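(* Let $(L,V)$ be a lattice pair of rank $r=[\mathfrak K:\mathbb F_q(T)]$ and dimension $n$ with complete multiplication by $\mathbf A_{\mathfrak K}$ of CM-type $\Phi$, and suppose its dual pair $(L',V')$ exists, so that $\mathbf A_{\mathfrak K}$ acts on $(L',V')$ by the dual (adjoint) action, with CM-type the complement $\Phi'$. Then $$\mathrm{Cl}(L',\Phi')=\mathrm{Cl}(\mathfrak d)^{-1}\,\mathrm{Cl}(L,\Phi)^{-1}$$ in $\mathrm{Cl}(\mathbf A_{\mathfrak K})$, where $\mathfrak d$ is the different ideal of $\mathbf A_{\mathfrak K}$ over $\mathbb F_q[\theta]$.
   Context: $\mathbb C_\infty$ is the completion of an algebraic closure of $\mathbb F_q((1/\theta))$; $\mathbb F_q(T)$ is identified with $\mathbb F_q(\theta)$ via $T\mapsto\theta$. $\mathfrak K$ is a finite separable extension of $\mathbb F_q(T)$ with $\mathfrak K\otimes_{\mathbb F_q}\mathbb C_\infty$ a field and exactly one place over $\infty$; $\mathbf A_{\mathfrak K}$ is the ring of elements regular outside that place; $\alpha_1,\dots,\alpha_r$ are the embeddings $\mathfrak K\to\mathbb C_\infty$ over $T\mapsto\theta$. A lattice of rank $r$ in $V=\mathbb C_\infty^n$ is a free $\mathbb F_q[\theta]$-submodule of rank $r$ spanning $V$ with $\mathbb F_q((1/\theta))$-span of dimension $r$. Complete multiplication by $\mathbf A_{\mathfrak K}$ of CM-type $\Phi\subset\{\alpha_1,\dots,\alpha_r\}$: an injective ring homomorphism from $\mathbf A_{\mathfrak K}$ to the $\mathbb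 C_\infty$-linear endomorphisms of $V$ preserving $L$, extending $T\mapsto\theta$, such that $V\cong\bigoplus_{\alpha\in\Phi}\alpha$ as a $\mathfrak K$-representation. Then $L$ is isomorphic as an $\mathbf A_{\mathfrak K}$-module to an ideal of $\mathbf A_{\mathfrak K}$, whose class is denoted $\mathrm{Cl}(L,\Phi)$. A dual pair $(L',V')$: $L'$ a lattice of rank $r$ in $V'$ with a perfect $\mathbb F_q[\theta]$-bilinear pairing $\langle\,,\rangle:L\times L'\to\mathbb F_q[\theta]$ such that $\dim V'=r-n$ and $V^*\to(L\otimes\mathbb C_\infty)^*\cong L'\otimes\mathbb C_\infty\to V'$ vanishes; the dual action of $a\in\mathbf A_{\mathfrak K}$ on $L'$ is defined by $\langle al,l'\rangle=\langle l,al'\rangle$, and $\mathrm{Cl}(L',\Phi')$ is the class of $L'$ as an $\mathbf A_{\mathfrak K}$-module under this action. *)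

theory Defs
  imports
    "HOL-Analysis.Analysis"
    "HOL-Computational_Algebra.Computational_Algebra"
    "HOL-Library.Multiset"
    "HOL-Algebra.Coset"
begin

text \<open>
  Conventions. The finite field \<open>F\<^sub>q\<close> is a type \<open>'k :: {field, finite}\<close>, so \<open>q = CARD('k)\<close>.
  \<open>F\<^sub>q[T]\<close> is \<open>'k poly\<close> and \<open>F\<^sub>q(T)\<close> is \<open>'k poly fract\<close>. \<open>F\<^sub>q((1/\<theta>))\<close> is \<open>'k fls\<close>, the
  formal variable being \<open>1/\<theta>\<close>, so that \<open>\<theta>\<close> is \<open>fls_X_inv\<close>. As \<open>F\<^sub>q[T]\<close> and \<open>F\<^sub>q[\<theta>]\<close> are
  identified, \<open>'k poly\<close> also serves as \<open>F\<^sub>q[\<theta>]\<close>.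
\<close>

definition unital_ring_hom :: "('a::ring_1 \<Rightarrow> 'b::ring_1) \<Rightarrow> bool" where
  "unital_ring_hom f \<longleftrightarrow>
     f 1 = 1 \<and> (\<forall>x y. f (x + y) = f x + f y) \<and> (\<forall>x y. f (x * y) = f x * f y)"


section \<open>The field \<open>C\<^sub>\<infinity>\<close>\<close>

definition algebraic_over :: "('a::field \<Rightarrow> 'b::field) \<Rightarrow> 'b \<Rightarrow> bool" where
  "algebraic_over f z \<longleftrightarrow> (\<exists>p. p \<noteq> 0 \<and> poly (map_poly f p) z = 0)"

text \<open>
  A completion of an algebraic closure of \<open>F\<^sub>q((1/\<theta>))\<close>: a complete non-archimedean valued field
  extending \<open>F\<^sub>q((1/\<theta>))\<close> with its absolute value (normalised by \<open>|\<theta>| = q\<close>), in which the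
  elements algebraic over \<open>F\<^sub>q((1/\<theta>))\<close> form an algebraically closed and dense subfield.
  These properties determine \<open>C\<^sub>\<infinity>\<close> up to isometric isomorphism.
\<close>

locale C_infinity =
  fixes emb :: "'k::{field,finite} fls \<Rightarrow> 'c::field"
    and cabs :: "'c \<Rightarrow> real"
  assumes emb_hom: "unital_ring_hom emb"
    and cabs_nonneg: "cabs x \<ge> 0"
    and cabs_eq_0_iff: "cabs x = 0 \<longleftrightarrow> x = 0"
    and cabs_mult: "cabs (x * y) = cabs x * cabs y"
    and cabs_add: "cabs (x + y) \<le> max (cabs x) (cabs y)"
    and cabs_emb: "f \<noteq> 0 \<Longrightarrow> cabs (emb f) = real CARD('k) powi (- fls_subdegree f)"
    and alg_closed:
      "degree p > 0 \<Longrightarrow> (\<forall>i. algebraic_over emb (coeff p i)) \<Longrightarrow>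
         \<exists>z. algebraic_over emb z \<and> poly p z = 0"
    and dense: "e > 0 \<Longrightarrow> \<exists>w. algebraic_over emb w \<and> cabs (z - w) < e"
    and complete:
      "(\<forall>e>0. \<exists>N. \<forall>i\<ge>N. \<forall>j\<ge>N. cabs (X i - X j) < e) \<Longrightarrow>
         \<exists>z. (\<lambda>i. cabs (X i - z)) \<longlonglongrightarrow> 0"

definition theta :: "('k::field fls \<Rightarrow> 'c::field) \<Rightarrow> 'c" where
  "theta emb = emb fls_X_inv"

definition const_C :: "('k::field fls \<Rightarrow> 'c::field) \<Rightarrow> 'k \<Rightarrow> 'c" where
  "const_C emb c = emb (fls_const c)"

definition eval_theta :: "('k::field fls \<Rightarrow> 'c::field) \<Rightarrow> 'k poly \<Rightarrow> 'c" where
  "eval_theta emb p = poly (map_poly (const_C emb) p) (theta emb)"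


section \<open>The field \<open>\<KK>\<close> and the ring \<open>A\<^sub>\<KK>\<close>\<close>

text \<open>Here \<open>\<iota>\<close> is the structure map from \<open>F\<^sub>q(T)\<close> to its extension field.\<close>

definition poly_K :: "('k::field poly fract \<Rightarrow> 'K::field) \<Rightarrow> 'k poly \<Rightarrow> 'K" where
  "poly_K \<iota> p = \<iota> (Fract p 1)"

definition const_K :: "('k::field poly fract \<Rightarrow> 'K::field) \<Rightarrow> 'k \<Rightarrow> 'K" where
  "const_K \<iota> c = poly_K \<iota> [:c:]"

definition T_K :: "('k::field poly fract \<Rightarrow> 'K::field) \<Rightarrow> 'K" where
  "T_K \<iota> = poly_K \<iota> [:0, 1:]"

definition scale_K :: "('k::field poly fract \<Rightarrow> 'K::field) \<Rightarrow> 'k poly fract \<Rightarrow> 'K \<Rightarrow> 'K" where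
  "scale_K \<iota> c x = \<iota> c * x"

definition degree_K :: "('k::field poly fract \<Rightarrow> 'K::field) \<Rightarrow> nat" where
  "degree_K \<iota> = vector_space.dim (scale_K \<iota>) UNIV"

definition finite_separable :: "('k::field poly fract \<Rightarrow> 'K::field) \<Rightarrow> bool" where
  "finite_separable \<iota> \<longleftrightarrow>
     unital_ring_hom \<iota> \<and>
     (\<exists>B. finite B \<and> module.span (scale_K \<iota>) B = UNIV) \<and>
     (\<forall>x. \<exists>p. irreducible p \<and> poly (map_poly \<iota> p) x = 0 \<and> coprime p (pderiv p))"

text \<open>A place is represented by its valuation ring; an element is regular there iff it lies in it.\<close>

definition places :: "('k::field poly fract \<Rightarrow> 'K::field) \<Rightarrow> 'K set set" where
  "places \<iota> =
     {R. range (const_K \<iota>) \<subseteq> R \<and> R \<noteq> UNIV \<and>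
         (\<forall>x\<in>R. \<forall>y\<in>R. x - y \<in> R \<and> x * y \<in> R) \<and>
         (\<forall>x. x \<noteq> 0 \<longrightarrow> x \<in> R \<or> inverse x \<in> R)}"

definition over_infinity :: "('k::field poly fract \<Rightarrow> 'K::field) \<Rightarrow> 'K set \<Rightarrow> bool" where
  "over_infinity \<iota> R \<longleftrightarrow> \<iota> -` R = {Fract f g | f g. g \<noteq> 0 \<and> degree f \<le> degree g}"

definition ring_A :: "('k::field poly fract \<Rightarrow> 'K::field) \<Rightarrow> 'K set" where
  "ring_A \<iota> = {x. \<forall>R\<in>places \<iota>. \<not> over_infinity \<iota> R \<longrightarrow> x \<in> R}"

definition embeddings ::
  "('k::field fls \<Rightarrow> 'c::field) \<Rightarrow> ('k poly fract \<Rightarrow> 'K::field) \<Rightarrow> ('K \<Rightarrow> 'c) set" where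
  "embeddings emb \<iota> =
     {\<alpha>. unital_ring_hom \<alpha> \<and> (\<forall>c. \<alpha> (const_K \<iota> c) = const_C emb c) \<and> \<alpha> (T_K \<iota>) = theta emb}"

text \<open>
  The tensor product of two commutative algebras over \<open>'k\<close> (structure maps \<open>s\<close> and \<open>t\<close>): a finite
  formal sum of pure tensors is a multiset of pairs, and \<open>tensor_eq\<close> is the congruence
  generated by the bilinearity relations.
\<close>

inductive tensor_eq ::
  "('k \<Rightarrow> 'a::comm_ring_1) \<Rightarrow> ('k \<Rightarrow> 'b::comm_ring_1) \<Rightarrow>
     ('a \<times> 'b) multiset \<Rightarrow> ('a \<times> 'b) multiset \<Rightarrow> bool"
  for s :: "'k \<Rightarrow> 'a" and t :: "'k \<Rightarrow> 'b"
where
  refl: "tensor_eq s t M M"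
| sym: "tensor_eq s t M N \<Longrightarrow> tensor_eq s t N M"
| trans: "tensor_eq s t M N \<Longrightarrow> tensor_eq s t N P \<Longrightarrow> tensor_eq s t M P"
| add: "tensor_eq s t M N \<Longrightarrow> tensor_eq s t (M + P) (N + P)"
| zero_left: "tensor_eq s t {#(0, b)#} {#}"
| zero_right: "tensor_eq s t {#(a, 0)#} {#}"
| add_left: "tensor_eq s t {#(a + a', b)#} {#(a, b), (a', b)#}"
| add_right: "tensor_eq s t {#(a, b + b')#} {#(a, b), (a, b')#}"
| scalar: "tensor_eq s t {#(s c * a, b)#} {#(a, t c * b)#}"

definition tensor_mult ::
  "('a::comm_ring_1 \<times> 'b::comm_ring_1) multiset \<Rightarrow> ('a \<times> 'b) multiset \<Rightarrow> ('a \<times> 'b) multiset" where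
  "tensor_mult M N = (\<Sum>(a, b)\<in>#M. {#(a * a', b * b'). (a', b') \<in># N#})"

text \<open>
  The requirement on \<open>\<KK> \<otimes> C\<^sub>\<infinity>\<close> (over \<open>F\<^sub>q\<close>) is that its total ring of fractions, which is
  \<open>\<KK> \<otimes> C\<^sub>\<infinity>(T)\<close> over \<open>F\<^sub>q(T)\<close>, is a field; equivalently the ring itself is an integral domain.
  The ring \<open>\<KK> \<otimes> C\<^sub>\<infinity>\<close> itself is never a field: \<open>T \<otimes> 1 - 1 \<otimes> \<theta>\<close> is nonzero but is
  killed by the unital homomorphisms \<open>x \<otimes> z \<mapsto> \<alpha>(x) z\<close>.
\<close>

definition tensor_domain :: "('k \<Rightarrow> 'a::comm_ring_1) \<Rightarrow> ('k \<Rightarrow> 'b::comm_ring_1) \<Rightarrow> bool" where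
  "tensor_domain s t \<longleftrightarrow>
     \<not> tensor_eq s t {#(1, 1)#} {#} \<and>
     (\<forall>M N. tensor_eq s t (tensor_mult M N) {#} \<longrightarrow> tensor_eq s t M {#} \<or> tensor_eq s t N {#})"


section \<open>Ideal classes and the different\<close>

definition ideal_of :: "'K::field set \<Rightarrow> 'K set \<Rightarrow> bool" where
  "ideal_of A I \<longleftrightarrow>
     I \<subseteq> A \<and> 0 \<in> I \<and> (\<forall>x\<in>I. \<forall>y\<in>I. x + y \<in> I) \<and> (\<forall>a\<in>A. \<forall>x\<in>I. a * x \<in> I)"

definition fractional_ideal :: "'K::field set \<Rightarrow> 'K set \<Rightarrow> bool" where
  "fractional_ideal A I \<longleftrightarrow> I \<noteq> {0} \<and> (\<exists>d\<in>A. d \<noteq> 0 \<and> ideal_of A ((*) d ` I))"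

definition ideal_mult :: "'K::field set \<Rightarrow> 'K set \<Rightarrow> 'K set" where
  "ideal_mult I J =
     {\<Sum>i<n. x i * y i | (n::nat) x y. \<forall>i<n. x i \<in> I \<and> y i \<in> J}"

definition ideal_group :: "'K::field set \<Rightarrow> 'K set monoid" where
  "ideal_group A = \<lparr>carrier = {I. fractional_ideal A I}, monoid.mult = ideal_mult, one = A\<rparr>"

definition principal_ideals :: "'K::field set \<Rightarrow> 'K set set" where
  "principal_ideals A = {(*) x ` A | x. x \<noteq> 0}"

definition class_group :: "'K::field set \<Rightarrow> 'K set set monoid" where
  "class_group A = ideal_group A Mod principal_ideals A"

definition ideal_class :: "'K::field set \<Rightarrow> 'K set \<Rightarrow> 'K set set" where
  "ideal_class A I = principal_ideals A #>\<^bsub>ideal_group A\<^esub> I"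

text \<open>\<open>act\<close> is the action of \<open>A\<close> on the additive group \<open>L\<close>.\<close>

definition module_iso ::
  "'K::field set \<Rightarrow> ('K \<Rightarrow> 'v \<Rightarrow> 'v) \<Rightarrow> 'v::ab_group_add set \<Rightarrow> 'K set \<Rightarrow> ('v \<Rightarrow> 'K) \<Rightarrow> bool" where
  "module_iso A act L I f \<longleftrightarrow>
     bij_betw f L I \<and> (\<forall>x\<in>L. \<forall>y\<in>L. f (x + y) = f x + f y) \<and>
     (\<forall>a\<in>A. \<forall>x\<in>L. f (act a x) = a * f x)"

definition module_class ::
  "'K::field set \<Rightarrow> ('K \<Rightarrow> 'v \<Rightarrow> 'v) \<Rightarrow> 'v::ab_group_add set \<Rightarrow> 'K set set" where
  "module_class A act L =
     (THE C. \<exists>I f. ideal_of A I \<and> I \<noteq> {0} \<and> module_iso A act L I f \<and> C = ideal_class A I)"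

definition trace_K :: "('k::field poly fract \<Rightarrow> 'K::field) \<Rightarrow> 'K \<Rightarrow> 'k poly fract" where
  "trace_K \<iota> x =
     (let B = (SOME B. \<not> module.dependent (scale_K \<iota>) B \<and> module.span (scale_K \<iota>) B = UNIV)
      in \<Sum>b\<in>B. module.representation (scale_K \<iota>) B (x * b) b)"

definition codifferent :: "('k::field poly fract \<Rightarrow> 'K::field) \<Rightarrow> 'K set" where
  "codifferent \<iota> = {x. \<forall>a\<in>ring_A \<iota>. trace_K \<iota> (x * a) \<in> range (\<lambda>p. Fract p 1)}"

definition different :: "('k::field poly fract \<Rightarrow> 'K::field) \<Rightarrow> 'K set" where
  "different \<iota> = {y. \<forall>x\<in>codifferent \<iota>. y * x \<in> ring_A \<iota>}"


section \<open>Lattices, complete multiplication, duality\<close>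

definition poly_scale ::
  "('k::field fls \<Rightarrow> 'c::field) \<Rightarrow> 'k poly \<Rightarrow> 'c ^ 'n \<Rightarrow> 'c ^ 'n" where
  "poly_scale emb p v = eval_theta emb p *s v"

definition fls_scale ::
  "('k::field fls \<Rightarrow> 'c::field) \<Rightarrow> 'k fls \<Rightarrow> 'c ^ 'n \<Rightarrow> 'c ^ 'n" where
  "fls_scale emb f v = emb f *s v"

definition lattice_of_rank ::
  "('k::field fls \<Rightarrow> 'c::field) \<Rightarrow> nat \<Rightarrow> ('c ^ 'n) set \<Rightarrow> bool" where
  "lattice_of_rank emb r L \<longleftrightarrow>
     (\<exists>B. finite B \<and> card B = r \<and> \<not> module.dependent (poly_scale emb) B \<and>
          L = module.span (poly_scale emb) B) \<and>
     vec.span L = UNIV \<and>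
     vector_space.dim (fls_scale emb) (module.span (fls_scale emb) L) = r"

text \<open>
  \<open>M\<close> is the extension of the action \<open>m\<close> from \<open>A\<^sub>\<KK>\<close> to its fraction field, and \<open>g\<close> is the
  isomorphism of \<open>\<KK>\<close>-representations from \<open>V\<close> to the direct sum of the \<open>\<alpha>\<close> in \<open>\<Phi>\<close>, whose
  elements are the families of elements of \<open>C\<^sub>\<infinity>\<close> supported on \<open>\<Phi>\<close>.
\<close>

definition has_CM_type ::
  "'K::field set \<Rightarrow> ('K \<Rightarrow> 'c::field ^ 'n \<Rightarrow> 'c ^ 'n) \<Rightarrow> ('K \<Rightarrow> 'c) set \<Rightarrow> bool" where
  "has_CM_type A m \<Phi> \<longleftrightarrow>
     (\<exists>M. (\<forall>a\<in>A. M a = m a) \<and>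
          (\<forall>x. Vector_Spaces.linear (*s) (*s) (M x)) \<and>
          M 1 = id \<and>
          (\<forall>x y v. M (x + y) v = M x v + M y v) \<and>
          (\<forall>x y. M (x * y) = M x \<circ> M y) \<and>
          (\<exists>g :: 'c ^ 'n \<Rightarrow> ('K \<Rightarrow> 'c) \<Rightarrow> 'c.
             bij_betw g UNIV {f. \<forall>\<alpha>. \<alpha> \<notin> \<Phi> \<longrightarrow> f \<alpha> = 0} \<and>
             (\<forall>v w \<alpha>. g (v + w) \<alpha> = g v \<alpha> + g w \<alpha>) \<and>
             (\<forall>c v \<alpha>. g (c *s v) \<alpha> = c * g v \<alpha>) \<and>
             (\<forall>x v. \<forall>\<alpha>\<in>\<Phi>. g (M x v) \<alpha> = \<alpha> x * g v \<alpha>)))"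

definition complete_multiplication ::
  "('k::field fls \<Rightarrow> 'c::field) \<Rightarrow> ('k poly fract \<Rightarrow> 'K::field) \<Rightarrow> ('c ^ 'n) set \<Rightarrow>
     ('K \<Rightarrow> 'c ^ 'n \<Rightarrow> 'c ^ 'n) \<Rightarrow> ('K \<Rightarrow> 'c) set \<Rightarrow> bool" where
  "complete_multiplication emb \<iota> L m \<Phi> \<longleftrightarrow>
     \<Phi> \<subseteq> embeddings emb \<iota> \<and>
     inj_on m (ring_A \<iota>) \<and>
     (\<forall>a\<in>ring_A \<iota>. Vector_Spaces.linear (*s) (*s) (m a) \<and> m a ` L \<subseteq> L) \<and>
     (\<forall>a\<in>ring_A \<iota>. \<forall>b\<in>ring_A \<iota>. \<forall>v. m (a + b) v = m a v + m b v) \<and>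
     (\<forall>a\<in>ring_A \<iota>. \<forall>b\<in>ring_A \<iota>. m (a * b) = m a \<circ> m b) \<and>
     (\<forall>p v. m (poly_K \<iota> p) v = poly_scale emb p v) \<and>
     has_CM_type (ring_A \<iota>) m \<Phi>"

definition poly_linear_on ::
  "('k::field fls \<Rightarrow> 'c::field) \<Rightarrow> ('c ^ 'n) set \<Rightarrow> ('c ^ 'n \<Rightarrow> 'k poly) \<Rightarrow> bool" where
  "poly_linear_on emb L f \<longleftrightarrow>
     (\<forall>x\<in>L. \<forall>y\<in>L. f (x + y) = f x + f y) \<and>
     (\<forall>p. \<forall>x\<in>L. f (poly_scale emb p x) = p * f x)"

definition perfect_pairing ::
  "('k::field fls \<Rightarrow> 'c::field) \<Rightarrow> ('c ^ 'n) set \<Rightarrow> ('c ^ 'm) set \<Rightarrow>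
     ('c ^ 'n \<Rightarrow> 'c ^ 'm \<Rightarrow> 'k poly) \<Rightarrow> bool" where
  "perfect_pairing emb L L' \<beta> \<longleftrightarrow>
     (\<forall>l'\<in>L'. poly_linear_on emb L (\<lambda>l. \<beta> l l')) \<and>
     (\<forall>l\<in>L. poly_linear_on emb L' (\<lambda>l'. \<beta> l l')) \<and>
     (\<forall>f. poly_linear_on emb L f \<longrightarrow> (\<exists>!l'. l' \<in> L' \<and> (\<forall>l\<in>L. f l = \<beta> l l'))) \<and>
     (\<forall>f. poly_linear_on emb L' f \<longrightarrow> (\<exists>!l. l \<in> L \<and> (\<forall>l'\<in>L'. f l' = \<beta> l l')))"

text \<open>
  The last clause says that the composite \<open>V\<^sup>* \<rightarrow> (L \<otimes> C\<^sub>\<infinity>)\<^sup>* \<cong> L' \<otimes> C\<^sub>\<infinity> \<rightarrow> V'\<close> vanishes. The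
  multiset \<open>M\<close> is a formal sum of pure tensors \<open>l' \<otimes> c\<close>; it represents the image in
  \<open>L' \<otimes> C\<^sub>\<infinity>\<close> of the linear form \<open>\<phi>\<close> iff \<open>\<phi> l = \<Sum> c \<langle>l, l'\<rangle>\<close> for all \<open>l\<close> in \<open>L\<close>, and its
  image in \<open>V'\<close> is \<open>\<Sum> c l'\<close>.
\<close>

definition dual_pair ::
  "('k::field fls \<Rightarrow> 'c::field) \<Rightarrow> nat \<Rightarrow> ('c ^ 'n) set \<Rightarrow> ('c ^ 'm) set \<Rightarrow>
     ('c ^ 'n \<Rightarrow> 'c ^ 'm \<Rightarrow> 'k poly) \<Rightarrow> bool" where
  "dual_pair emb r L L' \<beta> \<longleftrightarrow>
     lattice_of_rank emb r L' \<and>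
     CARD('n) + CARD('m) = r \<and>
     perfect_pairing emb L L' \<beta> \<and>
     (\<forall>\<phi> :: 'c ^ 'n \<Rightarrow> 'c. \<forall>M :: (('c ^ 'm) \<times> 'c) multiset.
        Vector_Spaces.linear (*s) (*) \<phi> \<longrightarrow>
        (\<forall>(l', c)\<in>#M. l' \<in> L') \<longrightarrow>
        (\<forall>l\<in>L. \<phi> l = (\<Sum>(l', c)\<in>#M. c * eval_theta emb (\<beta> l l'))) \<longrightarrow>
        (\<Sum>(l', c)\<in>#M. c *s l') = 0)"

definition dual_action ::
  "('v \<Rightarrow> 'w \<Rightarrow> 'p) \<Rightarrow> 'v set \<Rightarrow> 'w set \<Rightarrow> ('K \<Rightarrow> 'v \<Rightarrow> 'v) \<Rightarrow> 'K \<Rightarrow> 'w \<Rightarrow> 'w" where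
  "dual_action \<beta> L L' m a l' = (THE y. y \<in> L' \<and> (\<forall>l\<in>L. \<beta> (m a l) l' = \<beta> l y))"

end

theory Submission
  imports Defs "HOL-Library.Function_Algebras"
begin

text \<open>
  Fixing a nonzero \<open>l\<^sub>0\<close> in \<open>L\<close>, the map \<open>x \<mapsto> x l\<^sub>0\<close> from \<open>\<KK>\<close> is an isomorphism
  onto the \<open>F\<^sub>q(T)\<close>-span of \<open>L\<close>, both having dimension \<open>r\<close>; so \<open>L\<close> becomes a fractional
  ideal \<open>J\<close>. The trace form is nondegenerate by separability, so the pairing turns \<open>L'\<close> into
  \<open>J' = {y. Tr (y J) \<subseteq> F\<^sub>q[T]} = {y. y J \<subseteq> D}\<close> with \<open>D\<close> the codifferent. Since \<open>A\<close> is a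
  Pruefer domain, \<open>J\<close> and \<open>J'\<close> are invertible, hence \<open>J' J = D\<close>, and \<open>D\<close> is inverse to the
  different.

  For the CM type, let \<open>b'\<close> be the basis of \<open>L'\<close> dual to a basis \<open>b\<close> of \<open>L\<close>, and put
  \<open>w\<^sub>\<alpha> = \<Sum>\<^sub>b \<alpha>(b) b'\<close> in \<open>V'\<close>, where \<open>b\<close> is read in \<open>\<KK>\<close>. As the trace is the sum of the
  embeddings, \<open>l' = \<Sum>\<^sub>\<alpha> \<alpha>(l') w\<^sub>\<alpha>\<close> for \<open>l'\<close> in \<open>L'\<close>, while \<open>w\<^sub>\<alpha> = 0\<close> for \<open>\<alpha>\<close> in \<open>\<Phi>\<close>
  by the vanishing condition; counting dimensions, the \<open>w\<^sub>\<alpha>\<close> with \<open>\<alpha>\<close> in \<open>\<Phi>'\<close> form a basis of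
  eigenvectors of \<open>V'\<close>.
\<close>

section \<open>Ring homomorphisms and Bezout's identity\<close>

locale unital_hom =
  fixes f :: "'a::comm_ring_1 \<Rightarrow> 'b::comm_ring_1"
  assumes unital_ring_hom: "unital_ring_hom f"
begin

lemma hom_one [simp]: "f 1 = 1"
  and hom_add [simp]: "f (x + y) = f x + f y"
  and hom_mult [simp]: "f (x * y) = f x * f y"
  using unital_ring_hom by (auto simp: unital_ring_hom_def)

lemma hom_zero [simp]: "f 0 = 0"
  using hom_add[of 0 0] by (simp del: hom_add)

lemma hom_minus [simp]: "f (- x) = - f x"
  using hom_add[of x "- x"] by (simp add: eq_neg_iff_add_eq_0 add.commute del: hom_add)

lemma hom_diff [simp]: "f (x - y) = f x - f y"
  using hom_add[of x "- y"] by simp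

lemma hom_sum [simp]: "f (sum g S) = (\<Sum>s\<in>S. f (g s))"
  by (induction S rule: infinite_finite_induct) simp_all

lemma unital_hom_map_poly: "unital_hom (map_poly f)"
  by unfold_locales (auto simp: unital_ring_hom_def poly_eq_iff coeff_map_poly coeff_mult)

end

locale field_hom = unital_hom f for f :: "'a::field \<Rightarrow> 'b::field"
begin

lemma hom_eq_0_iff [simp]: "f x = 0 \<longleftrightarrow> x = 0"
proof
  assume "f x = 0"
  then have "f (x * inverse x) = 0" by simp
  then show "x = 0" by (metis hom_one right_inverse zero_neq_one)
qed simp

lemma hom_eq_iff [simp]: "f x = f y \<longleftrightarrow> x = y"
  using hom_eq_0_iff[of "x - y"] by (simp del: hom_eq_0_iff)

lemma hom_inverse [simp]: "f (inverse x) = inverse (f x)"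
proof (cases "x = 0")
  case False
  then have "f x * f (inverse x) = 1" by (simp flip: hom_mult)
  then show ?thesis by (metis inverse_unique)
qed simp

lemma hom_divide [simp]: "f (x / y) = f x / f y"
  by (simp add: divide_inverse)

lemma map_poly_pderiv: "map_poly f (pderiv p) = pderiv (map_poly f p)"
proof -
  have "f (of_nat n) = of_nat n" for n by (induction n) simp_all
  then show ?thesis by (simp add: poly_eq_iff coeff_map_poly coeff_pderiv del: of_nat_Suc)
qed

lemma vector_space_hom: "vector_space (\<lambda>c x. f c * x)"
  by unfold_locales (simp_all add: algebra_simps)

end

lemma linear_combination_dvd:
  fixes x :: "'i \<Rightarrow> 'a::euclidean_ring"
  assumes "finite I"
  obtains c where "\<And>i. i \<in> I \<Longrightarrow> (\<Sum>k\<in>I. c k * x k) dvd x i"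
proof -
  define comb where "comb c = (\<Sum>k\<in>I. c k * x k)" for c
  have comb_indicator: "comb (\<lambda>k. if k = i then 1 else 0) = x i" if "i \<in> I" for i
    using assms that by (simp add: comb_def if_distrib[of "\<lambda>a. a * _"] cong: if_cong)
  show ?thesis
  proof (cases "\<exists>c. comb c \<noteq> 0")
    case True
    then obtain c where comb_nonzero: "comb c \<noteq> 0"
      and minimal: "\<And>e. comb e \<noteq> 0 \<Longrightarrow> euclidean_size (comb c) \<le> euclidean_size (comb e)"
      using exists_least_iff[of "\<lambda>n. \<exists>c. comb c \<noteq> 0 \<and> euclidean_size (comb c) = n"]
      by (metis not_less)
    have "comb c dvd x i" if "i \<in> I" for i
    proof -
      define e where "e k = (if k = i then 1 else 0) - x i div comb c * c k" for k
      have "comb e = comb (\<lambda>k. if k = i then 1 else 0) - x i div comb c * comb c"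
        by (simp add: comb_def e_def left_diff_distrib sum_subtractf sum_distrib_left mult.assoc)
      then have "comb e = x i mod comb c" by (simp add: comb_indicator[OF that] minus_div_mult_eq_mod)
      then have "x i mod comb c = 0"
        using minimal[of e] mod_size_less[OF comb_nonzero, of "x i"] by fastforce
      then show ?thesis by blast
    qed
    then show ?thesis unfolding comb_def by (rule that)
  next
    case False
    then have "x i = 0" if "i \<in> I" for i using comb_indicator[OF that] by metis
    then show ?thesis using that by simp
  qed
qed

lemma coprime_bezout:
  fixes a b :: "'a::euclidean_ring"
  assumes "coprime a b"
  obtains u v where "u * a + v * b = 1"
proof -
  define x where "x i = (if i then a else b)" for i
  obtain c where comb_dvd: "\<And>i. (\<Sum>k\<in>UNIV. c k * x k) dvd x i"
    using linear_combination_dvd[of "UNIV :: bool set"] by auto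
  have "c True * a + c False * b dvd a" "c True * a + c False * b dvd b"
    using comb_dvd[of True] comb_dvd[of False] by (simp_all add: UNIV_bool x_def add.commute)
  then have "c True * a + c False * b dvd 1" using assms by (simp add: coprime_def)
  then obtain e where "1 = (c True * a + c False * b) * e" by blast
  then have "(e * c True) * a + (e * c False) * b = 1" by (simp add: algebra_simps)
  then show ?thesis by (rule that)
qed

section \<open>Valuation rings\<close>

locale valuation_ring =
  fixes R :: "'K::field set"
  assumes diff_closed: "x \<in> R \<Longrightarrow> y \<in> R \<Longrightarrow> x - y \<in> R"
    and mult_closed: "x \<in> R \<Longrightarrow> y \<in> R \<Longrightarrow> x * y \<in> R"
    and inverse_closed: "x \<noteq> 0 \<Longrightarrow> x \<in> R \<or> inverse x \<in> R"
begin

lemma one_closed: "1 \<in> R"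
  using inverse_closed[of 1] by simp

lemma zero_closed: "0 \<in> R"
  using diff_closed[OF one_closed one_closed] by simp

lemma uminus_closed: "x \<in> R \<Longrightarrow> - x \<in> R"
  using diff_closed[OF zero_closed] by simp

lemma add_closed: "x \<in> R \<Longrightarrow> y \<in> R \<Longrightarrow> x + y \<in> R"
  using diff_closed[OF _ uminus_closed] by simp

lemma power_closed: "x \<in> R \<Longrightarrow> x ^ n \<in> R"
  by (induction n) (auto intro: one_closed mult_closed)

lemma inverse_if_notin: "x \<notin> R \<Longrightarrow> inverse x \<in> R"
  using inverse_closed zero_closed by (cases "x = 0") auto

lemma power_notin:
  assumes "x \<notin> R" "n > 0"
  shows "x ^ n \<notin> R"
proof
  assume "x ^ n \<in> R"
  obtain k where n_eq: "n = Suc k" using assms(2) by (cases n) auto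
  have "x = x ^ n * inverse x ^ k"
    using assms(1) zero_closed by (cases "x = 0") (simp_all add: n_eq power_inverse)
  then show False
    using assms(1) mult_closed[OF \<open>x ^ n \<in> R\<close> power_closed[OF inverse_if_notin[OF assms(1)]]] by metis
qed

lemma add_unit_ratio:
  assumes "x \<notin> R" "y \<in> R"
  shows "x + y \<noteq> 0" "inverse x * (x + y) \<in> R" "inverse (inverse x * (x + y)) \<in> R"
proof -
  have x_inverse: "x \<noteq> 0" "inverse x \<in> R" using assms zero_closed inverse_if_notin by auto
  have sum_notin: "x + y \<notin> R" using assms diff_closed[of "x + y" y] by auto
  then show "x + y \<noteq> 0" using zero_closed by auto
  have "inverse x * (x + y) = 1 + inverse x * y" using x_inverse by (simp add: distrib_left)
  then show "inverse x * (x + y) \<in> R"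
    using add_closed[OF one_closed mult_closed[OF x_inverse(2) assms(2)]] by (simp only:)
  have "inverse (inverse x * (x + y)) = 1 - inverse (x + y) * y"
    using \<open>x + y \<noteq> 0\<close> by (simp add: field_simps)
  then show "inverse (inverse x * (x + y)) \<in> R"
    using diff_closed[OF one_closed mult_closed[OF inverse_if_notin[OF sum_notin] assms(2)]]
    by (simp only:)
qed

lemma linear_quotient_coeffs:
  assumes product_coeffs: "\<And>i. coeff ([:- y, 1:] * h) i \<in> R"
  shows "coeff h i \<in> R \<and> y * coeff h i \<in> R"
proof (cases "y \<in> R")
  case y_in_R: True
  have "coeff h i \<in> R" for i
  proof (cases "i \<le> degree h")
    case True
    then show ?thesis
    proof (induction rule: inc_induct)
      case base
      show ?case using product_coeffs[of "Suc (degree h)"] by (simp add: coeff_eq_0)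
    next
      case (step n)
      have "coeff h n = coeff ([:- y, 1:] * h) (Suc n) + y * coeff h (Suc n)" by simp
      then show ?case using add_closed[OF product_coeffs mult_closed[OF y_in_R step.IH]] by metis
    qed
  qed (simp add: coeff_eq_0 zero_closed)
  then show ?thesis using y_in_R mult_closed by blast
next
  case False
  then have y_inverse: "y \<noteq> 0" "inverse y \<in> R" using zero_closed inverse_if_notin by auto
  have divide_y: "coeff h i \<in> R" if "y * coeff h i \<in> R" for i
    using mult_closed[OF y_inverse(2) that] y_inverse(1) by (simp add: mult.assoc[symmetric])
  have "y * coeff h i \<in> R"
  proof (induction i)
    case 0
    show ?case using uminus_closed[OF product_coeffs[of 0]] by simp
  next
    case (Suc i)
    have "y * coeff h (Suc i) = coeff h i - coeff ([:- y, 1:] * h) (Suc i)" by simp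
    then show ?case using diff_closed[OF divide_y[OF Suc] product_coeffs] by metis
  qed
  then show ?thesis using divide_y by blast
qed

end

section \<open>Products of ideals\<close>

lemma ideal_mult_zero: "0 \<in> ideal_mult I J"
  unfolding ideal_mult_def by (auto intro!: exI[of _ "0::nat"])

lemma ideal_mult_add_product:
  assumes "z \<in> ideal_mult I J" "x \<in> I" "y \<in> J"
  shows "z + x * y \<in> ideal_mult I J"
proof -
  obtain n :: nat and a b where z_eq: "z = (\<Sum>i<n. a i * b i)" "\<forall>i<n. a i \<in> I \<and> b i \<in> J"
    using assms(1) unfolding ideal_mult_def by blast
  have "z + x * y = (\<Sum>i<Suc n. (a(n := x)) i * (b(n := y)) i)" by (simp add: z_eq)
  moreover have "\<forall>i<Suc n. (a(n := x)) i \<in> I \<and> (b(n := y)) i \<in> J" using z_eq assms by auto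
  ultimately show ?thesis unfolding ideal_mult_def by blast
qed

lemma ideal_mult_product: "x \<in> I \<Longrightarrow> y \<in> J \<Longrightarrow> x * y \<in> ideal_mult I J"
  using ideal_mult_add_product[OF ideal_mult_zero] by fastforce

lemma ideal_mult_induct [consumes 1, case_names zero add]:
  assumes "z \<in> ideal_mult I J" "Q 0" "\<And>z x y. Q z \<Longrightarrow> x \<in> I \<Longrightarrow> y \<in> J \<Longrightarrow> Q (z + x * y)"
  shows "Q z"
proof -
  obtain n :: nat and a b where z_eq: "z = (\<Sum>i<n. a i * b i)" "\<forall>i<n. a i \<in> I \<and> b i \<in> J"
    using assms(1) unfolding ideal_mult_def by blast
  have "Q (\<Sum>i<k. a i * b i)" if "k \<le> n" for k
    using that z_eq(2) by (induction k) (auto intro: assms(2,3))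
  then show ?thesis using z_eq by blast
qed

lemma ideal_mult_add:
  assumes "w \<in> ideal_mult I J" "z \<in> ideal_mult I J"
  shows "w + z \<in> ideal_mult I J"
  using assms(2)
proof (induction rule: ideal_mult_induct)
  case (add z x y)
  then show ?case using ideal_mult_add_product[of "w + z"] by (simp add: add.assoc)
qed (simp add: assms)

lemma ideal_mult_sum: "(\<And>s. s \<in> S \<Longrightarrow> g s \<in> ideal_mult I J) \<Longrightarrow> sum g S \<in> ideal_mult I J"
  by (induction S rule: infinite_finite_induct) (auto intro: ideal_mult_zero ideal_mult_add)

lemma ideal_mult_least:
  assumes "0 \<in> Q" "\<And>w z. w \<in> Q \<Longrightarrow> z \<in> Q \<Longrightarrow> w + z \<in> Q" "\<And>x y. x \<in> I \<Longrightarrow> y \<in> J \<Longrightarrow> x * y \<in> Q"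
  shows "ideal_mult I J \<subseteq> Q"
proof
  fix z assume "z \<in> ideal_mult I J"
  then show "z \<in> Q" by (induction rule: ideal_mult_induct) (auto intro: assms)
qed

lemma ideal_mult_mono: "I \<subseteq> I' \<Longrightarrow> J \<subseteq> J' \<Longrightarrow> ideal_mult I J \<subseteq> ideal_mult I' J'"
  by (intro ideal_mult_least ideal_mult_zero ideal_mult_add) (auto intro: ideal_mult_product)

lemma ideal_mult_commute: "ideal_mult I J = ideal_mult J I"
proof -
  have "ideal_mult I J \<subseteq> ideal_mult J I" for I J :: "'a set"
    by (intro ideal_mult_least ideal_mult_zero ideal_mult_add) (metis ideal_mult_product mult.commute)+
  then show ?thesis by blast
qed

lemma ideal_mult_mult_left:
  assumes "\<And>x. x \<in> I \<Longrightarrow> a * x \<in> I'" "z \<in> ideal_mult I J"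
  shows "a * z \<in> ideal_mult I' J"
  using assms(2)
proof (induction rule: ideal_mult_induct)
  case (add z x y)
  then show ?case using ideal_mult_add_product[of "a * z" I' J "a * x" y] assms(1)
    by (simp add: algebra_simps)
qed (simp add: ideal_mult_zero)

lemma ideal_mult_assoc: "ideal_mult (ideal_mult I J) K = ideal_mult I (ideal_mult J K)"
proof -
  have subset: "ideal_mult (ideal_mult I J) K \<subseteq> ideal_mult I (ideal_mult J K)" for I J K :: "'a set"
  proof (intro ideal_mult_least ideal_mult_zero ideal_mult_add)
    fix x z assume "x \<in> ideal_mult I J" and z_in_K: "z \<in> K"
    then show "x * z \<in> ideal_mult I (ideal_mult J K)"
    proof (induction rule: ideal_mult_induct)
      case (add w x y)
      then show ?case
        using ideal_mult_add_product[of "w * z" I "ideal_mult J K" x "y * z"]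
          ideal_mult_product[of y J z K]
        by (simp add: algebra_simps)
    qed (simp add: ideal_mult_zero)
  qed
  have "ideal_mult I (ideal_mult J K) = ideal_mult (ideal_mult K J) I"
    by (simp add: ideal_mult_commute)
  also have "\<dots> \<subseteq> ideal_mult K (ideal_mult J I)" by (rule subset)
  also have "\<dots> = ideal_mult (ideal_mult I J) K" by (simp add: ideal_mult_commute)
  finally show ?thesis using subset[of I J K] by blast
qed

lemma ideal_mult_scale_left: "ideal_mult ((*) x ` I) J = (*) x ` ideal_mult I J"
proof
  show "ideal_mult ((*) x ` I) J \<subseteq> (*) x ` ideal_mult I J"
  proof (intro ideal_mult_least)
    show "0 \<in> (*) x ` ideal_mult I J" using ideal_mult_zero by (metis imageI mult_zero_right)
  next
    fix w z assume "w \<in> (*) x ` ideal_mult I J" "z \<in> (*) x ` ideal_mult I J"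
    then show "w + z \<in> (*) x ` ideal_mult I J"
      by (auto simp flip: distrib_left intro: ideal_mult_add)
  qed (auto simp: mult.assoc intro: ideal_mult_product)
  show "(*) x ` ideal_mult I J \<subseteq> ideal_mult ((*) x ` I) J"
    using ideal_mult_mult_left[of I x "(*) x ` I"] by blast
qed

lemma ideal_mult_scale: "ideal_mult ((*) x ` I) ((*) y ` J) = (*) (x * y) ` ideal_mult I J"
  using ideal_mult_scale_left[of y J I]
  by (simp add: ideal_mult_scale_left ideal_mult_commute[of I] image_image mult.assoc)

definition submodule_of :: "'K::field set \<Rightarrow> 'K set \<Rightarrow> bool" where
  "submodule_of A I \<longleftrightarrow> 0 \<in> I \<and> (\<forall>x\<in>I. \<forall>y\<in>I. x + y \<in> I) \<and> (\<forall>a\<in>A. \<forall>x\<in>I. a * x \<in> I)"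

definition ideal_inverse :: "'K::field set \<Rightarrow> 'K set \<Rightarrow> 'K set" where
  "ideal_inverse A I = {y. \<forall>x\<in>I. y * x \<in> A}"

text \<open>
  For a set \<open>S\<close> that is not a submodule this says that the submodule generated by \<open>S\<close> is invertible.
\<close>

definition invertible_over :: "'K::field set \<Rightarrow> 'K set \<Rightarrow> bool" where
  "invertible_over A S \<longleftrightarrow> 1 \<in> ideal_mult S (ideal_inverse A S)"

lemma submodule_zero: "submodule_of A I \<Longrightarrow> 0 \<in> I"
  and submodule_add: "submodule_of A I \<Longrightarrow> x \<in> I \<Longrightarrow> y \<in> I \<Longrightarrow> x + y \<in> I"
  and submodule_mult: "submodule_of A I \<Longrightarrow> a \<in> A \<Longrightarrow> x \<in> I \<Longrightarrow> a * x \<in> I"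
  by (auto simp: submodule_of_def)

lemma ideal_mult_subset_submodule:
  assumes "submodule_of A Q" "\<And>x y. x \<in> I \<Longrightarrow> y \<in> J \<Longrightarrow> x * y \<in> Q"
  shows "ideal_mult I J \<subseteq> Q"
  by (intro ideal_mult_least submodule_zero[OF assms(1)] submodule_add[OF assms(1)] assms(2))

lemma submodule_ideal_mult:
  assumes "submodule_of A I"
  shows "submodule_of A (ideal_mult I J)"
  using ideal_mult_mult_left[of I _ I _ J] submodule_mult[OF assms] unfolding submodule_of_def
  by (auto intro: ideal_mult_zero ideal_mult_add)

lemma submodule_scale:
  assumes "submodule_of A I"
  shows "submodule_of A ((*) c ` I)"
  unfolding submodule_of_def
proof (intro conjI ballI)
  show "0 \<in> (*) c ` I" using submodule_zero[OF assms] by (metis imageI mult_zero_right)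
  show "x + y \<in> (*) c ` I" if "x \<in> (*) c ` I" "y \<in> (*) c ` I" for x y
    using that submodule_add[OF assms] by (auto simp flip: distrib_left)
  show "a * x \<in> (*) c ` I" if "a \<in> A" "x \<in> (*) c ` I" for a x
    using that submodule_mult[OF assms] by (auto simp: mult.left_commute[of a])
qed

lemma submodule_scale_iff:
  assumes "c \<noteq> 0"
  shows "submodule_of A ((*) c ` I) \<longleftrightarrow> submodule_of A I"
proof
  have "(*) (inverse c) ` (*) c ` I = I" using assms by (simp add: image_image flip: mult.assoc)
  then show "submodule_of A I" if "submodule_of A ((*) c ` I)"
    using submodule_scale[OF that, of "inverse c"] by simp
qed (rule submodule_scale)

lemma fractional_ideal_iff:
  "fractional_ideal A I \<longleftrightarrow>
     submodule_of A I \<and> I \<noteq> {0} \<and> (\<exists>d\<in>A. d \<noteq> 0 \<and> (\<forall>x\<in>I. d * x \<in> A))"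
proof -
  have "ideal_of A ((*) d ` I) \<longleftrightarrow> submodule_of A I \<and> (\<forall>x\<in>I. d * x \<in> A)" if "d \<noteq> 0" for d
    using submodule_scale_iff[OF that, of A I] by (auto simp: ideal_of_def submodule_of_def)
  then show ?thesis unfolding fractional_ideal_def by blast
qed

section \<open>The ideal class group of a subring of a field\<close>

locale fraction_subring =
  fixes A :: "'K::field set"
  assumes zero_closed: "0 \<in> A" and one_closed: "1 \<in> A" and uminus_closed: "x \<in> A \<Longrightarrow> - x \<in> A"
    and add_closed: "x \<in> A \<Longrightarrow> y \<in> A \<Longrightarrow> x + y \<in> A"
    and mult_closed: "x \<in> A \<Longrightarrow> y \<in> A \<Longrightarrow> x * y \<in> A"
    and denominator_exists: "\<exists>d\<in>A. d \<noteq> 0 \<and> d * x \<in> A"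
begin

lemma submodule_self: "submodule_of A A"
  by (simp add: submodule_of_def zero_closed add_closed mult_closed)

lemma ideal_mult_one:
  assumes "submodule_of A I"
  shows "ideal_mult A I = I"
proof
  show "ideal_mult A I \<subseteq> I" by (rule ideal_mult_subset_submodule[OF assms submodule_mult[OF assms]])
  show "I \<subseteq> ideal_mult A I" using ideal_mult_product[OF one_closed] by fastforce
qed

lemma submodule_ideal_inverse: "submodule_of A (ideal_inverse A I)"
  by (auto simp: submodule_of_def ideal_inverse_def zero_closed distrib_right add_closed mult.assoc
    mult_closed)

lemma ideal_mult_inverse_subset: "ideal_mult I (ideal_inverse A I) \<subseteq> A"
proof (rule ideal_mult_subset_submodule[OF submodule_self])
  fix x y assume "x \<in> I" "y \<in> ideal_inverse A I"
  then have "y * x \<in> A" by (simp add: ideal_inverse_def)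
  then show "x * y \<in> A" by (simp only: mult.commute)
qed

lemma ideal_mult_inverse:
  assumes "submodule_of A I" "invertible_over A I"
  shows "ideal_mult I (ideal_inverse A I) = A"
proof
  show "A \<subseteq> ideal_mult I (ideal_inverse A I)"
    using submodule_mult[OF submodule_ideal_mult[OF assms(1)]] assms(2)
    unfolding invertible_over_def by fastforce
qed (rule ideal_mult_inverse_subset)

lemma ideal_inverse_if_mult_eq:
  assumes submodule: "submodule_of A J" and mult_eq: "ideal_mult I J = A"
  shows "ideal_inverse A I = J"
proof
  show "J \<subseteq> ideal_inverse A I"
    using mult_eq ideal_mult_product[of _ J _ I] unfolding ideal_mult_commute[of I] ideal_inverse_def
    by blast
  have "ideal_inverse A I = ideal_mult (ideal_mult J I) (ideal_inverse A I)"
    by (simp add: mult_eq ideal_mult_one submodule_ideal_inverse ideal_mult_commute[of J])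
  also have "\<dots> \<subseteq> ideal_mult J A"
    unfolding ideal_mult_assoc by (intro ideal_mult_mono ideal_mult_inverse_subset order.refl)
  also have "\<dots> = J" by (simp add: ideal_mult_commute[of J] ideal_mult_one[OF submodule])
  finally show "ideal_inverse A I \<subseteq> J" .
qed

lemma invertible_over_if_mult_eq:
  assumes "submodule_of A J" "ideal_mult I J = A"
  shows "invertible_over A I"
  using assms ideal_inverse_if_mult_eq[OF assms] one_closed by (simp add: invertible_over_def)

lemma invertible_over_mult:
  assumes I_invertible: "submodule_of A I" "invertible_over A I"
    and J_invertible: "submodule_of A J" "invertible_over A J"
  shows "invertible_over A (ideal_mult I J)"
proof (rule invertible_over_if_mult_eq)
  let ?I' = "ideal_inverse A I" and ?J' = "ideal_inverse A J"
  show "submodule_of A (ideal_mult ?I' ?J')" by (intro submodule_ideal_mult submodule_ideal_inverse)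
  have "ideal_mult (ideal_mult I J) (ideal_mult ?I' ?J') =
    ideal_mult (ideal_mult I ?I') (ideal_mult J ?J')"
    by (metis ideal_mult_assoc ideal_mult_commute)
  then show "ideal_mult (ideal_mult I J) (ideal_mult ?I' ?J') = A"
    by (simp add: ideal_mult_inverse I_invertible J_invertible ideal_mult_one submodule_self)
qed

lemma colon_eq_mult_inverse:
  assumes J_invertible: "submodule_of A J" "invertible_over A J" and D_submodule: "submodule_of A D"
  shows "{y. \<forall>x\<in>J. y * x \<in> D} = ideal_mult D (ideal_inverse A J)"
proof
  show "ideal_mult D (ideal_inverse A J) \<subseteq> {y. \<forall>x\<in>J. y * x \<in> D}"
  proof (rule ideal_mult_least)
    fix x y assume x_in_D: "x \<in> D" and y_mem: "y \<in> ideal_inverse A J"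
    have "(y * z) * x \<in> D" if "z \<in> J" for z
      using submodule_mult[OF D_submodule _ x_in_D] y_mem that by (simp add: ideal_inverse_def)
    then show "x * y \<in> {y. \<forall>x\<in>J. y * x \<in> D}" by (simp add: mult_ac)
  qed (auto simp: distrib_right submodule_zero[OF D_submodule] submodule_add[OF D_submodule])
  show "{y. \<forall>x\<in>J. y * x \<in> D} \<subseteq> ideal_mult D (ideal_inverse A J)"
  proof
    fix y assume y_mem: "y \<in> {y. \<forall>x\<in>J. y * x \<in> D}"
    have "y * 1 \<in> ideal_mult D (ideal_inverse A J)"
      using y_mem J_invertible(2) unfolding invertible_over_def by (intro ideal_mult_mult_left[of J]) auto
    then show "y \<in> ideal_mult D (ideal_inverse A J)" by simp
  qed
qed

lemma common_denominator:
  assumes "finite S"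
  shows "\<exists>d\<in>A. d \<noteq> 0 \<and> (\<forall>x\<in>S. d * x \<in> A)"
  using assms
proof (induction S)
  case (insert y S)
  then obtain d where d_denominator: "d \<in> A" "d \<noteq> 0" "\<forall>x\<in>S. d * x \<in> A" by blast
  obtain e where e_denominator: "e \<in> A" "e \<noteq> 0" "e * y \<in> A" using denominator_exists by blast
  have "e * d * y \<in> A" using mult_closed[OF d_denominator(1) e_denominator(3)] by (simp add: mult_ac)
  moreover have "e * d * x \<in> A" if "x \<in> S" for x
    using d_denominator(3) that mult_closed[OF e_denominator(1), of "d * x"] by (simp add: mult.assoc)
  ultimately show ?case using d_denominator e_denominator mult_closed by (intro bexI[of _ "e * d"]) auto
qed (use one_closed in \<open>auto intro!: bexI[of _ 1]\<close>)

lemma fractional_ideal_if_invertible: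
  assumes I_invertible: "submodule_of A I" "invertible_over A I"
  shows "fractional_ideal A I"
proof -
  obtain n :: nat and x y
    where one_eq: "1 = (\<Sum>i<n. x i * y i)" and factors: "\<And>i. i < n \<Longrightarrow> x i \<in> I \<and> y i \<in> ideal_inverse A I"
    using I_invertible(2) unfolding invertible_over_def ideal_mult_def by blast
  obtain d where d_denominator: "d \<in> A" "d \<noteq> 0" "\<forall>z\<in>x ` {..<n}. d * z \<in> A"
    using common_denominator[of "x ` {..<n}"] by blast
  have "d * z \<in> A" if z_in_I: "z \<in> I" for z
  proof -
    have "d * z = (d * z) * (\<Sum>i<n. x i * y i)" by (simp flip: one_eq)
    also have "\<dots> = (\<Sum>i<n. (d * x i) * (y i * z))" by (simp add: sum_distrib_left algebra_simps)
    also have "\<dots> \<in> ideal_mult A A"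
      using d_denominator(3) factors z_in_I
      by (intro ideal_mult_sum ideal_mult_product) (auto simp: ideal_inverse_def)
    finally show ?thesis by (simp add: ideal_mult_one[OF submodule_self])
  qed
  moreover have "I \<noteq> {0}"
  proof
    assume "I = {0}"
    then have "(1 :: 'K) = 0" using one_eq factors by simp
    then show False by simp
  qed
  ultimately show ?thesis using I_invertible(1) d_denominator(1,2) unfolding fractional_ideal_iff by blast
qed

lemma fractional_ideal_self: "fractional_ideal A A"
  using submodule_self one_closed by (auto simp: fractional_ideal_iff intro!: bexI[of _ 1])

lemma fractional_ideal_mult:
  assumes "fractional_ideal A I" "fractional_ideal A J"
  shows "fractional_ideal A (ideal_mult I J)"
proof -
  obtain d where I_submodule: "submodule_of A I" "I \<noteq> {0}"
    and d_denominator: "d \<in> A" "d \<noteq> 0" "\<forall>x\<in>I. d * x \<in> A"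
    using assms(1) unfolding fractional_ideal_iff by blast
  obtain e where J_submodule: "submodule_of A J" "J \<noteq> {0}"
    and e_denominator: "e \<in> A" "e \<noteq> 0" "\<forall>x\<in>J. e * x \<in> A"
    using assms(2) unfolding fractional_ideal_iff by blast
  obtain x y where "x \<in> I" "x \<noteq> 0" "y \<in> J" "y \<noteq> 0"
    using I_submodule J_submodule submodule_zero by blast
  then have "ideal_mult I J \<noteq> {0}"
    by (metis ideal_mult_product mult_eq_0_iff singletonD)
  moreover have "ideal_mult I J \<subseteq> {z. d * e * z \<in> A}"
  proof (rule ideal_mult_least)
    fix x y assume "x \<in> I" "y \<in> J"
    then have "(d * x) * (e * y) \<in> A" using d_denominator(3) e_denominator(3)
      by (intro mult_closed[of "d * x"]) auto
    then show "x * y \<in> {z. d * e * z \<in> A}" by (simp add: mult_ac)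
  qed (simp_all add: zero_closed distrib_left add_closed)
  ultimately show ?thesis
    using submodule_ideal_mult[OF I_submodule(1), of J] d_denominator e_denominator
      mult_closed[OF d_denominator(1) e_denominator(1)]
    unfolding fractional_ideal_iff by (intro conjI bexI[of _ "d * e"]) auto
qed

lemma ideal_class_eq:
  assumes "submodule_of A I"
  shows "ideal_class A I = {(*) x ` I | x. x \<noteq> 0}"
proof -
  have "ideal_class A I = (\<lambda>H. ideal_mult H I) ` {(*) x ` A | x. x \<noteq> 0}"
    unfolding ideal_class_def r_coset_def principal_ideals_def ideal_group_def by auto
  also have "\<dots> = {ideal_mult ((*) x ` A) I | x. x \<noteq> 0}" by blast
  finally show ?thesis unfolding ideal_mult_scale_left ideal_mult_one[OF assms] .
qed

lemma ideal_class_scale: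
  assumes submodule: "submodule_of A I" and c_nonzero: "c \<noteq> 0"
  shows "ideal_class A ((*) c ` I) = ideal_class A I"
proof -
  have "{(*) x ` (*) c ` I | x. x \<noteq> 0} = {(*) x ` I | x. x \<noteq> 0}"
  proof (intro subset_antisym subsetI)
    fix H assume "H \<in> {(*) x ` (*) c ` I | x. x \<noteq> 0}"
    then obtain x where "x \<noteq> 0" "H = (*) x ` (*) c ` I" by blast
    then have "x * c \<noteq> 0" "H = (*) (x * c) ` I" using c_nonzero by (simp_all add: image_image mult.assoc)
    then show "H \<in> {(*) x ` I | x. x \<noteq> 0}" by blast
  next
    fix H assume "H \<in> {(*) x ` I | x. x \<noteq> 0}"
    then obtain x where "x \<noteq> 0" "H = (*) x ` I" by blast
    then have "x / c \<noteq> 0" "H = (*) (x / c) ` (*) c ` I" using c_nonzero by (simp_all add: image_image)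
    then show "H \<in> {(*) x ` (*) c ` I | x. x \<noteq> 0}" by blast
  qed
  then show ?thesis by (simp add: ideal_class_eq submodule submodule_scale)
qed

lemma class_group_mult:
  assumes I_submodule: "submodule_of A I" and J_submodule: "submodule_of A J"
  shows "ideal_class A I \<otimes>\<^bsub>class_group A\<^esub> ideal_class A J = ideal_class A (ideal_mult I J)"
proof -
  have products: "{H (x * y) | x y. x \<noteq> 0 \<and> y \<noteq> 0} = {H x | x. x \<noteq> 0}" for H :: "'K \<Rightarrow> 'K set"
  proof (intro subset_antisym subsetI)
    fix G assume "G \<in> {H x | x. x \<noteq> 0}"
    then obtain x where "x \<noteq> 0" "G = H (x * 1)" by auto
    then show "G \<in> {H (x * y) | x y. x \<noteq> 0 \<and> y \<noteq> 0}" using one_neq_zero by blast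
  qed fastforce
  have "ideal_class A I \<otimes>\<^bsub>class_group A\<^esub> ideal_class A J =
      {ideal_mult ((*) x ` I) ((*) y ` J) | x y. x \<noteq> 0 \<and> y \<noteq> 0}"
    unfolding class_group_def FactGroup_def set_mult_def ideal_group_def ideal_class_eq[OF I_submodule]
      ideal_class_eq[OF J_submodule]
    by auto
  also have "\<dots> = {(*) (x * y) ` ideal_mult I J | x y. x \<noteq> 0 \<and> y \<noteq> 0}" by (simp only: ideal_mult_scale)
  also have "\<dots> = {(*) x ` ideal_mult I J | x. x \<noteq> 0}" by (rule products)
  finally show ?thesis by (simp only: ideal_class_eq[OF submodule_ideal_mult[OF I_submodule]])
qed

lemma carrier_class_group: "carrier (class_group A) = {ideal_class A I | I. fractional_ideal A I}"
  unfolding class_group_def FactGroup_def RCOSETS_def ideal_class_def by (auto simp: ideal_group_def)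

lemma one_class_group: "\<one>\<^bsub>class_group A\<^esub> = ideal_class A A"
  unfolding class_group_def FactGroup_def ideal_class_eq[OF submodule_self] principal_ideals_def by simp

text \<open>
  \<open>A\<close> need not be a Dedekind domain here, so \<open>class_group A\<close> is only a monoid.
\<close>

lemma comm_monoid_class_group: "comm_monoid (class_group A)"
proof (rule comm_monoidI)
  fix C C' C'' assume "C \<in> carrier (class_group A)" "C' \<in> carrier (class_group A)" "C'' \<in> carrier (class_group A)"
  then obtain I I' I''
    where classes: "C = ideal_class A I" "C' = ideal_class A I'" "C'' = ideal_class A I''"
    and fractional: "fractional_ideal A I" "fractional_ideal A I'" "fractional_ideal A I''"
    unfolding carrier_class_group by blast
  then have submodules: "submodule_of A I" "submodule_of A I'" "submodule_of A I''"
    by (simp_all add: fractional_ideal_iff)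
  show "C \<otimes>\<^bsub>class_group A\<^esub> C' \<in> carrier (class_group A)"
    using fractional_ideal_mult[OF fractional(1,2)]
    unfolding classes class_group_mult[OF submodules(1,2)] carrier_class_group by blast
  show "C \<otimes>\<^bsub>class_group A\<^esub> C' \<otimes>\<^bsub>class_group A\<^esub> C'' = C \<otimes>\<^bsub>class_group A\<^esub> (C' \<otimes>\<^bsub>class_group A\<^esub> C'')"
    by (simp add: classes class_group_mult submodules submodule_ideal_mult ideal_mult_assoc)
  show "\<one>\<^bsub>class_group A\<^esub> \<otimes>\<^bsub>class_group A\<^esub> C = C"
    by (simp add: classes one_class_group class_group_mult submodules submodule_self ideal_mult_one)
  show "C \<otimes>\<^bsub>class_group A\<^esub> C' = C' \<otimes>\<^bsub>class_group A\<^esub> C"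
    by (simp add: classes class_group_mult submodules ideal_mult_commute)
next
  show "\<one>\<^bsub>class_group A\<^esub> \<in> carrier (class_group A)"
    unfolding carrier_class_group one_class_group using fractional_ideal_self by blast
qed

sublocale class_group: comm_monoid "class_group A"
  by (rule comm_monoid_class_group)

lemma ideal_class_inverse:
  assumes I_invertible: "submodule_of A I" "invertible_over A I"
  shows "ideal_class A I \<in> Units (class_group A)"
    and "inv\<^bsub>class_group A\<^esub> (ideal_class A I) = ideal_class A (ideal_inverse A I)"
proof -
  let ?J = "ideal_inverse A I"
  have mult_eq: "ideal_mult I ?J = A" by (rule ideal_mult_inverse[OF I_invertible])
  have J_invertible: "submodule_of A ?J" "invertible_over A ?J"
    using submodule_ideal_inverse invertible_over_if_mult_eq[OF I_invertible(1)] mult_eq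
    by (simp_all add: ideal_mult_commute)
  have carrier: "ideal_class A I \<in> carrier (class_group A)" "ideal_class A ?J \<in> carrier (class_group A)"
    using fractional_ideal_if_invertible I_invertible J_invertible by (auto simp: carrier_class_group)
  have "ideal_class A I \<otimes>\<^bsub>class_group A\<^esub> ideal_class A ?J = \<one>\<^bsub>class_group A\<^esub>"
    "ideal_class A ?J \<otimes>\<^bsub>class_group A\<^esub> ideal_class A I = \<one>\<^bsub>class_group A\<^esub>"
    by (simp_all add: class_group_mult I_invertible(1) J_invertible(1) mult_eq one_class_group
      ideal_mult_commute[of ?J])
  then show "ideal_class A I \<in> Units (class_group A)"
    and "inv\<^bsub>class_group A\<^esub> (ideal_class A I) = ideal_class A ?J"
    using carrier class_group.inv_unique' by (auto simp: Units_def)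
qed

lemma ideal_class_colon:
  assumes J_invertible: "submodule_of A J" "invertible_over A J"
    and D_submodule: "submodule_of A D"
    and J'_invertible: "submodule_of A J'" "invertible_over A J'" "J' = {y. \<forall>x\<in>J. y * x \<in> D}"
  shows "ideal_class A J' =
    inv\<^bsub>class_group A\<^esub> (ideal_class A (ideal_inverse A D)) \<otimes>\<^bsub>class_group A\<^esub>
    inv\<^bsub>class_group A\<^esub> (ideal_class A J)"
proof -
  have J'_eq: "J' = ideal_mult D (ideal_inverse A J)"
    unfolding J'_invertible(3) by (rule colon_eq_mult_inverse[OF J_invertible D_submodule])
  have "ideal_mult J' J = ideal_mult D (ideal_mult J (ideal_inverse A J))"
    unfolding J'_eq ideal_mult_assoc by (simp only: ideal_mult_commute)
  then have "ideal_mult J' J = D"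
    by (simp only: ideal_mult_inverse[OF J_invertible] ideal_mult_commute[of D]
      ideal_mult_one[OF D_submodule])
  then have "invertible_over A D" using invertible_over_mult[OF J'_invertible(1,2) J_invertible] by simp
  then have "inv\<^bsub>class_group A\<^esub> (ideal_class A (ideal_inverse A D)) = ideal_class A D"
    using class_group.Units_inv_inv[OF ideal_class_inverse(1)[OF D_submodule]]
    by (simp add: ideal_class_inverse(2)[OF D_submodule])
  then show ?thesis
    by (simp add: J'_eq ideal_class_inverse[OF J_invertible]
      class_group_mult[OF D_submodule submodule_ideal_inverse])
qed

end

section \<open>Ideal classes of modules\<close>

lemma module_iso_scale:
  assumes "module_iso A act L I f" "d \<noteq> 0"
  shows "module_iso A act L ((*) d ` I) (\<lambda>x. d * f x)"
  using assms inj_on_mult[of d I] unfolding module_iso_def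
  by (auto simp: distrib_left mult.left_commute bij_betw_def inj_on_def image_image)

text \<open>
  Two isomorphisms from the same module are proportional, since \<open>f x * g y = g (f x \<cdot> y) = g (f y \<cdot> x)\<close>.
\<close>

lemma module_iso_ideals_proportional:
  assumes I_ideal: "ideal_of A I" "I \<noteq> {0}" and f_iso: "module_iso A act L I f"
    and J_ideal: "ideal_of A J" "J \<noteq> {0}" and g_iso: "module_iso A act L J g"
    and act_closed: "\<And>a l. a \<in> A \<Longrightarrow> l \<in> L \<Longrightarrow> act a l \<in> L"
  obtains c where "c \<noteq> 0" "J = (*) c ` I"
proof -
  have inj_f: "inj_on f L" and images: "f ` L = I" "g ` L = J"
    and equivariant: "\<And>a l. a \<in> A \<Longrightarrow> l \<in> L \<Longrightarrow> f (act a l) = a * f l"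
      "\<And>a l. a \<in> A \<Longrightarrow> l \<in> L \<Longrightarrow> g (act a l) = a * g l"
    using f_iso g_iso by (auto simp: module_iso_def bij_betw_def)
  have in_A: "f l \<in> A" if "l \<in> L" for l using I_ideal(1) images that unfolding ideal_of_def by blast
  have proportional: "f x * g y = f y * g x" if "x \<in> L" "y \<in> L" for x y
  proof -
    have "f (act (f x) y) = f (act (f y) x)" using equivariant(1) in_A that by (simp add: mult.commute)
    then have "act (f x) y = act (f y) x" using inj_onD[OF inj_f] act_closed in_A that by blast
    then show ?thesis using equivariant(2) in_A that by metis
  qed
  have "0 \<in> I" "0 \<in> J" using I_ideal(1) J_ideal(1) by (simp_all add: ideal_of_def)
  then obtain x y where x_nonzero: "x \<in> L" "f x \<noteq> 0" and y_nonzero: "y \<in> L" "g y \<noteq> 0"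
    using I_ideal(2) J_ideal(2) images by blast
  have "g x \<noteq> 0" using proportional[OF x_nonzero(1) y_nonzero(1)] x_nonzero(2) y_nonzero(2)
    by (metis mult_eq_0_iff)
  have "g z = g x / f x * f z" if "z \<in> L" for z
    using proportional[OF x_nonzero(1) that] x_nonzero(2) by (simp add: field_simps)
  then have "J = (*) (g x / f x) ` I" unfolding images[symmetric] image_image by simp
  moreover have "g x / f x \<noteq> 0" using \<open>g x \<noteq> 0\<close> x_nonzero(2) by simp
  ultimately show ?thesis using that by blast
qed

lemma (in fraction_subring) module_class_eq:
  assumes f_iso: "module_iso A act L I f" and fractional: "fractional_ideal A I"
    and act_closed: "\<And>a l. a \<in> A \<Longrightarrow> l \<in> L \<Longrightarrow> act a l \<in> L"
  shows "module_class A act L = ideal_class A I"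
proof -
  have submodule: "submodule_of A I" using fractional by (simp add: fractional_ideal_iff)
  obtain d where d_ideal: "d \<noteq> 0" "ideal_of A ((*) d ` I)" using fractional unfolding fractional_ideal_def
    by blast
  obtain x where "x \<in> I" "x \<noteq> 0"
    using fractional submodule_zero[OF submodule] unfolding fractional_ideal_iff by blast
  then have nonzero: "(*) d ` I \<noteq> {0}" using d_ideal(1) by (metis imageI mult_eq_0_iff singletonD)
  have scaled_iso: "module_iso A act L ((*) d ` I) (\<lambda>x. d * f x)"
    by (rule module_iso_scale[OF f_iso d_ideal(1)])
  have class_d: "ideal_class A ((*) d ` I) = ideal_class A I"
    by (rule ideal_class_scale[OF submodule d_ideal(1)])
  show ?thesis unfolding module_class_def
  proof (rule the_equality)
    show "\<exists>J g. ideal_of A J \<and> J \<noteq> {0} \<and> module_iso A act L J g \<and> ideal_class A I = ideal_class A J"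
      using d_ideal(2) nonzero scaled_iso class_d by metis
  next
    fix C assume "\<exists>J g. ideal_of A J \<and> J \<noteq> {0} \<and> module_iso A act L J g \<and> C = ideal_class A J"
    then obtain J g where J_iso: "ideal_of A J" "J \<noteq> {0}" "module_iso A act L J g" "C = ideal_class A J"
      by blast
    obtain c where "c \<noteq> 0" "J = (*) c ` (*) d ` I"
      by (rule module_iso_ideals_proportional[OF d_ideal(2) nonzero scaled_iso J_iso(1-3) act_closed])
    then show "C = ideal_class A I"
      by (simp add: J_iso(4) ideal_class_scale submodule_scale[OF submodule] class_d)
  qed
qed

lemma submodule_image:
  fixes f :: "'v::ab_group_add \<Rightarrow> 'K::field"
  assumes L_closed: "0 \<in> L" "\<And>x y. x \<in> L \<Longrightarrow> y \<in> L \<Longrightarrow> x + y \<in> L" "\<And>a x. a \<in> A \<Longrightarrow> x \<in> L \<Longrightarrow> act a x \<in> L"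
    and f_linear: "\<And>x y. x \<in> L \<Longrightarrow> y \<in> L \<Longrightarrow> f (x + y) = f x + f y"
      "\<And>a x. a \<in> A \<Longrightarrow> x \<in> L \<Longrightarrow> f (act a x) = a * f x"
  shows "submodule_of A (f ` L)"
  unfolding submodule_of_def
proof (intro conjI ballI)
  have "f 0 = 0" using f_linear(1)[OF L_closed(1) L_closed(1)]
    by (simp only: add_0_right add_cancel_right_right)
  then show "0 \<in> f ` L" using L_closed(1) by (metis imageI)
qed (auto simp flip: f_linear intro: L_closed)

lemma (in fraction_subring) module_class_eq_image:
  assumes "submodule_of A (f ` L)" "invertible_over A (f ` L)" and "inj_on f L"
    and "\<And>x y. x \<in> L \<Longrightarrow> y \<in> L \<Longrightarrow> f (x + y) = f x + f y"
    and "\<And>a x. a \<in> A \<Longrightarrow> x \<in> L \<Longrightarrow> f (act a x) = a * f x"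
    and "\<And>a x. a \<in> A \<Longrightarrow> x \<in> L \<Longrightarrow> act a x \<in> L"
  shows "module_class A act L = ideal_class A (f ` L)"
  using assms
  by (intro module_class_eq[where f = f] fractional_ideal_if_invertible)
    (simp_all add: module_iso_def bij_betw_def)

section \<open>Pruefer domains\<close>

lemma (in fraction_subring) invertible_over_singleton:
  assumes "c \<in> S" "c \<noteq> 0" "S \<subseteq> {0, c}"
  shows "invertible_over A S"
proof -
  have "1 / c \<in> ideal_inverse A S"
    using assms zero_closed one_closed by (auto simp: ideal_inverse_def)
  then show ?thesis
    using ideal_mult_product[OF assms(1), of "1 / c" "ideal_inverse A S"] assms(2)
    by (simp add: invertible_over_def)
qed

text \<open>
  If \<open>1 = \<Sum> e\<^sub>i g\<^sub>i\<close> for the coefficients \<open>g\<^sub>i = h\<^sub>i\<^sub>-\<^sub>1 - y h\<^sub>i\<close> of \<open>(X - y) h\<close>, where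
  \<open>y = c / a\<close>, then \<open>1\<close> is a combination of \<open>1\<close> and \<open>y\<close> with coefficients that multiply both
  into \<open>A\<close>.
\<close>

lemma (in fraction_subring) invertible_over_pair:
  assumes a_nonzero: "a \<noteq> 0"
    and quotient_coeffs: "\<And>i. coeff h i \<in> A" "\<And>i. c / a * coeff h i \<in> A"
    and combination: "\<And>i. e i \<in> A" "(\<Sum>i\<le>n. e i * coeff ([:- (c / a), 1:] * h) i) = 1"
  shows "invertible_over A {a, c}"
proof -
  have inverse: "e i * x / a \<in> ideal_inverse A {a, c}" if "x \<in> A" "c / a * x \<in> A" for i x
  proof -
    have "e i * x / a * a \<in> A" using mult_closed[OF combination(1) that(1)] a_nonzero by simp
    moreover have "e i * x / a * c \<in> A" using mult_closed[OF combination(1) that(2)]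
      by (simp add: mult_ac)
    ultimately show ?thesis by (simp add: ideal_inverse_def)
  qed
  have "e i * coeff ([:- (c / a), 1:] * h) i \<in> ideal_mult {a, c} (ideal_inverse A {a, c})" for i
  proof -
    have "coeff (pCons 0 h) i \<in> A" "c / a * coeff (pCons 0 h) i \<in> A"
      using quotient_coeffs zero_closed by (simp_all add: coeff_pCons split: nat.split)
    then have "a * (e i * coeff (pCons 0 h) i / a) + c * (e i * - coeff h i / a)
        \<in> ideal_mult {a, c} (ideal_inverse A {a, c})"
      using quotient_coeffs uminus_closed by (intro ideal_mult_add ideal_mult_product inverse) auto
    moreover have "e i * coeff ([:- (c / a), 1:] * h) i =
        a * (e i * coeff (pCons 0 h) i / a) + c * (e i * - coeff h i / a)"
      using a_nonzero by (simp add: algebra_simps)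
    ultimately show ?thesis by (simp only:)
  qed
  then have "(\<Sum>i\<le>n. e i * coeff ([:- (c / a), 1:] * h) i) \<in> ideal_mult {a, c} (ideal_inverse A {a, c})"
    by (rule ideal_mult_sum)
  then show ?thesis unfolding combination(2) invertible_over_def .
qed

locale pruefer_domain = fraction_subring A for A :: "'K::field set" +
  assumes pair_invertible: "a \<noteq> 0 \<Longrightarrow> invertible_over A {a, c}"
begin

text \<open>
  Write \<open>1 = \<Sum> a b\<close> with \<open>a \<in> S\<close>, \<open>b \<in> S\<^sup>-\<^sup>1\<close>, and replace each \<open>a b\<close> by \<open>a b\<close> times a
  decomposition of \<open>1\<close> for the pair \<open>{a, c}\<close>.
\<close>

lemma invertible_over_insert:
  assumes S_invertible: "invertible_over A S"
  shows "invertible_over A (insert c S)"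
proof -
  let ?Q = "ideal_mult (insert c S) (ideal_inverse A (insert c S))"
  have "ideal_mult S (ideal_inverse A S) \<subseteq> ?Q"
  proof (intro ideal_mult_least ideal_mult_zero ideal_mult_add)
    fix a b assume a_in_S: "a \<in> S" and b_in_inverse: "b \<in> ideal_inverse A S"
    show "a * b \<in> ?Q"
    proof (cases "a = 0")
      case False
      have "ideal_mult {a, c} (ideal_inverse A {a, c}) \<subseteq> {z. a * b * z \<in> ?Q}"
      proof (rule ideal_mult_least)
        fix u v assume u_in_pair: "u \<in> {a, c}" and v_in_inverse: "v \<in> ideal_inverse A {a, c}"
        have "a * b * v * t \<in> A" if "t \<in> insert c S" for t
        proof -
          have "a * b * v * t = (b * t) * (v * a)" "a * b * v * t = (b * a) * (v * t)"
            by (simp_all add: mult_ac)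
          then show ?thesis
            using that a_in_S b_in_inverse v_in_inverse mult_closed unfolding ideal_inverse_def
            by (metis (mono_tags, lifting) insertCI insertE mem_Collect_eq)
        qed
        then have "u * (a * b * v) \<in> ?Q"
          using u_in_pair a_in_S by (intro ideal_mult_product) (auto simp: ideal_inverse_def)
        then show "u * v \<in> {z. a * b * z \<in> ?Q}" by (simp add: mult_ac)
      qed (simp_all add: ideal_mult_zero distrib_left ideal_mult_add)
      then have "1 \<in> {z. a * b * z \<in> ?Q}"
        using pair_invertible[OF False, of c] unfolding invertible_over_def by blast
      then show ?thesis by simp
    qed (simp add: ideal_mult_zero)
  qed
  then show ?thesis using S_invertible unfolding invertible_over_def by blast
qed

lemma invertible_over_finite:
  assumes "finite S" "\<not> S \<subseteq> {0}"
  shows "invertible_over A S"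
  using assms
proof (induction S)
  case (insert c S)
  show ?case
  proof (cases "S \<subseteq> {0}")
    case True
    then show ?thesis using insert.prems by (intro invertible_over_singleton[of c]) auto
  next
    case False
    then show ?thesis by (intro invertible_over_insert insert.IH)
  qed
qed simp

lemma invertible_over_finitely_generated:
  assumes generators: "finite S" "S \<subseteq> I" "I \<subseteq> ideal_mult A S" and I_nonzero: "I \<noteq> {0}" "0 \<in> I"
  shows "invertible_over A I"
proof -
  have "\<not> S \<subseteq> {0}"
  proof
    assume "S \<subseteq> {0}"
    then have "ideal_mult A S \<subseteq> {0}" by (intro ideal_mult_least) auto
    then show False using generators(3) I_nonzero by blast
  qed
  then have "invertible_over A S" by (rule invertible_over_finite[OF generators(1)])
  moreover have "ideal_inverse A S \<subseteq> ideal_inverse A I"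
  proof
    fix y assume y_in_inverse: "y \<in> ideal_inverse A S"
    have "ideal_mult A S \<subseteq> {x. y * x \<in> A}"
    proof (rule ideal_mult_least)
      fix a s assume "a \<in> A" "s \<in> S"
      then have "a * (y * s) \<in> A" using y_in_inverse mult_closed by (simp add: ideal_inverse_def)
      then show "a * s \<in> {x. y * x \<in> A}" by (simp add: mult.left_commute)
    qed (simp_all add: zero_closed distrib_left add_closed)
    then show "y \<in> ideal_inverse A I" using generators(3) by (auto simp: ideal_inverse_def)
  qed
  ultimately show ?thesis unfolding invertible_over_def using ideal_mult_mono[OF generators(2)] by blast
qed

end

section \<open>The ring \<open>A\<^sub>\<KK>\<close> is a Pruefer domain\<close>

locale structure_map =
  fixes \<iota> :: "'k::field poly fract \<Rightarrow> 'K::field"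
  assumes unital_ring_hom_structure_map: "unital_ring_hom \<iota>"
begin

abbreviation A where "A \<equiv> ring_A \<iota>"
abbreviation P where "P \<equiv> poly_K \<iota>"

sublocale \<iota>: field_hom \<iota>
  using unital_ring_hom_structure_map by unfold_locales

sublocale P: unital_hom P
  by unfold_locales
    (simp add: unital_ring_hom_def poly_K_def One_fract_def[symmetric] flip: \<iota>.hom_add \<iota>.hom_mult)

lemma poly_K_eq_0_iff [simp]: "P p = 0 \<longleftrightarrow> p = 0"
  by (simp add: poly_K_def Zero_fract_def eq_fract)

lemma poly_K_pCons: "P (pCons a p) = const_K \<iota> a + T_K \<iota> * P p"
proof -
  have "pCons a p = [:a:] + [:0, 1:] * p" by simp
  then show ?thesis unfolding const_K_def T_K_def by (simp only: P.hom_add P.hom_mult)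
qed

lemma const_K_inverse: "const_K \<iota> (inverse c) = inverse (const_K \<iota> c)"
proof (cases "c = 0")
  case False
  have "const_K \<iota> c * const_K \<iota> (inverse c) = P ([:c:] * [:inverse c:])"
    unfolding const_K_def by (simp only: P.hom_mult)
  also have "[:c:] * [:inverse c:] = 1" using False by (simp add: one_pCons)
  finally show ?thesis by (metis P.hom_one inverse_unique)
qed (simp add: const_K_def)

lemma structure_map_Fract: "g \<noteq> 0 \<Longrightarrow> \<iota> (Fract f g) = P f / P g"
  using \<iota>.hom_divide[of "Fract f 1" "Fract g 1"] by (simp add: poly_K_def)

lemma const_K_place: "R \<in> places \<iota> \<Longrightarrow> const_K \<iota> c \<in> R"
  unfolding places_def by auto

lemma valuation_ring_place: "R \<in> places \<iota> \<Longrightarrow> valuation_ring R"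
  unfolding places_def valuation_ring_def by auto

context
  fixes R assumes place: "R \<in> places \<iota>" and pole: "T_K \<iota> \<notin> R"
begin

interpretation valuation_ring R
  using place by (rule valuation_ring_place)

lemma leading_term_unit:
  assumes "p \<noteq> 0"
  shows "P p / T_K \<iota> ^ degree p \<in> R \<and> T_K \<iota> ^ degree p / P p \<in> R"
  using assms
proof (induction p)
  case (pCons a p)
  have T_nonzero: "T_K \<iota> \<noteq> 0" using pole zero_closed by auto
  show ?case
  proof (cases "p = 0")
    case True
    then have "const_K \<iota> a \<in> R" "inverse (const_K \<iota> a) \<in> R" using const_K_place[OF place]
      by (simp_all flip: const_K_inverse)
    then show ?thesis using True by (simp add: const_K_def divide_inverse)
  next
    case False
    define u where "u = P p / T_K \<iota> ^ degree p"
    have u_unit: "u \<noteq> 0" "u \<in> R" "inverse u \<in> R" using pCons.IH[OF False] False T_nonzero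
      by (simp_all add: u_def)
    define w where "w = const_K \<iota> a / P p"
    have "w = const_K \<iota> a * inverse (T_K \<iota>) ^ degree p * inverse u"
      using T_nonzero False by (simp add: w_def u_def field_simps power_inverse)
    then have w_in_R: "w \<in> R"
      using const_K_place[OF place] power_closed[OF inverse_if_notin[OF pole]] u_unit(3) mult_closed
      by simp
    have "P (pCons a p) = P p * (T_K \<iota> + w)" using False by (simp add: poly_K_pCons w_def distrib_left)
    then have "P (pCons a p) / T_K \<iota> ^ degree (pCons a p) = u * (inverse (T_K \<iota>) * (T_K \<iota> + w))"
      using False T_nonzero by (simp add: u_def field_simps)
    moreover from this have "T_K \<iota> ^ degree (pCons a p) / P (pCons a p) =
        inverse u * inverse (inverse (T_K \<iota>) * (T_K \<iota> + w))"
      by (metis inverse_divide inverse_mult_distrib)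
    ultimately show ?thesis using add_unit_ratio[OF pole w_in_R] u_unit mult_closed by simp
  qed
qed simp

lemma over_infinity_if_T_notin: "over_infinity \<iota> R"
proof -
  have T_nonzero: "T_K \<iota> \<noteq> 0" using pole zero_closed by auto
  have "\<iota> (Fract f g) \<in> R \<longleftrightarrow> degree f \<le> degree g" if g_nonzero: "g \<noteq> 0" for f g
  proof (cases "f = 0")
    case True
    then show ?thesis by (simp add: structure_map_Fract[OF g_nonzero] zero_closed)
  next
    case f_nonzero: False
    have "P f / P g \<in> R \<longleftrightarrow> T_K \<iota> ^ degree f / T_K \<iota> ^ degree g \<in> R"
    proof -
      have "P f / P g =
        P f / T_K \<iota> ^ degree f * (T_K \<iota> ^ degree g / P g) * (T_K \<iota> ^ degree f / T_K \<iota> ^ degree g)"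
        and "T_K \<iota> ^ degree f / T_K \<iota> ^ degree g =
          T_K \<iota> ^ degree f / P f * (P g / T_K \<iota> ^ degree g) * (P f / P g)"
        using f_nonzero g_nonzero T_nonzero by simp_all
      then show ?thesis using leading_term_unit[OF f_nonzero] leading_term_unit[OF g_nonzero] mult_closed
        by metis
    qed
    also have "\<dots> \<longleftrightarrow> degree f \<le> degree g"
    proof (cases "degree f \<le> degree g")
      case True
      then have "T_K \<iota> ^ degree f / T_K \<iota> ^ degree g = inverse (T_K \<iota>) ^ (degree g - degree f)"
        using T_nonzero by (simp add: power_diff power_inverse)
      then show ?thesis using True power_closed[OF inverse_if_notin[OF pole]] by simp
    next
      case False
      then have "T_K \<iota> ^ degree f / T_K \<iota> ^ degree g = T_K \<iota> ^ (degree f - degree g)"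
        using T_nonzero by (simp add: power_diff)
      then show ?thesis using False power_notin[OF pole] by simp
    qed
    finally show ?thesis by (simp add: structure_map_Fract[OF g_nonzero])
  qed
  then have "\<iota> z \<in> R \<longleftrightarrow> (\<exists>f g. z = Fract f g \<and> g \<noteq> 0 \<and> degree f \<le> degree g)" for z
    by (metis Fract_cases)
  then show ?thesis unfolding over_infinity_def by auto
qed

end

lemma ring_A_iff: "x \<in> A \<longleftrightarrow> (\<forall>R. R \<in> places \<iota> \<longrightarrow> \<not> over_infinity \<iota> R \<longrightarrow> x \<in> R)"
  by (auto simp: ring_A_def)

lemma ring_A_zero: "0 \<in> A" and ring_A_one: "1 \<in> A" and ring_A_uminus: "x \<in> A \<Longrightarrow> - x \<in> A"
  and ring_A_add: "x \<in> A \<Longrightarrow> y \<in> A \<Longrightarrow> x + y \<in> A" and ring_A_mult: "x \<in> A \<Longrightarrow> y \<in> A \<Longrightarrow> x * y \<in> A"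
  unfolding ring_A_iff
  by (blast intro: valuation_ring_place valuation_ring.zero_closed valuation_ring.one_closed
      valuation_ring.uminus_closed valuation_ring.add_closed valuation_ring.mult_closed)+

lemma poly_K_in_ring_A: "P p \<in> A"
proof (induction p)
  case (pCons a p)
  have "T_K \<iota> \<in> A" "const_K \<iota> a \<in> A"
    using over_infinity_if_T_notin const_K_place by (auto simp: ring_A_iff)
  then show ?case using pCons.IH by (simp add: poly_K_pCons ring_A_add ring_A_mult)
qed (simp add: ring_A_zero)

lemma ring_A_quotient_coeffs:
  assumes factorization: "map_poly P g = [:- y, 1:] * h"
  shows "coeff h i \<in> A" "y * coeff h i \<in> A"
proof -
  have "coeff ([:- y, 1:] * h) i \<in> A" for i
    unfolding factorization[symmetric] using poly_K_in_ring_A by (simp add: coeff_map_poly)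
  then show "coeff h i \<in> A" "y * coeff h i \<in> A"
    using valuation_ring.linear_quotient_coeffs[OF valuation_ring_place] unfolding ring_A_iff by blast+
qed

end

lemma fract_poly_clear_denominators:
  fixes p :: "'a::idom fract poly"
  obtains d g where "d \<noteq> 0" "smult (Fract d 1) p = map_poly (\<lambda>a. Fract a 1) g"
proof -
  have "\<exists>d g. d \<noteq> 0 \<and> smult (Fract d 1) p = map_poly (\<lambda>a. Fract a 1) g"
  proof (induction p)
    case 0
    show ?case by (intro exI[of _ 1] exI[of _ 0]) (simp add: map_poly_0)
  next
    case (pCons a p)
    then obtain d g where cleared: "d \<noteq> 0" "smult (Fract d 1) p = map_poly (\<lambda>a. Fract a 1) g" by blast
    obtain u v where a_eq: "a = Fract u v" "v \<noteq> 0" by (cases a) auto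
    have "Fract (d * v) 1 * a = Fract (d * u) 1" using a_eq by (simp add: eq_fract)
    moreover have "smult (Fract (d * v) 1) p = smult (Fract v 1) (smult (Fract d 1) p)"
      by (simp add: mult.commute)
    moreover have "map_poly (\<lambda>a. Fract a 1) (smult v g) = smult (Fract v 1) (map_poly (\<lambda>a. Fract a 1) g)"
      by (simp add: poly_eq_iff coeff_map_poly Zero_fract_def)
    ultimately have "smult (Fract (d * v) 1) (pCons a p) =
      map_poly (\<lambda>a. Fract a 1) (pCons (d * u) (smult v g))"
      using cleared(2) by (simp add: map_poly_pCons Zero_fract_def)
    then show ?case using cleared(1) a_eq(2) by (metis mult_eq_0_iff)
  qed
  then show ?thesis using that by blast
qed

locale separable_extension = structure_map \<iota>
  for \<iota> :: "'k::field poly fract \<Rightarrow> 'K::field" +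
  assumes finite_separable: "finite_separable \<iota>"
begin

lemma separable_annihilator:
  obtains p where "p \<noteq> 0" "poly (map_poly \<iota> p) x = 0" "coprime p (pderiv p)"
  using finite_separable unfolding finite_separable_def by (metis irreducible_def)

lemma polynomial_annihilator:
  obtains g where "g \<noteq> 0" "poly (map_poly P g) x = 0"
proof -
  obtain p where root: "p \<noteq> 0" "poly (map_poly \<iota> p) x = 0" using separable_annihilator by metis
  obtain d g where cleared: "d \<noteq> 0" "smult (Fract d 1) p = map_poly (\<lambda>a. Fract a 1) g"
    by (rule fract_poly_clear_denominators)
  have "map_poly P g = map_poly \<iota> (smult (Fract d 1) p)"
    unfolding cleared(2) by (simp add: poly_eq_iff coeff_map_poly poly_K_def Zero_fract_def[symmetric])
  also have "\<dots> = smult (P d) (map_poly \<iota> p)" by (simp add: poly_eq_iff coeff_map_poly poly_K_def)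
  finally have "poly (map_poly P g) x = 0" using root by simp
  moreover have "g \<noteq> 0" using cleared root by (auto simp: Zero_fract_def eq_fract map_poly_0)
  ultimately show ?thesis using that by blast
qed

lemma primitive_annihilator:
  obtains g e where "poly (map_poly P g) x = 0" "(\<Sum>i\<le>degree g. e i * coeff g i) = 1"
proof -
  obtain g where root: "g \<noteq> 0" "poly (map_poly P g) x = 0" by (rule polynomial_annihilator)
  obtain e where combination_dvd: "\<And>i. i \<le> degree g \<Longrightarrow> (\<Sum>k\<le>degree g. e k * coeff g k) dvd coeff g i"
    using linear_combination_dvd[of "{..degree g}"] by auto
  define d where "d = (\<Sum>k\<le>degree g. e k * coeff g k)"
  define g' where "g' = map_poly (\<lambda>a. a div d) g"
  have "d dvd coeff g i" for i using combination_dvd[of i]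
    by (cases "i \<le> degree g") (simp_all add: d_def coeff_eq_0)
  then have coeff_g: "coeff g i = d * coeff g' i" for i by (simp add: g'_def coeff_map_poly)
  then have g_eq: "g = smult d g'" by (simp add: poly_eq_iff)
  then have d_nonzero: "d \<noteq> 0" using root(1) by auto
  have "map_poly P g = smult (P d) (map_poly P g')"
    unfolding g_eq by (simp add: poly_eq_iff coeff_map_poly)
  then have "poly (map_poly P g') x = 0" using root(2) d_nonzero by simp
  moreover have "d * (\<Sum>i\<le>degree g. e i * coeff g' i) = d * 1"
    using d_def by (simp add: coeff_g sum_distrib_left mult.left_commute)
  then have "(\<Sum>i\<le>degree g'. e i * coeff g' i) = 1" using d_nonzero by (simp add: g_eq)
  ultimately show ?thesis by (rule that)
qed

lemma denominator:
  obtains d where "d \<noteq> 0" "P d * x \<in> A"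
proof -
  obtain g where root: "g \<noteq> 0" "poly (map_poly P g) x = 0" by (rule polynomial_annihilator)
  then obtain h where factorization: "map_poly P g = [:- x, 1:] * h" by (metis poly_eq_0_iff_dvd dvdE)
  have "degree (map_poly P g) = degree g" by (rule degree_map_poly) simp
  moreover have "lead_coeff (map_poly P g) = lead_coeff h" unfolding factorization lead_coeff_mult by simp
  ultimately have "P (lead_coeff g) = lead_coeff h" by (simp add: coeff_map_poly)
  then have "P (lead_coeff g) * x \<in> A"
    using ring_A_quotient_coeffs(2)[OF factorization, of "degree h"] by (simp add: mult.commute)
  then show ?thesis using that root(1) by (metis leading_coeff_0_iff)
qed

sublocale ring_A: fraction_subring A
proof
  show "\<exists>d\<in>A. d \<noteq> 0 \<and> d * x \<in> A" for x
    using denominator[of x] poly_K_in_ring_A poly_K_eq_0_iff by metis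
qed (auto intro: ring_A_zero ring_A_one ring_A_uminus ring_A_add ring_A_mult)

sublocale ring_A: pruefer_domain A
proof
  fix a c :: 'K assume a_nonzero: "a \<noteq> 0"
  obtain g e where root: "poly (map_poly P g) (c / a) = 0"
    and primitive: "(\<Sum>i\<le>degree g. e i * coeff g i) = 1"
    by (rule primitive_annihilator)
  obtain h where factorization: "map_poly P g = [:- (c / a), 1:] * h" using root
    by (metis poly_eq_0_iff_dvd dvdE)
  have "(\<Sum>i\<le>degree g. P (e i) * coeff ([:- (c / a), 1:] * h) i) = P (\<Sum>i\<le>degree g. e i * coeff g i)"
    unfolding factorization[symmetric] by (simp add: coeff_map_poly)
  then have "(\<Sum>i\<le>degree g. P (e i) * coeff ([:- (c / a), 1:] * h) i) = 1" by (simp add: primitive)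
  then show "invertible_over A {a, c}"
    by (rule ring_A.invertible_over_pair[OF a_nonzero ring_A_quotient_coeffs[OF factorization]
          poly_K_in_ring_A])
qed

end

section \<open>Simultaneous eigenvectors\<close>

definition poly_operator ::
  "('a::zero \<Rightarrow> 'b \<Rightarrow> 'b) \<Rightarrow> ('b \<Rightarrow> 'b) \<Rightarrow> 'a poly \<Rightarrow> 'b \<Rightarrow> 'b::comm_monoid_add" where
  "poly_operator smul T p v = (\<Sum>i\<le>degree p. smul (coeff p i) ((T ^^ i) v))"

definition eigenvectors ::
  "('a \<Rightarrow> 'b \<Rightarrow> 'b) \<Rightarrow> ('b \<Rightarrow> 'b) \<Rightarrow> 'b set \<Rightarrow> 'a set \<Rightarrow> 'b set" where
  "eigenvectors smul T W Z = {w \<in> W. \<exists>z\<in>Z. T w = smul z w}"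

context vector_space
begin

lemma span_eigenvectors_subset_shift_image:
  assumes linear: "Vector_Spaces.linear scale scale T" and "y \<notin> Z"
  shows "span (eigenvectors scale T W Z) \<subseteq> (\<lambda>v. T v - scale y v) ` span (eigenvectors scale T W Z)"
    (is "?E \<subseteq> _")
proof -
  interpret T: Vector_Spaces.linear scale scale T by (rule linear)
  define shift where "shift v = T v - scale y v" for v
  have shift_add: "shift (u + v) = shift u + shift v"
    and shift_scale: "shift (scale c v) = scale c (shift v)" for c u v
    by (simp_all add: shift_def T.add T.scale scale_right_distrib scale_right_diff_distrib
      scale_left_commute)
  have "?E \<subseteq> shift ` ?E"
  proof (rule span_minimal)
    show "eigenvectors scale T W Z \<subseteq> shift ` ?E"
    proof
      fix w assume w_eigenvector: "w \<in> eigenvectors scale T W Z"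
      then obtain z where "z \<in> Z" and eigenvalue: "T w = scale z w" by (auto simp: eigenvectors_def)
      then have "z \<noteq> y" using assms(2) by auto
      then have "w = shift (scale (1 / (z - y)) w)"
        unfolding shift_scale by (simp add: shift_def eigenvalue flip: scale_left_diff_distrib)
      then show "w \<in> shift ` ?E" using span_scale[OF span_base[OF w_eigenvector]] by blast
    qed
    show "subspace (shift ` ?E)"
    proof (rule subspaceI)
      have "shift 0 = 0" using shift_scale[of 0 0] by simp
      then show "0 \<in> shift ` ?E" using span_zero by (metis imageI)
    qed (auto simp flip: shift_add shift_scale intro: span_add span_scale)
  qed
  then show ?thesis unfolding shift_def .
qed

lemma eigenvector_decomposition:
  assumes linear: "Vector_Spaces.linear scale scale T"
    and stable: "subspace W" "\<And>w. w \<in> W \<Longrightarrow> T w \<in> W"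
    and "distinct zs" "v \<in> W" "fold (\<lambda>z v. T v - scale z v) zs v = 0"
  shows "v \<in> span (eigenvectors scale T W (set zs))"
  using assms(4-)
proof (induction zs arbitrary: v)
  case Nil
  then show ?case using span_zero by simp
next
  case (Cons z zs)
  interpret T: Vector_Spaces.linear scale scale T by (rule linear)
  let ?E = "\<lambda>Z. span (eigenvectors scale T W Z)"
  have "T v - scale z v \<in> ?E (set zs)"
    using Cons.IH[of "T v - scale z v"] Cons.prems stable subspace_diff subspace_scale by simp
  then obtain u where u_span: "u \<in> ?E (set zs)" and shift_eq: "T u - scale z u = T v - scale z v"
    using span_eigenvectors_subset_shift_image[OF linear, of z "set zs" W] Cons.prems(1) by auto
  have "?E (set zs) \<subseteq> W" by (rule span_minimal[OF _ stable(1)]) (auto simp: eigenvectors_def)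
  then have "v - u \<in> W" using Cons.prems(2) u_span subspace_diff[OF stable(1)] by blast
  moreover have "T (v - u) = scale z (v - u)"
    using shift_eq by (simp add: T.diff scale_right_diff_distrib algebra_simps)
  ultimately have "v - u \<in> ?E (set (z # zs))" by (intro span_base) (simp add: eigenvectors_def)
  moreover have "eigenvectors scale T W (set zs) \<subseteq> eigenvectors scale T W (set (z # zs))"
    by (auto simp: eigenvectors_def)
  then have "u \<in> ?E (set (z # zs))" using u_span span_mono by blast
  ultimately have "(v - u) + u \<in> ?E (set (z # zs))" by (rule span_add)
  then show ?case by simp
qed

lemma subspace_joint_eigenspace:
  assumes "\<And>s. s \<in> S \<Longrightarrow> Vector_Spaces.linear scale scale (T s)" "subspace W"
  shows "subspace {w \<in> W. \<forall>s\<in>S. T s w = scale (c s) w}"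
proof -
  have add: "T s (u + v) = T s u + T s v"
    and scale: "T s (scale d u) = scale d (T s u)" if "s \<in> S" for s u v d
    using assms(1)[OF that] by (simp_all add: Vector_Spaces.linear_iff)
  show ?thesis
    using subspace_0[OF assms(2)] subspace_add[OF assms(2)] subspace_scale[OF assms(2)] scale[of _ 0 0]
    by (intro subspaceI) (auto simp: add scale scale_right_distrib scale_left_commute)
qed

lemma joint_eigenvector_decomposition:
  assumes "finite S"
    and linear: "\<And>s. s \<in> S \<Longrightarrow> Vector_Spaces.linear scale scale (T s)"
    and commute: "\<And>s t v. s \<in> S \<Longrightarrow> t \<in> S \<Longrightarrow> T s (T t v) = T t (T s v)"
    and "subspace W" "\<And>s w. s \<in> S \<Longrightarrow> w \<in> W \<Longrightarrow> T s w \<in> W"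
    and annihilator: "\<And>s. s \<in> S \<Longrightarrow> \<exists>zs. distinct zs \<and> (\<forall>w\<in>W. fold (\<lambda>z v. T s v - scale z v) zs w = 0)"
  shows "W \<subseteq> span {w \<in> W. \<forall>s\<in>S. \<exists>z. T s w = scale z w}"
  using assms
proof (induction S)
  case empty
  then show ?case using span_superset by simp
next
  case (insert s S)
  let ?joint = "\<lambda>S. {w \<in> W. \<forall>s\<in>S. \<exists>z. T s w = scale z w}"
  have "?joint S \<subseteq> span (?joint (insert s S))"
  proof
    fix w assume "w \<in> ?joint S"
    then have w_in_W: "w \<in> W" and "\<forall>t\<in>S. \<exists>z. T t w = scale z w" by simp_all
    then obtain c where eigenvalues: "\<forall>t\<in>S. T t w = scale (c t) w"
      using bchoice[of S "\<lambda>t z. T t w = scale z w"] by blast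
    obtain zs where "distinct zs"
      and annihilates: "\<And>w. w \<in> W \<Longrightarrow> fold (\<lambda>z v. T s v - scale z v) zs w = 0"
      using insert.prems(5) by blast
    define W' where "W' = {u \<in> W. \<forall>t\<in>S. T t u = scale (c t) u}"
    have linear_s: "Vector_Spaces.linear scale scale (T s)" by (rule insert.prems(1)) simp
    then interpret Ts: Vector_Spaces.linear scale scale "T s" .
    have "w \<in> span (eigenvectors scale (T s) W' (set zs))"
    proof (rule eigenvector_decomposition[OF linear_s _ _ \<open>distinct zs\<close> _ annihilates[OF w_in_W]])
      show "subspace W'"
        unfolding W'_def by (rule subspace_joint_eigenspace) (use insert.prems(1,3) in auto)
      show "T s u \<in> W'" if "u \<in> W'" for u
        using that insert.prems(2)[of _ s u] insert.prems(4) by (auto simp: W'_def Ts.scale)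
      show "w \<in> W'" using w_in_W eigenvalues by (simp add: W'_def)
    qed
    also have "\<dots> \<subseteq> span (?joint (insert s S))" by (rule span_mono) (auto simp: W'_def eigenvectors_def)
    finally show "w \<in> span (?joint (insert s S))" .
  qed
  then have "span (?joint S) \<subseteq> span (?joint (insert s S))" by (rule span_minimal) (rule subspace_span)
  moreover have "W \<subseteq> span (?joint S)" by (rule insert.IH) (use insert.prems in auto)
  ultimately show ?case by blast
qed

lemma poly_operator_eq_sum:
  fixes p :: "'a poly"
  shows "degree p \<le> n \<Longrightarrow> poly_operator scale T p v = (\<Sum>i\<le>n. scale (coeff p i) ((T ^^ i) v))"
  unfolding poly_operator_def by (rule sum.mono_neutral_left) (auto simp: coeff_eq_0)

lemma poly_operator_pCons:
  "poly_operator scale T (pCons a p) v = scale a v + poly_operator scale T p (T v)"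
proof -
  have "poly_operator scale T (pCons a p) v =
    (\<Sum>i\<le>Suc (degree p). scale (coeff (pCons a p) i) ((T ^^ i) v))"
    by (rule poly_operator_eq_sum) (simp add: degree_pCons_le)
  also have "\<dots> = scale a v + (\<Sum>i\<le>degree p. scale (coeff p i) ((T ^^ Suc i) v))"
    by (simp add: sum.atMost_Suc_shift del: sum.atMost_Suc funpow.simps)
  finally show ?thesis by (simp add: poly_operator_def funpow_swap1)
qed

lemma poly_operator_linear_factor:
  assumes linear: "Vector_Spaces.linear scale scale T"
  shows "poly_operator scale T ([:- z, 1:] * q) v = poly_operator scale T q (T v - scale z v)"
proof -
  interpret T: Vector_Spaces.linear scale scale T by (rule linear)
  let ?n = "Suc (degree q)"
  have power: "(T ^^ i) (T v - scale z v) = (T ^^ i) (T v) - scale z ((T ^^ i) v)" for i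
    by (induction i) (simp_all add: T.diff T.scale)
  have "[:- z, 1:] * q = pCons 0 q - smult z q" by simp
  moreover have "degree (pCons 0 q - smult z q) \<le> ?n"
    by (intro degree_diff_le degree_pCons_le order.trans[OF degree_smult_le]) simp
  ultimately have "poly_operator scale T ([:- z, 1:] * q) v =
      (\<Sum>i\<le>?n. scale (coeff (pCons 0 q) i - z * coeff q i) ((T ^^ i) v))"
    using poly_operator_eq_sum[of "pCons 0 q - smult z q" ?n] by simp
  also have "\<dots> = poly_operator scale T (pCons 0 q) v - scale z (poly_operator scale T q v)"
    using poly_operator_eq_sum[of "pCons 0 q" ?n T v] poly_operator_eq_sum[of q ?n T v]
      degree_pCons_le[of 0 q]
    by (simp add: scale_left_diff_distrib sum_subtractf scale_sum_right del: sum.atMost_Suc)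
  also have "\<dots> = poly_operator scale T q (T v - scale z v)"
    unfolding poly_operator_pCons
    by (simp add: poly_operator_def power scale_right_diff_distrib sum_subtractf scale_sum_right
      mult.commute)
  finally show ?thesis .
qed

lemma poly_operator_smult: "poly_operator scale T (smult c p) v = scale c (poly_operator scale T p v)"
  using poly_operator_eq_sum[OF degree_smult_le] by (simp add: poly_operator_def scale_sum_right)

lemma poly_operator_prod_linear_factors:
  assumes "Vector_Spaces.linear scale scale T"
  shows "poly_operator scale T (\<Prod>z\<leftarrow>zs. [:- z, 1:]) v = fold (\<lambda>z v. T v - scale z v) zs v"
proof (induction zs arbitrary: v)
  case Nil
  show ?case by (simp add: poly_operator_def)
next
  case (Cons z zs)
  then show ?case by (simp add: poly_operator_linear_factor[OF assms] del: mult_pCons_left)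
qed

lemma span_subset_if_card_le:
  assumes spanning: "finite B" "C \<subseteq> span B" and independent: "independent C"
    and card_le: "card B \<le> card C"
  shows "span B \<subseteq> span C"
proof (rule span_minimal[OF _ subspace_span], rule subsetI, rule ccontr)
  fix b assume b_notin_span: "b \<in> B" "b \<notin> span C"
  have "independent (insert b C)" using independent b_notin_span(2) by (simp add: independent_insertI)
  moreover have "insert b C \<subseteq> span B" using b_notin_span(1) spanning(2) span_base by blast
  ultimately have "finite (insert b C) \<and> card (insert b C) \<le> card B"
    by (rule independent_span_bound[OF spanning(1)])
  moreover have "b \<notin> C" using b_notin_span(2) span_base by blast
  ultimately show False using card_le by auto
qed

end

section \<open>Spaces of functions and independence of characters\<close>

definition scale_fun :: "'c::times \<Rightarrow> ('a \<Rightarrow> 'c) \<Rightarrow> 'a \<Rightarrow> 'c" where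
  "scale_fun c \<phi> = (\<lambda>x. c * \<phi> x)"

interpretation fun_space: vector_space "scale_fun :: 'c::field \<Rightarrow> ('a \<Rightarrow> 'c) \<Rightarrow> 'a \<Rightarrow> 'c"
  by unfold_locales (simp_all add: scale_fun_def fun_eq_iff algebra_simps)

lemma scale_fun_apply [simp]: "scale_fun c \<phi> x = c * \<phi> x"
  by (simp add: scale_fun_def)

lemma sum_fun_apply [simp]: "(\<Sum>s\<in>S. g s) x = (\<Sum>s\<in>S. g s x)"
  for g :: "'i \<Rightarrow> 'a \<Rightarrow> 'c::comm_monoid_add"
  by (induction S rule: infinite_finite_induct) simp_all

lemma characters_independent:
  fixes S :: "('a::monoid_mult \<Rightarrow> 'c::field) set"
  assumes one: "\<And>\<alpha>. \<alpha> \<in> S \<Longrightarrow> \<alpha> 1 = 1" and mult: "\<And>\<alpha> x y. \<alpha> \<in> S \<Longrightarrow> \<alpha> (x * y) = \<alpha> x * \<alpha> y"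
  shows "fun_space.independent S"
proof -
  have "u \<alpha> = 0" if "finite X" "X \<subseteq> S" "(\<Sum>\<alpha>\<in>X. scale_fun (u \<alpha>) \<alpha>) = 0" "\<alpha> \<in> X" for X u \<alpha>
    using that
  proof (induction X arbitrary: u \<alpha>)
    case (insert \<psi> X)
    have \<psi>_in_S: "\<psi> \<in> S" using insert.prems by simp
    have sum_eq_0: "(\<Sum>\<alpha>\<in>insert \<psi> X. u \<alpha> * \<alpha> x) = 0" for x using fun_cong[OF insert.prems(2), of x] by simp
    have zero: "u \<alpha> = 0" if \<alpha>_in_X: "\<alpha> \<in> X" for \<alpha>
    proof -
      obtain y where separates: "\<alpha> y \<noteq> \<psi> y" using insert.hyps \<alpha>_in_X by (metis ext)
      have "(\<Sum>\<alpha>\<in>X. u \<alpha> * (\<alpha> y - \<psi> y) * \<alpha> x) = 0" for x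
      proof -
        have "(\<Sum>\<alpha>\<in>X. u \<alpha> * (\<alpha> y - \<psi> y) * \<alpha> x) = (\<Sum>\<alpha>\<in>insert \<psi> X. u \<alpha> * (\<alpha> y - \<psi> y) * \<alpha> x)"
          using insert.hyps by simp
        also have "\<dots> = (\<Sum>\<alpha>\<in>insert \<psi> X. u \<alpha> * \<alpha> (y * x) - \<psi> y * (u \<alpha> * \<alpha> x))"
          by (rule sum.cong[OF HOL.refl]) (simp add: mult[OF subsetD[OF insert.prems(1)]] algebra_simps)
        also have "\<dots> = (\<Sum>\<alpha>\<in>insert \<psi> X. u \<alpha> * \<alpha> (y * x)) - \<psi> y * (\<Sum>\<alpha>\<in>insert \<psi> X. u \<alpha> * \<alpha> x)"
          unfolding sum_subtractf sum_distrib_left ..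
        finally show ?thesis unfolding sum_eq_0 by simp
      qed
      then have "(\<Sum>\<alpha>\<in>X. scale_fun (u \<alpha> * (\<alpha> y - \<psi> y)) \<alpha>) = 0" by (simp add: fun_eq_iff)
      then have "u \<alpha> * (\<alpha> y - \<psi> y) = 0"
        by (rule insert.IH[rotated]) (use insert.prems(1) \<alpha>_in_X in simp_all)
      then show ?thesis using separates by simp
    qed
    then have "u \<psi> = 0" using sum_eq_0[of 1] insert.hyps one[OF \<psi>_in_S] by simp
    then show ?case using zero insert.prems(3) by blast
  qed simp
  then show ?thesis unfolding fun_space.independent_explicit_module by blast
qed

section \<open>Algebraic elements form a subring\<close>

context field_hom
begin

interpretation vs: vector_space "\<lambda>c x. f c * x"
  by (rule vector_space_hom)

lemma span_powers_eq_poly: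
  assumes "x \<in> vs.span (power z ` {..<n})"
  shows "\<exists>q. x = poly (map_poly f q) z \<and> (\<forall>i\<ge>n. coeff q i = 0)"
  using assms
proof (induction rule: vs.span_induct_alt)
  case base
  show ?case by (intro exI[of _ 0]) simp
next
  case (step c x y)
  then obtain i q
    where x_eq: "i < n" "x = z ^ i" and y_eq: "y = poly (map_poly f q) z" "\<forall>i\<ge>n. coeff q i = 0" by auto
  have "map_poly f (monom c i + q) = monom (f c) i + map_poly f q"
    by (simp add: poly_eq_iff coeff_map_poly)
  then show ?case using x_eq y_eq by (intro exI[of _ "monom c i + q"]) (simp add: poly_monom)
qed

lemma algebraic_over_iff_power_in_span:
  "algebraic_over f z \<longleftrightarrow> (\<exists>n. z ^ n \<in> vs.span (power z ` {..<n}))"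
proof
  assume "algebraic_over f z"
  then obtain p where root: "p \<noteq> 0" "poly (map_poly f p) z = 0" unfolding algebraic_over_def by blast
  define n where "n = degree p"
  have "degree (map_poly f p) = n" unfolding n_def by (rule degree_map_poly) simp
  then have "(\<Sum>i\<le>n. f (coeff p i) * z ^ i) = 0" using root(2) by (simp add: poly_altdef coeff_map_poly)
  moreover have "{..n} = insert n {..<n}" by auto
  ultimately have "f (lead_coeff p) * z ^ n = - (\<Sum>i<n. f (coeff p i) * z ^ i)"
    by (simp add: n_def eq_neg_iff_add_eq_0)
  also have "\<dots> \<in> vs.span (power z ` {..<n})"
    by (intro vs.span_neg vs.span_sum vs.span_scale vs.span_base) auto
  finally have "f (inverse (lead_coeff p)) * (f (lead_coeff p) * z ^ n) \<in> vs.span (power z ` {..<n})"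
    by (rule vs.span_scale)
  then show "\<exists>n. z ^ n \<in> vs.span (power z ` {..<n})" using root(1) by (auto simp: mult.assoc[symmetric])
next
  assume "\<exists>n. z ^ n \<in> vs.span (power z ` {..<n})"
  then obtain n q where power_eq: "z ^ n = poly (map_poly f q) z" "\<forall>i\<ge>n. coeff q i = 0"
    using span_powers_eq_poly by blast
  have "map_poly f (monom 1 n - q) = monom 1 n - map_poly f q" by (simp add: poly_eq_iff coeff_map_poly)
  then have "poly (map_poly f (monom 1 n - q)) z = 0" using power_eq(1) by (simp add: poly_monom)
  moreover have "coeff (monom 1 n - q) n = 1" using power_eq(2) by simp
  then have "monom 1 n - q \<noteq> 0" by force
  ultimately show "algebraic_over f z" unfolding algebraic_over_def by blast
qed

lemma algebraic_over_if_finite_span: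
  assumes S_stable: "finite S" "1 \<in> vs.span S" "\<And>x. x \<in> vs.span S \<Longrightarrow> z * x \<in> vs.span S"
  shows "algebraic_over f z"
proof (rule ccontr)
  assume "\<not> algebraic_over f z"
  then have notin: "z ^ n \<notin> vs.span (power z ` {..<n})" for n
    by (simp add: algebraic_over_iff_power_in_span)
  have "vs.independent (power z ` {..<n}) \<and> card (power z ` {..<n}) = n" for n
  proof (induction n)
    case (Suc n)
    have "z ^ n \<notin> power z ` {..<n}" using notin[of n] vs.span_superset by (rule contra_subsetD[rotated])
    then show ?case using Suc notin[of n] by (simp add: lessThan_Suc vs.independent_insertI)
  qed (simp add: vs.independent_empty)
  moreover have "z ^ i \<in> vs.span S" for i by (induction i) (use S_stable in auto)
  then have "power z ` {..<n} \<subseteq> vs.span S" for n by blast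
  ultimately have "Suc (card S) \<le> card S" using vs.independent_span_bound[OF S_stable(1)] by metis
  then show False by simp
qed

lemma mult_span_closed:
  assumes "\<And>x. x \<in> S \<Longrightarrow> z * x \<in> vs.span U" "x \<in> vs.span S"
  shows "z * x \<in> vs.span U"
  using assms(2)
proof (induction rule: vs.span_induct_alt)
  case base
  show ?case using vs.span_zero by simp
next
  case (step c x y)
  have "z * (f c * x + y) = f c * (z * x) + z * y" by (simp add: algebra_simps)
  then show ?case using vs.span_add[OF vs.span_scale[OF assms(1)[OF step(1)]] step(2)] by (simp only:)
qed

lemma algebraic_over_finite_span:
  assumes "algebraic_over f z"
  obtains S where "finite S" "1 \<in> S" "\<And>x. x \<in> S \<Longrightarrow> z * x \<in> vs.span S"
proof -
  obtain n where power_in_span: "z ^ n \<in> vs.span (power z ` {..<n})"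
    using assms algebraic_over_iff_power_in_span by blast
  have "n \<noteq> 0"
  proof
    assume "n = 0"
    then show False using power_in_span by simp
  qed
  have closed: "z * x \<in> vs.span (power z ` {..<n})" if x_power: "x \<in> power z ` {..<n}" for x
  proof -
    obtain i where x_eq: "x = z ^ i" "i < n" using x_power by blast
    have "z ^ Suc i \<in> vs.span (power z ` {..<n})"
    proof (cases "Suc i = n")
      case False
      then have "z ^ Suc i \<in> power z ` {..<n}" using x_eq(2) by (intro imageI) simp
      then show ?thesis by (rule vs.span_base)
    qed (use power_in_span in blast)
    then show ?thesis by (simp add: x_eq(1))
  qed
  have "1 \<in> power z ` {..<n}" using \<open>n \<noteq> 0\<close> by (intro image_eqI[of _ _ 0]) auto
  from that[OF _ this closed] show ?thesis by simp
qed

lemma algebraic_over_add_mult: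
  assumes z_algebraic: "algebraic_over f z" and w_algebraic: "algebraic_over f w"
  shows "algebraic_over f (z + w)" "algebraic_over f (z * w)"
proof -
  obtain S where S_stable: "finite S" "1 \<in> S" "\<And>x. x \<in> S \<Longrightarrow> z * x \<in> vs.span S"
    using algebraic_over_finite_span[OF z_algebraic] by metis
  obtain T where T_stable: "finite T" "1 \<in> T" "\<And>y. y \<in> T \<Longrightarrow> w * y \<in> vs.span T"
    using algebraic_over_finite_span[OF w_algebraic] by metis
  define U where "U = (\<lambda>(x, y). x * y) ` (S \<times> T)"
  have base: "x * y \<in> vs.span U" if "x \<in> S" "y \<in> T" for x y
    using that by (intro vs.span_base) (auto simp: U_def)
  have closed_z: "z * u \<in> vs.span U" if "u \<in> vs.span U" for u
  proof (rule mult_span_closed[OF _ that])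
    fix u assume "u \<in> U"
    then obtain x y where u_eq: "x \<in> S" "y \<in> T" "u = x * y" by (auto simp: U_def)
    have "y * (z * x) \<in> vs.span U"
      by (rule mult_span_closed[OF _ S_stable(3)[OF u_eq(1)]])
        (use base u_eq(2) in \<open>simp add: mult.commute[of y]\<close>)
    then show "z * u \<in> vs.span U" by (simp add: u_eq(3) mult_ac)
  qed
  have closed_w: "w * u \<in> vs.span U" if "u \<in> vs.span U" for u
  proof (rule mult_span_closed[OF _ that])
    fix u assume "u \<in> U"
    then obtain x y where u_eq: "x \<in> S" "y \<in> T" "u = x * y" by (auto simp: U_def)
    have "x * (w * y) \<in> vs.span U"
      by (rule mult_span_closed[OF _ T_stable(3)[OF u_eq(2)]]) (use base u_eq(1) in simp)
    then show "w * u \<in> vs.span U" by (simp add: u_eq(3) mult_ac)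
  qed
  have U_finite: "finite U" "1 \<in> vs.span U" using S_stable(1) T_stable(1) base[OF S_stable(2) T_stable(2)]
    by (simp_all add: U_def)
  show "algebraic_over f (z + w)"
    by (rule algebraic_over_if_finite_span[OF U_finite])
      (simp add: distrib_right vs.span_add closed_z closed_w)
  show "algebraic_over f (z * w)"
    by (rule algebraic_over_if_finite_span[OF U_finite]) (simp add: mult.assoc closed_z closed_w)
qed

lemma algebraic_over_hom: "algebraic_over f (f c)"
  unfolding algebraic_over_def by (intro exI[of _ "[:- c, 1:]"]) (simp add: map_poly_pCons)

lemma algebraic_over_quotient_coeffs:
  assumes "\<And>i. algebraic_over f (coeff ([:- z, 1:] * q) i)" "algebraic_over f z"
  shows "algebraic_over f (coeff q i)"
proof (cases "i \<le> degree q")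
  case True
  then show ?thesis
  proof (induction rule: inc_induct)
    case base
    show ?case using assms(1)[of "Suc (degree q)"] by (simp add: coeff_eq_0)
  next
    case (step n)
    have "coeff q n = coeff ([:- z, 1:] * q) (Suc n) + z * coeff q (Suc n)" by simp
    then show ?case using algebraic_over_add_mult assms step.IH by metis
  qed
next
  case False
  then show ?thesis using algebraic_over_hom[of 0] by (simp add: coeff_eq_0)
qed

end

sublocale C_infinity \<subseteq> emb: field_hom emb
  using emb_hom by unfold_locales

lemma (in C_infinity) algebraic_poly_splits:
  assumes "Q \<noteq> 0" "\<And>i. algebraic_over emb (coeff Q i)"
  shows "\<exists>c zs. Q = smult c (\<Prod>z\<leftarrow>zs. [:- z, 1:])"
  using assms
proof (induction "degree Q" arbitrary: Q)
  case 0
  then obtain c where "Q = [:c:]" by (metis degree_eq_zeroE)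
  then show ?case by (intro exI[of _ c] exI[of _ "[]"]) simp
next
  case (Suc n)
  obtain z where root: "algebraic_over emb z" "poly Q z = 0" using alg_closed[of Q] Suc by auto
  then obtain R where factorization: "Q = [:- z, 1:] * R" by (metis poly_eq_0_iff_dvd dvdE)
  then have R_nonzero: "R \<noteq> 0" using Suc.prems(1) by auto
  have "degree R = n" using Suc.hyps(2) R_nonzero unfolding factorization
    by (subst (asm) degree_mult_eq) auto
  moreover have "algebraic_over emb (coeff R i)" for i
    using emb.algebraic_over_quotient_coeffs[OF _ root(1)] Suc.prems(2) unfolding factorization by blast
  ultimately obtain c zs where "R = smult c (\<Prod>z\<leftarrow>zs. [:- z, 1:])"
    using Suc.hyps(1)[of R] R_nonzero by blast
  then have "Q = smult c (\<Prod>z\<leftarrow>z # zs. [:- z, 1:])" by (simp add: factorization del: mult_pCons_left)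
  then show ?case by blast
qed

lemma distinct_roots_if_no_double_root:
  fixes zs :: "'a::field list"
  assumes splits: "Q = smult c (\<Prod>z\<leftarrow>zs. [:- z, 1:])"
    and separable: "\<And>z. poly Q z = 0 \<Longrightarrow> poly (pderiv Q) z \<noteq> 0"
  shows "distinct zs"
proof (rule ccontr)
  assume "\<not> distinct zs"
  then obtain us vs ws z where "zs = us @ [z] @ vs @ [z] @ ws" using not_distinct_decomp by blast
  then have "Q = [:- z, 1:] * ([:- z, 1:] *
      smult c ((\<Prod>z\<leftarrow>us. [:- z, 1:]) * (\<Prod>z\<leftarrow>vs. [:- z, 1:]) * (\<Prod>z\<leftarrow>ws. [:- z, 1:])))"
    using splits by (simp add: algebra_simps del: mult_pCons_left)
  then obtain R where "Q = [:- z, 1:] * ([:- z, 1:] * R)" by blast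
  then have "poly Q z = 0" "poly (pderiv Q) z = 0"
    by (simp_all add: pderiv_mult pderiv_pCons del: mult_pCons_left)
  then show False using separable by blast
qed

section \<open>Extensions of a homomorphism and the trace\<close>

locale finite_extension = field_hom \<iota> for \<iota> :: "'f::field \<Rightarrow> 'K::field" +
  assumes finite_span: "\<exists>B. finite B \<and> module.span (\<lambda>c x. \<iota> c * x) B = UNIV"
begin

sublocale K: vector_space "\<lambda>c x. \<iota> c * x"
  by (rule vector_space_hom)

definition basis :: "'K set" where
  "basis = (SOME B. K.independent B \<and> K.span B = UNIV)"

lemma independent_basis: "K.independent basis"
  and span_basis: "K.span basis = UNIV"
proof -
  have "\<exists>B. K.independent B \<and> K.span B = UNIV" using K.basis_exists[of UNIV]
    by (metis top.extremum_unique)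
  from someI_ex[OF this, folded basis_def] show "K.independent basis" "K.span basis = UNIV" by simp_all
qed

lemma finite_basis: "finite basis"
  using finite_span K.independent_span_bound[OF _ independent_basis] by (metis top_greatest)

sublocale K: finite_dimensional_vector_space "\<lambda>c x. \<iota> c * x" basis
  by unfold_locales (rule finite_basis independent_basis span_basis)+

definition field_trace :: "'K \<Rightarrow> 'f" where
  "field_trace x = (\<Sum>b\<in>basis. K.representation basis (x * b) b)"

lemma sum_representation_basis: "(\<Sum>b\<in>basis. \<iota> (K.representation basis x b) * b) = x"
  by (rule K.sum_representation_eq) (simp_all add: independent_basis span_basis finite_basis)

end

locale split_extension = finite_extension \<iota> + j: field_hom j
  for \<iota> :: "'f::field \<Rightarrow> 'K::field" and j :: "'f \<Rightarrow> 'c::field" +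
  assumes split_annihilator: "\<exists>p c zs. p \<noteq> 0 \<and> poly (map_poly \<iota> p) x = 0 \<and>
    distinct zs \<and> map_poly j p = smult c (\<Prod>z\<leftarrow>zs. [:- z, 1:])"
begin

definition extensions :: "('K \<Rightarrow> 'c) set" where
  "extensions = {\<alpha>. unital_ring_hom \<alpha> \<and> (\<forall>c. \<alpha> (\<iota> c) = j c)}"

definition functionals :: "('K \<Rightarrow> 'c) set" where
  "functionals = {\<phi>. (\<forall>x y. \<phi> (x + y) = \<phi> x + \<phi> y) \<and> (\<forall>c x. \<phi> (\<iota> c * x) = j c * \<phi> x)}"

definition translate :: "'K \<Rightarrow> ('K \<Rightarrow> 'c) \<Rightarrow> 'K \<Rightarrow> 'c" where
  "translate s \<phi> = (\<lambda>x. \<phi> (s * x))"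

lemma field_hom_extension: "\<alpha> \<in> extensions \<Longrightarrow> field_hom \<alpha>"
  by unfold_locales (simp add: extensions_def)

lemma extension_base: "\<alpha> \<in> extensions \<Longrightarrow> \<alpha> (\<iota> c) = j c"
  by (simp add: extensions_def)

lemma functional_add: "\<phi> \<in> functionals \<Longrightarrow> \<phi> (x + y) = \<phi> x + \<phi> y"
  and functional_scale: "\<phi> \<in> functionals \<Longrightarrow> \<phi> (\<iota> c * x) = j c * \<phi> x"
  by (auto simp: functionals_def)

lemma functional_zero: "\<phi> \<in> functionals \<Longrightarrow> \<phi> 0 = 0"
  using functional_scale[of \<phi> 0 0] by simp

lemma subspace_functionals: "fun_space.subspace functionals"
  by (rule fun_space.subspaceI) (auto simp: functionals_def algebra_simps)

lemma linear_translate: "Vector_Spaces.linear scale_fun scale_fun (translate s)"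
  by unfold_locales (simp_all add: translate_def fun_eq_iff)

lemma translate_functional: "\<phi> \<in> functionals \<Longrightarrow> translate s \<phi> \<in> functionals"
  by (simp add: functionals_def translate_def distrib_left mult.left_commute[of s "\<iota> _"])

lemma poly_operator_translate:
  assumes "\<phi> \<in> functionals"
  shows "poly_operator scale_fun (translate s) (map_poly j p) \<phi> = translate (poly (map_poly \<iota> p) s) \<phi>"
  using assms
proof (induction p arbitrary: \<phi>)
  case 0
  then show ?case by (simp add: poly_operator_def translate_def functional_zero fun_eq_iff)
next
  case (pCons a p)
  have "poly_operator scale_fun (translate s) (map_poly j (pCons a p)) \<phi> =
      scale_fun (j a) \<phi> + translate (poly (map_poly \<iota> p) s) (translate s \<phi>)"
    by (simp add: map_poly_pCons fun_space.poly_operator_pCons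
      pCons.IH[OF translate_functional[OF pCons.prems]])
  also have "\<dots> = translate (poly (map_poly \<iota> (pCons a p)) s) \<phi>"
    using functional_add[OF pCons.prems] functional_scale[OF pCons.prems]
    by (simp add: fun_eq_iff translate_def map_poly_pCons distrib_right mult.assoc)
  finally show ?case .
qed

lemma translate_annihilator:
  "\<exists>zs. distinct zs \<and> (\<forall>\<phi>\<in>functionals. fold (\<lambda>z \<psi>. translate s \<psi> - scale_fun z \<psi>) zs \<phi> = 0)"
proof -
  obtain p c zs where root: "p \<noteq> 0" "poly (map_poly \<iota> p) s = 0"
    and splits: "distinct zs" "map_poly j p = smult c (\<Prod>z\<leftarrow>zs. [:- z, 1:])"
    using split_annihilator by blast
  have "map_poly j p \<noteq> 0" using root(1) by (simp add: poly_eq_iff coeff_map_poly)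
  then have "c \<noteq> 0" using splits(2) by auto
  have "fold (\<lambda>z \<psi>. translate s \<psi> - scale_fun z \<psi>) zs \<phi> = 0" if "\<phi> \<in> functionals" for \<phi>
  proof -
    have "scale_fun c (fold (\<lambda>z \<psi>. translate s \<psi> - scale_fun z \<psi>) zs \<phi>) = translate 0 \<phi>"
      using poly_operator_translate[OF that, of s p]
      by (simp add: root(2) splits(2) fun_space.poly_operator_smult
          fun_space.poly_operator_prod_linear_factors[OF linear_translate])
    also have "\<dots> = 0" using functional_zero[OF that] by (simp add: translate_def fun_eq_iff)
    finally show ?thesis using \<open>c \<noteq> 0\<close> by simp
  qed
  then show ?thesis using splits(1) by blast
qed

lemma translate_eigenvector:
  assumes functional: "\<psi> \<in> functionals"
    and eigenvector: "\<And>b. b \<in> basis \<Longrightarrow> \<exists>z. translate b \<psi> = scale_fun z \<psi>"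
  shows "\<exists>z. translate s \<psi> = scale_fun z \<psi>"
proof -
  have "s \<in> K.span basis" by (simp add: span_basis)
  then show ?thesis
  proof (induction rule: K.span_induct_alt)
    case base
    show ?case by (intro exI[of _ 0]) (simp add: translate_def functional_zero[OF functional] fun_eq_iff)
  next
    case (step c b s)
    then obtain z w where "translate b \<psi> = scale_fun z \<psi>" "translate s \<psi> = scale_fun w \<psi>"
      using eigenvector by blast
    then have "translate (\<iota> c * b + s) \<psi> = scale_fun (j c * z + w) \<psi>"
      using functional_add[OF functional] functional_scale[OF functional]
      by (simp add: translate_def fun_eq_iff distrib_right mult.assoc)
    then show ?case by blast
  qed
qed

lemma translate_eigenvector_in_span_extensions:
  assumes functional: "\<psi> \<in> functionals" and eigenvector: "\<And>s. \<exists>z. translate s \<psi> = scale_fun z \<psi>"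
  shows "\<psi> \<in> fun_space.span extensions"
proof -
  have mult: "\<psi> (x * y) * \<psi> 1 = \<psi> x * \<psi> y" for x y
  proof -
    obtain z where "translate x \<psi> = scale_fun z \<psi>" using eigenvector by blast
    then have "\<psi> (x * y) = z * \<psi> y" for y by (metis scale_fun_apply translate_def)
    from this[of 1] this[of y] show ?thesis by simp
  qed
  show ?thesis
  proof (cases "\<psi> 1 = 0")
    case True
    have "\<psi> x = 0" for x using mult[of x x] True by simp
    then have "\<psi> = 0" by (simp add: fun_eq_iff)
    then show ?thesis using fun_space.span_zero by simp
  next
    case False
    define \<alpha> where "\<alpha> x = \<psi> x / \<psi> 1" for x
    have "\<alpha> (x * y) = \<alpha> x * \<alpha> y" for x y using mult[of x y] False by (simp add: \<alpha>_def field_simps)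
    then have "unital_ring_hom \<alpha>" unfolding unital_ring_hom_def
      using False by (simp add: \<alpha>_def functional_add[OF functional] add_divide_distrib)
    moreover have "\<alpha> (\<iota> c) = j c" for c
      using functional_scale[OF functional, of c 1] False by (simp add: \<alpha>_def)
    ultimately have "\<alpha> \<in> extensions" by (simp add: extensions_def)
    moreover have "\<psi> = scale_fun (\<psi> 1) \<alpha>" using False by (simp add: fun_eq_iff \<alpha>_def)
    ultimately show ?thesis using fun_space.span_scale fun_space.span_base by metis
  qed
qed

lemma functionals_subset_span_extensions: "functionals \<subseteq> fun_space.span extensions"
proof -
  have "functionals \<subseteq>
      fun_space.span {\<psi> \<in> functionals. \<forall>s\<in>basis. \<exists>z. translate s \<psi> = scale_fun z \<psi>}"
    by (rule fun_space.joint_eigenvector_decomposition)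
      (simp_all add: finite_basis linear_translate subspace_functionals translate_functional
        translate_annihilator,
       simp add: translate_def mult.left_commute)
  also have "\<dots> \<subseteq> fun_space.span extensions"
    by (rule fun_space.span_minimal)
      (auto intro: translate_eigenvector_in_span_extensions translate_eigenvector)
  finally show ?thesis .
qed

lemma independent_extensions: "fun_space.independent extensions"
proof (rule characters_independent)
  fix \<alpha> x y assume "\<alpha> \<in> extensions"
  then interpret \<alpha>: field_hom \<alpha> by (rule field_hom_extension)
  show "\<alpha> 1 = 1" "\<alpha> (x * y) = \<alpha> x * \<alpha> y" by simp_all
qed

definition coordinate :: "'K \<Rightarrow> 'K \<Rightarrow> 'c" where
  "coordinate b x = j (K.representation basis x b)"

lemma coordinate_functional: "coordinate b \<in> functionals"
  using K.representation_add[OF independent_basis] K.representation_scale[OF independent_basis]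
  by (simp add: functionals_def coordinate_def span_basis)

lemma extension_eq_sum_coordinate:
  assumes "\<alpha> \<in> extensions"
  shows "\<alpha> x = (\<Sum>b\<in>basis. \<alpha> b * coordinate b x)"
proof -
  interpret \<alpha>: field_hom \<alpha> using assms by (rule field_hom_extension)
  have "\<alpha> x = \<alpha> (\<Sum>b\<in>basis. \<iota> (K.representation basis x b) * b)" by (simp only: sum_representation_basis)
  then show ?thesis by (simp add: extension_base[OF assms] coordinate_def mult.commute)
qed

lemma finite_extensions: "finite extensions"
  and card_extensions_le: "card extensions \<le> K.dim UNIV"
proof -
  have "extensions \<subseteq> fun_space.span (coordinate ` basis)"
  proof
    fix \<alpha> assume "\<alpha> \<in> extensions"
    then have "\<alpha> = (\<Sum>b\<in>basis. scale_fun (\<alpha> b) (coordinate b))"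
      using extension_eq_sum_coordinate by (simp add: fun_eq_iff)
    also have "\<dots> \<in> fun_space.span (coordinate ` basis)"
      by (intro fun_space.span_sum fun_space.span_scale fun_space.span_base imageI)
    finally show "\<alpha> \<in> fun_space.span (coordinate ` basis)" .
  qed
  note bound =
    fun_space.independent_span_bound[OF finite_imageI[OF finite_basis] independent_extensions this]
  then show "finite extensions" by simp
  have "card extensions \<le> card (coordinate ` basis)" using bound by simp
  also have "\<dots> \<le> card basis" by (rule card_image_le[OF finite_basis])
  finally show "card extensions \<le> K.dim UNIV" by simp
qed

lemma sum_extensions_eq_0:
  assumes "\<And>x. (\<Sum>\<alpha>\<in>extensions. c \<alpha> * \<alpha> x) = 0" "\<alpha> \<in> extensions"
  shows "c \<alpha> = 0"
  using fun_space.independentD[OF independent_extensions finite_extensions order.refl _ assms(2), of c]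
    assms(1)
  by (simp add: fun_eq_iff)

lemma functional_eq_sum_extensions:
  assumes "\<phi> \<in> functionals"
  obtains c where "\<And>x. \<phi> x = (\<Sum>\<alpha>\<in>extensions. c \<alpha> * \<alpha> x)"
proof -
  obtain c where "\<phi> = (\<Sum>\<alpha>\<in>extensions. scale_fun (c \<alpha>) \<alpha>)"
    using assms functionals_subset_span_extensions fun_space.span_finite[OF finite_extensions] by auto
  then show ?thesis by (intro that[of c]) simp
qed

text \<open>
  The coordinate functionals are combinations of the extensions, with a coefficient matrix inverse to
  \<open>(\<alpha> b)\<close> by independence of the extensions.
\<close>

theorem trace_eq_sum_extensions: "j (field_trace x) = (\<Sum>\<alpha>\<in>extensions. \<alpha> x)"
proof -
  have "\<forall>b. \<exists>c. \<forall>x. coordinate b x = (\<Sum>\<alpha>\<in>extensions. c \<alpha> * \<alpha> x)"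
    using functional_eq_sum_extensions[OF coordinate_functional] by metis
  then obtain c where coordinate_eq: "\<And>b x. coordinate b x = (\<Sum>\<alpha>\<in>extensions. c b \<alpha> * \<alpha> x)" by metis
  have diagonal: "(\<Sum>b\<in>basis. c b \<beta> * \<beta> b) = 1" if \<beta>_extension: "\<beta> \<in> extensions" for \<beta>
  proof -
    let ?d = "\<lambda>\<alpha>. (\<Sum>b\<in>basis. c b \<alpha> * \<beta> b) - (if \<alpha> = \<beta> then 1 else 0)"
    have "(\<Sum>\<alpha>\<in>extensions. ?d \<alpha> * \<alpha> x) = 0" for x
    proof -
      have "\<beta> x = (\<Sum>b\<in>basis. \<Sum>\<alpha>\<in>extensions. c b \<alpha> * \<beta> b * \<alpha> x)"
        unfolding extension_eq_sum_coordinate[OF \<beta>_extension, of x] coordinate_eq sum_distrib_left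
        by (simp only: mult_ac)
      also have "\<dots> = (\<Sum>\<alpha>\<in>extensions. (\<Sum>b\<in>basis. c b \<alpha> * \<beta> b) * \<alpha> x)"
        by (subst sum.swap) (simp add: sum_distrib_right)
      finally have "(\<Sum>\<alpha>\<in>extensions. (\<Sum>b\<in>basis. c b \<alpha> * \<beta> b) * \<alpha> x) = \<beta> x" by simp
      moreover have "(\<Sum>\<alpha>\<in>extensions. (if \<alpha> = \<beta> then 1 else 0) * \<alpha> x) = \<beta> x"
        using \<beta>_extension finite_extensions by (simp add: if_distrib[of "\<lambda>a. a * _"] cong: if_cong)
      ultimately show ?thesis by (simp only: left_diff_distrib sum_subtractf diff_self)
    qed
    from sum_extensions_eq_0[OF this \<beta>_extension] show ?thesis by simp
  qed
  have "j (field_trace x) = (\<Sum>b\<in>basis. \<Sum>\<alpha>\<in>extensions. c b \<alpha> * \<alpha> (x * b))"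
    by (simp add: field_trace_def coordinate_eq flip: coordinate_def)
  also have "\<dots> = (\<Sum>b\<in>basis. \<Sum>\<alpha>\<in>extensions. \<alpha> x * (c b \<alpha> * \<alpha> b))"
    by (intro sum.cong HOL.refl)
      (simp add: unital_hom.hom_mult[OF field_hom.axioms[OF field_hom_extension]])
  also have "\<dots> = (\<Sum>\<alpha>\<in>extensions. \<alpha> x * (\<Sum>b\<in>basis. c b \<alpha> * \<alpha> b))"
    by (subst sum.swap) (simp add: sum_distrib_left)
  also have "\<dots> = (\<Sum>\<alpha>\<in>extensions. \<alpha> x)" by (simp add: diagonal)
  finally show ?thesis .
qed

lemma extension_simps:
  assumes "\<alpha> \<in> extensions"
  shows "\<alpha> (x + y) = \<alpha> x + \<alpha> y" "\<alpha> (x * y) = \<alpha> x * \<alpha> y"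
proof -
  interpret field_hom \<alpha> using assms by (rule field_hom_extension)
  show "\<alpha> (x + y) = \<alpha> x + \<alpha> y" "\<alpha> (x * y) = \<alpha> x * \<alpha> y" by simp_all
qed

lemma trace_add: "field_trace (x + y) = field_trace x + field_trace y"
  by (subst j.hom_eq_iff[symmetric])
    (simp add: trace_eq_sum_extensions extension_simps sum.distrib del: j.hom_eq_iff)

lemma trace_scale: "field_trace (\<iota> c * x) = c * field_trace x"
  by (subst j.hom_eq_iff[symmetric])
    (simp add: trace_eq_sum_extensions extension_simps extension_base sum_distrib_left del: j.hom_eq_iff)

sublocale trace: Vector_Spaces.linear "\<lambda>c x. \<iota> c * x" "(*)" field_trace
  by unfold_locales (simp_all only: trace_add trace_scale distrib_left distrib_right mult.assoc
    mult_1_left)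

lemma trace_nondegenerate:
  assumes "\<And>x. field_trace (y * x) = 0"
  shows "y = 0"
proof -
  have "(\<Sum>\<alpha>\<in>extensions. \<alpha> y * \<alpha> x) = 0" for x
    using trace_eq_sum_extensions[of "y * x"] by (simp add: assms extension_simps)
  then have zero: "\<alpha> y = 0" if "\<alpha> \<in> extensions" for \<alpha>
    using sum_extensions_eq_0[of "\<lambda>\<alpha>. \<alpha> y"] that by blast
  have "coordinate b y = 0" for b
  proof -
    obtain c where "\<And>x. coordinate b x = (\<Sum>\<alpha>\<in>extensions. c \<alpha> * \<alpha> x)"
      using functional_eq_sum_extensions[OF coordinate_functional] by blast
    then show ?thesis by (simp add: zero)
  qed
  then show ?thesis using sum_representation_basis[of y] by (simp add: coordinate_def)
qed

lemma trace_eqI: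
  assumes "K.span B = UNIV" "\<And>b. b \<in> B \<Longrightarrow> field_trace (x * b) = field_trace (y * b)"
  shows "x = y"
proof -
  have "field_trace ((x - y) * z) = 0" for z
  proof -
    have "z \<in> K.span B" by (simp add: assms(1))
    then show ?thesis
    proof (induction rule: K.span_induct_alt)
      case (step c b z)
      have "(x - y) * (\<iota> c * b + z) = \<iota> c * (x * b) - \<iota> c * (y * b) + (x - y) * z"
        by (simp add: algebra_simps)
      then show ?case using step assms(2) by (simp add: trace.add trace.diff trace.scale)
    qed simp
  qed
  then have "x - y = 0" by (rule trace_nondegenerate)
  then show ?thesis by simp
qed

lemma trace_dual_basis:
  assumes B_basis: "K.independent B" "K.span B = UNIV"
  obtains d where "\<And>b b'. b \<in> B \<Longrightarrow> b' \<in> B \<Longrightarrow> field_trace (d b * b') = (if b = b' then 1 else 0)"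
proof -
  have finite_B: "finite B" by (rule K.finiteI_independent[OF B_basis(1)])
  define T where "T y = (\<Sum>b\<in>B. \<iota> (field_trace (y * b)) * b)" for y
  have coeffs: "field_trace (y * b) = u b" if "T y = (\<Sum>b\<in>B. \<iota> (u b) * b)" "b \<in> B" for y u b
  proof -
    have "(\<Sum>b\<in>B. \<iota> (field_trace (y * b) - u b) * b) = 0"
      using that(1) by (simp add: T_def left_diff_distrib sum_subtractf)
    from K.independentD[OF B_basis(1) finite_B order.refl this that(2)] show ?thesis by simp
  qed
  have "T (x + y) = T x + T y" for x y by (simp add: T_def distrib_right trace_add sum.distrib)
  moreover have "T (\<iota> c * x) = \<iota> c * T x" for c x
    unfolding T_def sum_distrib_left mult.assoc trace_scale hom_mult ..
  ultimately have "Vector_Spaces.linear (\<lambda>c x. \<iota> c * x) (\<lambda>c x. \<iota> c * x) T"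
    unfolding Vector_Spaces.linear_iff by (intro conjI allI K.vector_space_axioms)
  moreover have "inj T"
  proof (rule injI)
    fix x y assume T_eq: "T x = T y"
    show "x = y" by (rule trace_eqI[OF B_basis(2)]) (rule coeffs[OF T_eq[unfolded T_def[of y]]])
  qed
  ultimately have "surj T" by (rule K.linear_inj_imp_surj)
  then have "\<exists>y. T y = (\<Sum>b'\<in>B. \<iota> (if b = b' then 1 else 0) * b')" for b by (metis surjD)
  then obtain d where "\<And>b. T (d b) = (\<Sum>b'\<in>B. \<iota> (if b = b' then 1 else 0) * b')" by metis
  from coeffs[OF this] show ?thesis by (rule that)
qed

end

section \<open>Function fields inside \<open>C\<^sub>\<infinity>\<close>\<close>

lemma (in structure_map) scale_K_eq: "scale_K \<iota> = (\<lambda>c x. \<iota> c * x)"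
  by (intro ext) (simp add: scale_K_def)

context separable_extension
begin

sublocale finite_extension \<iota>
  using finite_separable by unfold_locales (simp add: finite_separable_def scale_K_eq)

lemma degree_K_eq_dim: "degree_K \<iota> = K.dim UNIV"
  by (simp add: degree_K_def scale_K_eq)

lemma trace_K_eq: "trace_K \<iota> = field_trace"
  by (intro ext) (simp add: trace_K_def field_trace_def basis_def scale_K_eq Let_def)

end

locale embedded_extension = separable_extension \<iota> + C_infinity emb cabs
  for \<iota> :: "'k::{field,finite} poly fract \<Rightarrow> 'K::field"
    and emb :: "'k fls \<Rightarrow> 'c::field" and cabs :: "'c \<Rightarrow> real" +
  fixes \<alpha>\<^sub>0 :: "'K \<Rightarrow> 'c"
  assumes embedding: "\<alpha>\<^sub>0 \<in> embeddings emb \<iota>"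
begin

lemma field_hom_embedding: "\<alpha> \<in> embeddings emb \<iota> \<Longrightarrow> field_hom \<alpha>"
  by unfold_locales (simp add: embeddings_def)

sublocale \<alpha>\<^sub>0: field_hom \<alpha>\<^sub>0
  using embedding by (rule field_hom_embedding)

definition base_map :: "'k poly fract \<Rightarrow> 'c" where
  "base_map c = \<alpha>\<^sub>0 (\<iota> c)"

sublocale base_map: field_hom base_map
  by unfold_locales (simp add: unital_ring_hom_def base_map_def)

lemma eval_theta_pCons: "eval_theta emb (pCons a p) = const_C emb a + theta emb * eval_theta emb p"
  by (simp add: eval_theta_def map_poly_pCons const_C_def)

lemma embedding_poly_K:
  assumes "\<alpha> \<in> embeddings emb \<iota>"
  shows "\<alpha> (P p) = eval_theta emb p"
proof -
  interpret \<alpha>: field_hom \<alpha> using assms by (rule field_hom_embedding)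
  show ?thesis
  proof (induction p)
    case (pCons a p)
    then show ?case using assms by (simp add: poly_K_pCons eval_theta_pCons embeddings_def)
  qed (simp add: eval_theta_def)
qed

lemma base_map_poly [simp]: "base_map (Fract p 1) = eval_theta emb p"
  using embedding_poly_K[OF embedding] by (simp add: base_map_def poly_K_def)

sublocale eval_theta: unital_hom "eval_theta emb"
  by unfold_locales (simp add: unital_ring_hom_def flip: embedding_poly_K[OF embedding])

lemma eval_theta_eq_0_iff [simp]: "eval_theta emb p = 0 \<longleftrightarrow> p = 0"
  by (simp flip: embedding_poly_K[OF embedding])

lemma base_map_Fract: "b \<noteq> 0 \<Longrightarrow> base_map (Fract a b) = eval_theta emb a / eval_theta emb b"
  by (simp add: base_map_def structure_map_Fract embedding_poly_K[OF embedding])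

lemma embedding_base:
  assumes "\<alpha> \<in> embeddings emb \<iota>"
  shows "\<alpha> (\<iota> c) = base_map c"
proof -
  interpret \<alpha>: field_hom \<alpha> using assms by (rule field_hom_embedding)
  show ?thesis
    by (cases c) (simp add: base_map_Fract structure_map_Fract embedding_poly_K[OF assms])
qed

lemma algebraic_base_map: "algebraic_over emb (base_map c)"
proof (cases c)
  case (Fract a b)
  have "\<exists>x. eval_theta emb p = emb x" for p
  proof (induction p)
    case (pCons a p)
    then obtain x where "eval_theta emb p = emb x" by blast
    then have "eval_theta emb (pCons a p) = emb (fls_const a + fls_X_inv * x)"
      by (simp add: eval_theta_pCons const_C_def theta_def)
    then show ?case by blast
  qed (metis emb.hom_zero eval_theta.hom_zero)
  then obtain x y where "eval_theta emb a = emb x" "eval_theta emb b = emb y" by metis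
  then have "base_map c = emb (x / y)" by (simp add: Fract base_map_Fract)
  then show ?thesis using emb.algebraic_over_hom[of "x / y"] by simp
qed

sublocale split_extension \<iota> base_map
proof
  fix x
  obtain p where annihilator: "p \<noteq> 0" "poly (map_poly \<iota> p) x = 0" "coprime p (pderiv p)"
    by (rule separable_annihilator)
  obtain u v where bezout: "u * p + v * pderiv p = 1" by (rule coprime_bezout[OF annihilator(3)])
  interpret map_poly: unital_hom "map_poly base_map" by (rule base_map.unital_hom_map_poly)
  let ?Q = "map_poly base_map p"
  have "map_poly base_map u * ?Q + map_poly base_map v * pderiv ?Q = 1"
    using arg_cong[OF bezout, of "map_poly base_map"] by (simp add: base_map.map_poly_pderiv)
  then have "poly (map_poly base_map u) z * poly ?Q z +
    poly (map_poly base_map v) z * poly (pderiv ?Q) z = 1" for z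
    by (metis poly_1 poly_add poly_mult)
  then have separable: "poly (pderiv ?Q) z \<noteq> 0" if "poly ?Q z = 0" for z
    using that by (metis add_0 mult_zero_right zero_neq_one)
  have "?Q \<noteq> 0" using annihilator(1) by (simp add: poly_eq_iff coeff_map_poly)
  moreover have "algebraic_over emb (coeff ?Q i)" for i using algebraic_base_map
    by (simp add: coeff_map_poly)
  ultimately obtain c zs where "?Q = smult c (\<Prod>z\<leftarrow>zs. [:- z, 1:])" using algebraic_poly_splits by blast
  then show "\<exists>p c zs. p \<noteq> 0 \<and> poly (map_poly \<iota> p) x = 0 \<and>
      distinct zs \<and> map_poly base_map p = smult c (\<Prod>z\<leftarrow>zs. [:- z, 1:])"
    using annihilator distinct_roots_if_no_double_root separable by blast
qed

lemma extensions_eq_embeddings: "extensions = embeddings emb \<iota>"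
proof
  show "extensions \<subseteq> embeddings emb \<iota>"
    using embedding
    by (auto simp: extensions_def embeddings_def const_K_def T_K_def poly_K_def base_map_def)
  show "embeddings emb \<iota> \<subseteq> extensions"
    using embedding_base by (auto simp: extensions_def embeddings_def)
qed

lemma trace_poly_scale: "field_trace (P p * x) = Fract p 1 * field_trace x"
  unfolding poly_K_def by (rule trace_scale)

lemma mem_codifferent_iff:
  "x \<in> codifferent \<iota> \<longleftrightarrow> (\<forall>a\<in>A. \<exists>p. field_trace (x * a) = Fract p 1)"
  by (auto simp: codifferent_def trace_K_eq)

lemma submodule_codifferent: "submodule_of A (codifferent \<iota>)"
  unfolding submodule_of_def
proof (intro conjI ballI)
  show "0 \<in> codifferent \<iota>" by (auto simp: mem_codifferent_iff Zero_fract_def)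
next
  fix x y assume xy_codifferent: "x \<in> codifferent \<iota>" "y \<in> codifferent \<iota>"
  show "x + y \<in> codifferent \<iota>" unfolding mem_codifferent_iff
  proof
    fix a assume "a \<in> A"
    then obtain p q where "field_trace (x * a) = Fract p 1" "field_trace (y * a) = Fract q 1"
      using xy_codifferent unfolding mem_codifferent_iff by blast
    then have "field_trace ((x + y) * a) = Fract (p + q) 1" by (simp add: distrib_right trace_add)
    then show "\<exists>p. field_trace ((x + y) * a) = Fract p 1" by blast
  qed
next
  fix a x assume "a \<in> A" "x \<in> codifferent \<iota>"
  then have "\<exists>p. field_trace (x * (a * b)) = Fract p 1" if "b \<in> A" for b
    using that ring_A_mult unfolding mem_codifferent_iff by blast
  then show "a * x \<in> codifferent \<iota>" by (simp add: mem_codifferent_iff mult_ac)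
qed

lemma different_eq_inverse_codifferent: "different \<iota> = ideal_inverse A (codifferent \<iota>)"
  by (simp add: different_def ideal_inverse_def)

lemma module_poly_scale: "module (poly_scale emb)"
  by unfold_locales (simp_all add: poly_scale_def algebra_simps)

lemma vector_space_base_map: "vector_space (\<lambda>c (v::'c ^ 'n). base_map c *s v)"
  by unfold_locales (simp_all add: algebra_simps)

end

lemma (in module) sum_scale_on_subspace:
  assumes subspace: "subspace S"
    and h_add: "\<And>x y. x \<in> S \<Longrightarrow> y \<in> S \<Longrightarrow> h (x + y) = h x + h y"
    and h_scale: "\<And>c x. x \<in> S \<Longrightarrow> h (scale c x) = g c (h x)"
    and x_in_S: "\<And>i. i \<in> I \<Longrightarrow> x i \<in> S"
  shows "h (\<Sum>i\<in>I. scale (c i) (x i)) = (\<Sum>i\<in>I. g (c i) (h (x i)) :: 'd::ab_group_add)"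
proof -
  have h_zero: "h 0 = 0"
    using h_add[OF subspace_0[OF subspace] subspace_0[OF subspace]]
    by (simp only: add_0_right add_cancel_right_right)
  show ?thesis using x_in_S
    by (induction I rule: infinite_finite_induct)
      (simp_all add: h_zero h_add h_scale subspace_scale[OF subspace] subspace_sum[OF subspace])
qed

section \<open>A lattice with complete multiplication as an ideal\<close>

locale cm_lattice = embedded_extension \<iota> emb cabs \<alpha>\<^sub>0
  for \<iota> :: "'k::{field,finite} poly fract \<Rightarrow> 'K::field"
    and emb :: "'k fls \<Rightarrow> 'c::field" and cabs \<alpha>\<^sub>0 +
  fixes L :: "('c ^ 'n) set" and m M :: "'K \<Rightarrow> 'c ^ 'n \<Rightarrow> 'c ^ 'n"
  assumes lattice: "lattice_of_rank emb (degree_K \<iota>) L"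
    and action_closed: "a \<in> A \<Longrightarrow> l \<in> L \<Longrightarrow> m a l \<in> L"
    and action_poly: "m (P p) v = poly_scale emb p v"
    and action_extension: "a \<in> A \<Longrightarrow> M a = m a"
    and linear: "Vector_Spaces.linear (*s) (*s) (M x)"
    and action_one: "M 1 = id"
    and action_add: "M (x + y) v = M x v + M y v"
    and action_mult: "M (x * y) = M x \<circ> M y"
begin

sublocale L: module "poly_scale emb :: 'k poly \<Rightarrow> 'c ^ 'n \<Rightarrow> 'c ^ 'n"
  by (rule module_poly_scale)

sublocale V: vector_space "\<lambda>c (v::'c ^ 'n). base_map c *s v"
  by (rule vector_space_base_map)

lemma action_base: "M (\<iota> c) v = base_map c *s v"
proof (cases c)
  case (Fract a b)
  have M_poly: "M (P p) v = eval_theta emb p *s v" for p v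
    using action_extension[OF poly_K_in_ring_A] action_poly by (simp add: poly_scale_def)
  have "P b * \<iota> c = P a" using Fract(2) by (simp add: Fract(1) structure_map_Fract)
  then have "M (P b) (M (\<iota> c) v) = M (P a) v" using action_mult[of "P b" "\<iota> c"] by (simp only: comp_apply)
  then have "eval_theta emb b *s M (\<iota> c) v = eval_theta emb a *s v" by (simp only: M_poly)
  also have "\<dots> = eval_theta emb b *s (base_map c *s v)" using Fract(2)
    by (simp add: Fract(1) base_map_Fract)
  finally show ?thesis by (rule vec.scale_left_imp_eq[rotated]) (simp add: Fract(2))
qed

definition B :: "('c ^ 'n) set" where
  "B = (SOME B. finite B \<and> card B = degree_K \<iota> \<and> L.independent B \<and> L = L.span B)"

lemma finite_B: "finite B" and card_B: "card B = K.dim UNIV"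
  and independent_B: "L.independent B" and span_B: "L = L.span B"
proof -
  have "\<exists>B. finite B \<and> card B = degree_K \<iota> \<and> L.independent B \<and> L = L.span B"
    using lattice unfolding lattice_of_rank_def by blast
  from someI_ex[OF this, folded B_def]
  show "finite B" "card B = K.dim UNIV" "L.independent B" "L = L.span B"
    by (simp_all add: degree_K_eq_dim)
qed

lemma subspace_L: "L.subspace L"
  by (subst span_B) (rule L.subspace_span)

lemma B_in_L: "b \<in> B \<Longrightarrow> b \<in> L"
  using span_B L.span_base[of b B] by simp

lemma span_L_UNIV: "vec.span L = UNIV"
  using lattice unfolding lattice_of_rank_def by blast

definition coord :: "'c ^ 'n \<Rightarrow> 'c ^ 'n \<Rightarrow> 'k poly" where
  "coord l b = L.representation B l b"

lemma sum_coord: "l \<in> L \<Longrightarrow> (\<Sum>b\<in>B. poly_scale emb (coord l b) b) = l"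
  unfolding coord_def using L.sum_representation_eq[OF independent_B _ finite_B order.refl] span_B
  by blast

lemma coord_add: "l \<in> L \<Longrightarrow> l' \<in> L \<Longrightarrow> coord (l + l') b = coord l b + coord l' b"
  and coord_scale: "l \<in> L \<Longrightarrow> coord (poly_scale emb p l) b = p * coord l b"
  unfolding coord_def
  using L.representation_add[OF independent_B, of l' l] L.representation_scale[OF independent_B, of l p]
    span_B
  by simp_all

lemma coord_basis: "b \<in> B \<Longrightarrow> coord b b' = (if b' = b then 1 else 0)"
  by (simp add: coord_def L.representation_basis[OF independent_B])

definition base_point :: "'c ^ 'n" where
  "base_point = (SOME l. l \<in> L \<and> l \<noteq> 0)"

lemma base_point_in_L: "base_point \<in> L" and base_point_nonzero: "base_point \<noteq> 0"
proof -
  have "\<exists>l. l \<in> L \<and> l \<noteq> 0"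
  proof (rule ccontr)
    assume "\<nexists>l. l \<in> L \<and> l \<noteq> 0"
    then have "L \<subseteq> {0}" by blast
    then have "vec.span L \<subseteq> vec.span {0}" by (rule vec.span_mono)
    then have "(UNIV :: ('c ^ 'n) set) \<subseteq> {0}" unfolding span_L_UNIV by simp
    then have "(1 :: 'c ^ 'n) = 0" by blast
    then show False by simp
  qed
  from someI_ex[OF this, folded base_point_def] show "base_point \<in> L" "base_point \<noteq> 0" by simp_all
qed

definition orbit :: "'K \<Rightarrow> 'c ^ 'n" where
  "orbit x = M x base_point"

lemma orbit_add: "orbit (x + y) = orbit x + orbit y"
  and orbit_mult: "orbit (x * y) = M x (orbit y)"
  and orbit_scale: "orbit (\<iota> c * x) = base_map c *s orbit x"
  and orbit_one: "orbit 1 = base_point"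
  by (simp_all add: orbit_def action_add action_mult action_base action_one)

lemma linear_orbit: "Vector_Spaces.linear (\<lambda>c x. \<iota> c * x) (\<lambda>c v. base_map c *s v) orbit"
  unfolding Vector_Spaces.linear_iff
  by (intro conjI allI K.vector_space_axioms V.vector_space_axioms orbit_add orbit_scale)

sublocale orbit: Vector_Spaces.linear "\<lambda>c x. \<iota> c * x" "\<lambda>c (v::'c ^ 'n). base_map c *s v" orbit
  by (rule linear_orbit)

lemma inj_orbit: "inj orbit"
  unfolding orbit.inj_iff_eq_0
proof (intro allI impI, rule ccontr)
  fix x assume "orbit x = 0" "x \<noteq> 0"
  then have "base_point = M (inverse x) 0" using orbit_mult[of "inverse x" x] by (simp add: orbit_one)
  then show False using linear[of "inverse x"] base_point_nonzero
    by (simp add: vec.linear_0 linear_iff_module_hom module_hom.zero)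
qed

lemma L_subset_span_B: "L \<subseteq> V.span B"
proof
  fix l assume "l \<in> L"
  then have "l = (\<Sum>b\<in>B. base_map (Fract (coord l b) 1) *s b)"
    using sum_coord by (simp add: poly_scale_def)
  also have "\<dots> \<in> V.span B" by (intro V.span_sum V.span_scale V.span_base)
  finally show "l \<in> V.span B" .
qed

lemma orbit_in_span_B: "orbit x \<in> V.span B"
proof -
  obtain d where d_denominator: "d \<noteq> 0" "P d * x \<in> A" by (rule denominator)
  have "orbit (P d * x) \<in> L"
    unfolding orbit_def
    using action_extension[OF d_denominator(2)] action_closed[OF d_denominator(2) base_point_in_L] by simp
  then have "base_map (inverse (Fract d 1)) *s orbit (P d * x) \<in> V.span B"
    using L_subset_span_B by (intro V.span_scale) blast
  moreover have "\<iota> (inverse (Fract d 1)) = inverse (P d)" by (simp only: \<iota>.hom_inverse poly_K_def)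
  then have "\<iota> (inverse (Fract d 1)) * (P d * x) = x" using d_denominator(1) by simp
  ultimately show ?thesis using orbit_scale by metis
qed

text \<open>Both \<open>\<KK> \<cdot> base_point\<close> and the \<open>F\<^sub>q(T)\<close>-span of \<open>L\<close> have dimension \<open>r\<close>, so they coincide.\<close>

lemma span_B_eq_range_orbit: "V.span B = range orbit"
proof
  have range: "V.span (orbit ` basis) = range orbit"
    using orbit.span_image[of basis] by (simp add: span_basis)
  have "V.independent (orbit ` basis)"
    using orbit.independent_injective_image[OF independent_basis] inj_orbit by (simp add: inj_on_subset)
  moreover have "orbit ` basis \<subseteq> V.span B" using orbit_in_span_B by blast
  moreover have "card B \<le> card (orbit ` basis)"
    using card_image[OF inj_on_subset[OF inj_orbit subset_UNIV], of basis] by (simp add: card_B)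
  ultimately show "V.span B \<subseteq> range orbit"
    unfolding range[symmetric] by (intro V.span_subset_if_card_le[OF finite_B])
qed (use orbit_in_span_B in blast)

definition to_K :: "'c ^ 'n \<Rightarrow> 'K" where
  "to_K = inv_into UNIV orbit"

lemma to_K_orbit: "to_K (orbit x) = x"
  unfolding to_K_def by (rule inv_f_f[OF inj_orbit])

lemma orbit_to_K: "l \<in> L \<Longrightarrow> orbit (to_K l) = l"
  unfolding to_K_def using L_subset_span_B span_B_eq_range_orbit by (intro f_inv_into_f) blast

lemma to_K_add: "l \<in> L \<Longrightarrow> l' \<in> L \<Longrightarrow> to_K (l + l') = to_K l + to_K l'"
  using to_K_orbit[of "to_K l + to_K l'"] by (simp add: orbit_add orbit_to_K)

lemma to_K_action: "a \<in> A \<Longrightarrow> l \<in> L \<Longrightarrow> to_K (m a l) = a * to_K l"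
  using to_K_orbit[of "a * to_K l"] by (simp add: orbit_mult orbit_to_K action_extension)

lemma to_K_poly_scale: "l \<in> L \<Longrightarrow> to_K (poly_scale emb p l) = P p * to_K l"
  using to_K_action[OF poly_K_in_ring_A] by (simp add: action_poly)

lemma inj_to_K: "inj_on to_K L"
  by (rule inj_onI) (metis orbit_to_K)

lemma to_K_base_point: "to_K base_point = 1"
  using to_K_orbit[of 1] by (simp add: orbit_one)

lemma to_K_eq_sum:
  assumes "l \<in> L"
  shows "to_K l = (\<Sum>b\<in>B. P (coord l b) * to_K b)"
  using L.sum_scale_on_subspace[OF subspace_L to_K_add to_K_poly_scale, of B id "coord l"] B_in_L
    sum_coord[OF assms]
  by simp

lemma span_to_K_B: "K.span (to_K ` B) = UNIV"
proof -
  have "orbit ` to_K ` B = B" using orbit_to_K[OF B_in_L] by (simp add: image_image)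
  then have "orbit ` K.span (to_K ` B) = orbit ` UNIV"
    using orbit.span_image[of "to_K ` B"] span_B_eq_range_orbit by simp
  then show ?thesis by (rule inj_image_eq_iff[OF inj_orbit, THEN iffD1])
qed

lemma independent_to_K_B: "K.independent (to_K ` B)"
  by (rule K.card_le_dim_spanning[of _ UNIV])
    (use card_image_le[OF finite_B, of to_K] card_B finite_B span_to_K_B in auto)

definition J :: "'K set" where
  "J = to_K ` L"

lemma submodule_J: "submodule_of A J"
  unfolding J_def
  by (rule submodule_image[OF L.subspace_0[OF subspace_L] L.subspace_add[OF subspace_L]
        action_closed to_K_add to_K_action])

lemma invertible_J: "invertible_over A J"
proof (rule ring_A.invertible_over_finitely_generated)
  show "finite (to_K ` B)" using finite_B by simp
  show "to_K ` B \<subseteq> J" using B_in_L by (auto simp: J_def)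
  show "J \<subseteq> ideal_mult A (to_K ` B)"
  proof
    fix x assume "x \<in> J"
    then obtain l where "l \<in> L" "x = to_K l" by (auto simp: J_def)
    then have "x = (\<Sum>b\<in>B. P (coord l b) * to_K b)" by (simp add: to_K_eq_sum)
    also have "\<dots> \<in> ideal_mult A (to_K ` B)"
      by (intro ideal_mult_sum ideal_mult_product poly_K_in_ring_A imageI)
    finally show "x \<in> ideal_mult A (to_K ` B)" .
  qed
  have "1 \<in> J" using imageI[OF base_point_in_L, of to_K] by (simp add: to_K_base_point J_def)
  then show "J \<noteq> {0}" by (metis singletonD zero_neq_one)
  show "0 \<in> J" using submodule_J by (rule submodule_zero)
qed

lemma module_class_L: "module_class A m L = ideal_class A J"
  using submodule_J invertible_J unfolding J_def
  by (rule ring_A.module_class_eq_image) (rule inj_to_K to_K_add to_K_action action_closed; assumption)+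

end

section \<open>The dual lattice as an ideal\<close>

locale cm_dual_pair = cm_lattice \<iota> emb cabs \<alpha>\<^sub>0 L m M
  for \<iota> :: "'k::{field,finite} poly fract \<Rightarrow> 'K::field"
    and emb :: "'k fls \<Rightarrow> 'c::field" and cabs \<alpha>\<^sub>0
    and L :: "('c ^ 'n) set" and m M :: "'K \<Rightarrow> 'c ^ 'n \<Rightarrow> 'c ^ 'n" +
  fixes L' :: "('c ^ 'm) set" and \<beta> :: "'c ^ 'n \<Rightarrow> 'c ^ 'm \<Rightarrow> 'k poly"
  assumes dual_pair: "dual_pair emb (degree_K \<iota>) L L' \<beta>"
begin

sublocale L': module "poly_scale emb :: 'k poly \<Rightarrow> 'c ^ 'm \<Rightarrow> 'c ^ 'm"
  by (rule module_poly_scale)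

lemma lattice_dual: "lattice_of_rank emb (degree_K \<iota>) L'"
  and card_sum: "CARD('n) + CARD('m) = K.dim UNIV"
  and perfect: "perfect_pairing emb L L' \<beta>"
  using dual_pair by (simp_all add: dual_pair_def degree_K_eq_dim)

lemma span_L'_UNIV: "vec.span L' = UNIV"
  using lattice_dual unfolding lattice_of_rank_def by blast

lemma subspace_L': "L'.subspace L'"
  using lattice_dual unfolding lattice_of_rank_def by auto

lemma pairing_add_left: "l \<in> L \<Longrightarrow> l2 \<in> L \<Longrightarrow> l' \<in> L' \<Longrightarrow> \<beta> (l + l2) l' = \<beta> l l' + \<beta> l2 l'"
  and pairing_scale_left: "l \<in> L \<Longrightarrow> l' \<in> L' \<Longrightarrow> \<beta> (poly_scale emb p l) l' = p * \<beta> l l'"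
  and pairing_add_right: "l \<in> L \<Longrightarrow> l' \<in> L' \<Longrightarrow> l2' \<in> L' \<Longrightarrow> \<beta> l (l' + l2') = \<beta> l l' + \<beta> l l2'"
  and pairing_scale_right: "l \<in> L \<Longrightarrow> l' \<in> L' \<Longrightarrow> \<beta> l (poly_scale emb p l') = p * \<beta> l l'"
  using perfect unfolding perfect_pairing_def poly_linear_on_def by simp_all

lemma pairing_represents: "poly_linear_on emb L h \<Longrightarrow> \<exists>!l'. l' \<in> L' \<and> (\<forall>l\<in>L. h l = \<beta> l l')"
  using perfect unfolding perfect_pairing_def by blast

lemma pairing_eqI:
  assumes "x \<in> L'" "y \<in> L'" "\<And>l. l \<in> L \<Longrightarrow> \<beta> l x = \<beta> l y"
  shows "x = y"
proof -
  have "poly_linear_on emb L (\<lambda>l. \<beta> l x)" using perfect assms(1) unfolding perfect_pairing_def by blast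
  then show ?thesis using pairing_represents assms by blast
qed

lemma pairing_eq_sum_coord:
  assumes "l \<in> L" "l' \<in> L'"
  shows "\<beta> l l' = (\<Sum>b\<in>B. coord l b * \<beta> b l')"
  using L.sum_scale_on_subspace[OF subspace_L, of "\<lambda>l. \<beta> l l'" "(*)" B id "coord l"]
  by (simp add: pairing_add_left pairing_scale_left assms B_in_L sum_coord)

definition dual_basis :: "'c ^ 'n \<Rightarrow> 'c ^ 'm" where
  "dual_basis b = (THE l'. l' \<in> L' \<and> (\<forall>l\<in>L. coord l b = \<beta> l l'))"

lemma dual_basis_in_L': "dual_basis b \<in> L'"
  and pairing_dual_basis: "l \<in> L \<Longrightarrow> \<beta> l (dual_basis b) = coord l b"
proof -
  have "poly_linear_on emb L (\<lambda>l. coord l b)" by (simp add: poly_linear_on_def coord_add coord_scale)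
  from theI'[OF pairing_represents[OF this], folded dual_basis_def]
  show "dual_basis b \<in> L'" "l \<in> L \<Longrightarrow> \<beta> l (dual_basis b) = coord l b" by simp_all
qed

lemma dual_eq_sum:
  assumes "l' \<in> L'"
  shows "l' = (\<Sum>b\<in>B. poly_scale emb (\<beta> b l') (dual_basis b))"
proof (rule pairing_eqI[OF assms])
  show "(\<Sum>b\<in>B. poly_scale emb (\<beta> b l') (dual_basis b)) \<in> L'"
    by (intro L'.subspace_sum L'.subspace_scale subspace_L' dual_basis_in_L')
  fix l assume l_in_L: "l \<in> L"
  have "\<beta> l (\<Sum>b\<in>B. poly_scale emb (\<beta> b l') (dual_basis b)) = (\<Sum>b\<in>B. \<beta> b l' * coord l b)"
    using L'.sum_scale_on_subspace[OF subspace_L', of "\<beta> l" "(*)" B dual_basis "\<lambda>b. \<beta> b l'"]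
    by (simp add: pairing_add_right pairing_scale_right pairing_dual_basis dual_basis_in_L' l_in_L)
  then show "\<beta> l l' = \<beta> l (\<Sum>b\<in>B. poly_scale emb (\<beta> b l') (dual_basis b))"
    by (simp add: pairing_eq_sum_coord[OF l_in_L assms] mult.commute)
qed

definition trace_dual :: "'c ^ 'n \<Rightarrow> 'K" where
  "trace_dual = (SOME d. \<forall>b\<in>B. \<forall>b'\<in>B. field_trace (d b * to_K b') = (if b = b' then 1 else 0))"

lemma trace_trace_dual:
  "b \<in> B \<Longrightarrow> b' \<in> B \<Longrightarrow> field_trace (trace_dual b * to_K b') = (if b = b' then 1 else 0)"
proof -
  obtain d where d_dual:
    "\<And>x y. x \<in> to_K ` B \<Longrightarrow> y \<in> to_K ` B \<Longrightarrow> field_trace (d x * y) = (if x = y then 1 else 0)"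
    using trace_dual_basis[OF independent_to_K_B span_to_K_B] by metis
  have "\<forall>b\<in>B. \<forall>b'\<in>B. field_trace (d (to_K b) * to_K b') = (if b = b' then 1 else 0)"
    using inj_to_K B_in_L by (simp add: d_dual inj_on_eq_iff)
  then have "\<exists>d. \<forall>b\<in>B. \<forall>b'\<in>B. field_trace (d b * to_K b') = (if b = b' then 1 else 0)"
    by (rule exI[of _ "\<lambda>b. d (to_K b)"])
  from someI_ex[OF this, folded trace_dual_def]
  show "b \<in> B \<Longrightarrow> b' \<in> B \<Longrightarrow> field_trace (trace_dual b * to_K b') = (if b = b' then 1 else 0)" by blast
qed

definition dual_to_K :: "'c ^ 'm \<Rightarrow> 'K" where
  "dual_to_K l' = (\<Sum>b\<in>B. P (\<beta> b l') * trace_dual b)"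

lemma trace_dual_to_K_basis:
  assumes "b \<in> B"
  shows "field_trace (dual_to_K l' * to_K b) = Fract (\<beta> b l') 1"
proof -
  have "field_trace (dual_to_K l' * to_K b) =
    (\<Sum>c\<in>B. Fract (\<beta> c l') 1 * field_trace (trace_dual c * to_K b))"
    by (simp add: dual_to_K_def sum_distrib_right mult.assoc trace.sum trace_poly_scale)
  also have "\<dots> = (\<Sum>c\<in>B. if c = b then Fract (\<beta> c l') 1 else 0)"
    by (rule sum.cong) (simp_all add: trace_trace_dual assms)
  finally show ?thesis using assms finite_B by simp
qed

lemma trace_dual_to_K:
  assumes l_in_L: "l \<in> L" and l'_in_L': "l' \<in> L'"
  shows "field_trace (dual_to_K l' * to_K l) = Fract (\<beta> l l') 1"
proof -
  have Fract_sum: "(\<Sum>s\<in>S. Fract (g s) 1) = Fract (\<Sum>s\<in>S. g s) 1" for g :: "'c ^ 'n \<Rightarrow> 'k poly" and S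
    by (induction S rule: infinite_finite_induct) (simp_all add: Zero_fract_def)
  have "dual_to_K l' * to_K l = (\<Sum>b\<in>B. P (coord l b) * (dual_to_K l' * to_K b))"
    by (simp add: to_K_eq_sum[OF l_in_L] sum_distrib_left mult.left_commute)
  then have "field_trace (dual_to_K l' * to_K l) = (\<Sum>b\<in>B. Fract (coord l b * \<beta> b l') 1)"
    by (simp add: trace.sum trace_poly_scale trace_dual_to_K_basis)
  then show ?thesis by (simp add: Fract_sum pairing_eq_sum_coord[OF l_in_L l'_in_L'])
qed

lemma dual_to_K_unique:
  assumes "\<And>b. b \<in> B \<Longrightarrow> field_trace (x * to_K b) = Fract (\<beta> b l') 1"
  shows "dual_to_K l' = x"
  by (rule trace_eqI[OF span_to_K_B]) (auto simp: assms trace_dual_to_K_basis)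

lemma dual_to_K_add: "x \<in> L' \<Longrightarrow> y \<in> L' \<Longrightarrow> dual_to_K (x + y) = dual_to_K x + dual_to_K y"
  by (simp add: dual_to_K_def pairing_add_right B_in_L distrib_right sum.distrib)

lemma inj_dual_to_K: "inj_on dual_to_K L'"
proof (rule inj_onI)
  fix x y assume xy_eq: "x \<in> L'" "y \<in> L'" "dual_to_K x = dual_to_K y"
  show "x = y"
  proof (rule pairing_eqI[OF xy_eq(1,2)])
    fix l assume l_in_L: "l \<in> L"
    have "Fract (\<beta> l x) 1 = Fract (\<beta> l y) 1"
      using trace_dual_to_K[OF l_in_L xy_eq(1)] trace_dual_to_K[OF l_in_L xy_eq(2)] xy_eq(3) by simp
    then show "\<beta> l x = \<beta> l y" by (simp add: eq_fract)
  qed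
qed

abbreviation dual_act :: "'K \<Rightarrow> 'c ^ 'm \<Rightarrow> 'c ^ 'm" where
  "dual_act \<equiv> dual_action \<beta> L L' m"

lemma dual_act_closed: "a \<in> A \<Longrightarrow> l' \<in> L' \<Longrightarrow> dual_act a l' \<in> L'"
  and pairing_dual_act: "a \<in> A \<Longrightarrow> l' \<in> L' \<Longrightarrow> l \<in> L \<Longrightarrow> \<beta> l (dual_act a l') = \<beta> (m a l) l'"
proof -
  assume a_in_A: "a \<in> A" and l'_in_L': "l' \<in> L'"
  have "m a (x + y) = m a x + m a y" "m a (poly_scale emb p x) = poly_scale emb p (m a x)" for x y p
    using linear[of a] action_extension[OF a_in_A] unfolding Vector_Spaces.linear_iff poly_scale_def
    by simp_all
  then have "poly_linear_on emb L (\<lambda>l. \<beta> (m a l) l')"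
    using l'_in_L'
    by (simp add: poly_linear_on_def action_closed[OF a_in_A] pairing_add_left pairing_scale_left)
  from theI'[OF pairing_represents[OF this], folded dual_action_def]
  show "dual_act a l' \<in> L'" "l \<in> L \<Longrightarrow> \<beta> l (dual_act a l') = \<beta> (m a l) l'" by simp_all
qed

lemma dual_to_K_dual_act:
  assumes a_in_A: "a \<in> A" and l'_in_L': "l' \<in> L'"
  shows "dual_to_K (dual_act a l') = a * dual_to_K l'"
proof (rule dual_to_K_unique)
  fix b assume b_in_B: "b \<in> B"
  have "field_trace (a * dual_to_K l' * to_K b) = field_trace (dual_to_K l' * to_K (m a b))"
    by (simp add: to_K_action[OF a_in_A B_in_L[OF b_in_B]] mult_ac)
  also have "\<dots> = Fract (\<beta> b (dual_act a l')) 1"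
    by (simp add: trace_dual_to_K action_closed a_in_A B_in_L b_in_B l'_in_L' pairing_dual_act)
  finally show "field_trace (a * dual_to_K l' * to_K b) = Fract (\<beta> b (dual_act a l')) 1" .
qed

definition J' :: "'K set" where
  "J' = dual_to_K ` L'"

lemma submodule_J': "submodule_of A J'"
  unfolding J'_def
  by (rule submodule_image[OF L'.subspace_0[OF subspace_L'] L'.subspace_add[OF subspace_L']
        dual_act_closed dual_to_K_add dual_to_K_dual_act])

lemma trace_dual_in_J':
  assumes "b \<in> B"
  shows "trace_dual b \<in> J'"
proof -
  have "dual_to_K (dual_basis b) = (\<Sum>c\<in>B. if c = b then trace_dual c else 0)"
    unfolding dual_to_K_def by (rule sum.cong) (auto simp: pairing_dual_basis B_in_L coord_basis)
  also have "\<dots> = trace_dual b" using assms finite_B by simp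
  finally show ?thesis unfolding J'_def using dual_basis_in_L' by (metis imageI)
qed

lemma invertible_J': "invertible_over A J'"
proof (rule ring_A.invertible_over_finitely_generated)
  show "finite (trace_dual ` B)" using finite_B by simp
  show "trace_dual ` B \<subseteq> J'" using trace_dual_in_J' by blast
  show "J' \<subseteq> ideal_mult A (trace_dual ` B)"
    unfolding J'_def dual_to_K_def
    by (auto intro!: ideal_mult_sum ideal_mult_product poly_K_in_ring_A)
  have "B \<noteq> {}" using sum_coord[OF base_point_in_L] base_point_nonzero by auto
  then obtain b where b_in_B: "b \<in> B" by blast
  have "trace_dual b \<noteq> 0" using trace_trace_dual[OF b_in_B b_in_B] by (auto simp: trace.zero)
  then show "J' \<noteq> {0}" using trace_dual_in_J'[OF b_in_B] by (metis singletonD)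
  show "0 \<in> J'" using submodule_J' by (rule submodule_zero)
qed

lemma J'_subset_colon: "J' \<subseteq> {y. \<forall>x\<in>J. y * x \<in> codifferent \<iota>}"
proof (intro subsetI CollectI ballI)
  fix y x assume "y \<in> J'" "x \<in> J"
  then obtain l l' where x_eq: "l \<in> L" "x = to_K l" and y_eq: "l' \<in> L'" "y = dual_to_K l'"
    by (auto simp: J_def J'_def)
  have "field_trace (y * x * a) = Fract (\<beta> (m a l) l') 1" if a_in_A: "a \<in> A" for a
    using trace_dual_to_K[OF action_closed[OF a_in_A x_eq(1)] y_eq(1)]
    by (simp add: to_K_action[OF a_in_A x_eq(1)] x_eq(2) y_eq(2) mult_ac)
  then show "y * x \<in> codifferent \<iota>" unfolding mem_codifferent_iff by blast
qed

lemma colon_subset_J': "{y. \<forall>x\<in>J. y * x \<in> codifferent \<iota>} \<subseteq> J'"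
proof
  fix y assume y_colon: "y \<in> {y. \<forall>x\<in>J. y * x \<in> codifferent \<iota>}"
  have "\<exists>p. field_trace (y * to_K l) = Fract p 1" if "l \<in> L" for l
  proof -
    have "y * to_K l \<in> codifferent \<iota>" using y_colon that by (simp add: J_def)
    then have "\<exists>p. field_trace (y * to_K l * 1) = Fract p 1"
      using ring_A_one unfolding mem_codifferent_iff by blast
    then show ?thesis by simp
  qed
  then obtain h where trace_eq: "\<And>l. l \<in> L \<Longrightarrow> field_trace (y * to_K l) = Fract (h l) 1" by metis
  have "poly_linear_on emb L h" unfolding poly_linear_on_def
  proof (intro conjI ballI allI)
    fix l l2 assume l_in_L: "l \<in> L" "l2 \<in> L"
    have "Fract (h (l + l2)) 1 = Fract (h l + h l2) 1"
      using trace_eq[OF L.subspace_add[OF subspace_L l_in_L]] trace_eq[OF l_in_L(1)]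
        trace_eq[OF l_in_L(2)]
      by (simp add: to_K_add[OF l_in_L] distrib_left trace_add)
    then show "h (l + l2) = h l + h l2" by (simp add: eq_fract)
  next
    fix p l assume l_in_L: "l \<in> L"
    have "Fract (h (poly_scale emb p l)) 1 = Fract (p * h l) 1"
      using trace_eq[OF L.subspace_scale[OF subspace_L l_in_L]] trace_eq[OF l_in_L]
      by (simp add: to_K_poly_scale[OF l_in_L] mult.left_commute[of y] trace_poly_scale)
    then show "h (poly_scale emb p l) = p * h l" by (simp add: eq_fract)
  qed
  then obtain l' where represents: "l' \<in> L'" "\<And>l. l \<in> L \<Longrightarrow> h l = \<beta> l l'" using pairing_represents by blast
  have "dual_to_K l' = y" by (rule dual_to_K_unique) (simp add: trace_eq represents(2) B_in_L)
  then show "y \<in> J'" using represents(1) by (auto simp: J'_def)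
qed

lemma module_class_L': "module_class A dual_act L' = ideal_class A J'"
  using submodule_J' invertible_J' unfolding J'_def
  by (rule ring_A.module_class_eq_image)
    (rule inj_dual_to_K dual_to_K_add dual_to_K_dual_act dual_act_closed; assumption)+

theorem module_class_dual:
  "module_class A dual_act L' =
    inv\<^bsub>class_group A\<^esub> (ideal_class A (different \<iota>)) \<otimes>\<^bsub>class_group A\<^esub>
    inv\<^bsub>class_group A\<^esub> (module_class A m L)"
  unfolding module_class_L module_class_L' different_eq_inverse_codifferent
  by (rule ring_A.ideal_class_colon)
    (intro submodule_J invertible_J submodule_J' invertible_J' submodule_codifferent
      subset_antisym J'_subset_colon colon_subset_J')+

text \<open>The vanishing of \<open>V\<^sup>* \<rightarrow> V'\<close>, evaluated on the dual bases.\<close>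

lemma sum_linear_form_dual_basis:
  assumes linear: "Vector_Spaces.linear (*s) (*) \<phi>"
  shows "(\<Sum>b\<in>B. \<phi> b *s dual_basis b) = 0"
proof -
  define N where "N = image_mset (\<lambda>b. (dual_basis b, \<phi> b)) (mset_set B)"
  have sum_N: "(\<Sum>(l', c)\<in>#N. F l' c) = (\<Sum>b\<in>B. F (dual_basis b) (\<phi> b))"
    for F :: "'c ^ 'm \<Rightarrow> 'c \<Rightarrow> 'z::comm_monoid_add"
    by (simp add: N_def sum_unfold_sum_mset image_mset.compositionality comp_def)
  have "\<forall>(l', c)\<in>#N. l' \<in> L'" using dual_basis_in_L' by (auto simp: N_def)
  moreover have "\<phi> l = (\<Sum>(l', c)\<in>#N. c * eval_theta emb (\<beta> l l'))" if "l \<in> L" for l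
  proof -
    interpret \<phi>: Vector_Spaces.linear "(*s)" "(*)" \<phi> by (rule linear)
    have "\<phi> l = \<phi> (\<Sum>b\<in>B. eval_theta emb (coord l b) *s b)"
      using sum_coord[OF that] by (simp add: poly_scale_def)
    then show ?thesis
      by (simp add: sum_N \<phi>.sum \<phi>.scale pairing_dual_basis[OF that] mult.commute)
  qed
  ultimately have "(\<Sum>(l', c)\<in>#N. c *s l') = 0" using dual_pair linear unfolding dual_pair_def by blast
  then show ?thesis by (simp add: sum_N)
qed

definition dual_vector :: "('K \<Rightarrow> 'c) \<Rightarrow> 'c ^ 'm" where
  "dual_vector \<alpha> = (\<Sum>b\<in>B. \<alpha> (to_K b) *s dual_basis b)"

lemma dual_eq_sum_dual_vector:
  assumes l'_in_L': "l' \<in> L'"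
  shows "l' = (\<Sum>\<alpha>\<in>extensions. \<alpha> (dual_to_K l') *s dual_vector \<alpha>)"
proof -
  have "eval_theta emb (\<beta> b l') = (\<Sum>\<alpha>\<in>extensions. \<alpha> (dual_to_K l') * \<alpha> (to_K b))" if "b \<in> B" for b
    using trace_eq_sum_extensions[of "dual_to_K l' * to_K b"]
    by (simp add: trace_dual_to_K_basis[OF that] extension_simps)
  then have "l' = (\<Sum>b\<in>B. \<Sum>\<alpha>\<in>extensions. (\<alpha> (dual_to_K l') * \<alpha> (to_K b)) *s dual_basis b)"
    using dual_eq_sum[OF l'_in_L'] by (simp add: poly_scale_def vec.scale_sum_left)
  also have "\<dots> = (\<Sum>\<alpha>\<in>extensions. \<Sum>b\<in>B. (\<alpha> (dual_to_K l') * \<alpha> (to_K b)) *s dual_basis b)"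
    by (rule sum.swap)
  finally show ?thesis by (simp add: dual_vector_def vec.scale_sum_right)
qed

end

section \<open>Diagonal actions\<close>

locale eigenbasis =
  fixes \<Psi> :: "('K::field \<Rightarrow> 'c::field) set" and w :: "('K \<Rightarrow> 'c) \<Rightarrow> 'c ^ 'm"
  assumes finite_type: "finite \<Psi>"
    and field_hom_type: "\<alpha> \<in> \<Psi> \<Longrightarrow> field_hom \<alpha>"
    and inj_w: "inj_on w \<Psi>"
    and independent_w: "vec.independent (w ` \<Psi>)"
    and span_w: "vec.span (w ` \<Psi>) = UNIV"
begin

definition eigen_coord :: "'c ^ 'm \<Rightarrow> ('K \<Rightarrow> 'c) \<Rightarrow> 'c" where
  "eigen_coord v \<alpha> = (if \<alpha> \<in> \<Psi> then vec.representation (w ` \<Psi>) v (w \<alpha>) else 0)"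

definition diagonal_action :: "'K \<Rightarrow> 'c ^ 'm \<Rightarrow> 'c ^ 'm" where
  "diagonal_action x v = (\<Sum>\<alpha>\<in>\<Psi>. (\<alpha> x * eigen_coord v \<alpha>) *s w \<alpha>)"

lemma sum_eigen_coord: "(\<Sum>\<alpha>\<in>\<Psi>. eigen_coord v \<alpha> *s w \<alpha>) = v"
  using vec.sum_representation_eq[OF independent_w _ finite_imageI[OF finite_type] order.refl, of v]
  by (simp add: span_w sum.reindex[OF inj_w] eigen_coord_def)

lemma eigen_coord_add: "eigen_coord (u + v) \<alpha> = eigen_coord u \<alpha> + eigen_coord v \<alpha>"
  and eigen_coord_scale: "eigen_coord (c *s v) \<alpha> = c * eigen_coord v \<alpha>"
  using vec.representation_add[OF independent_w, of v u]
    vec.representation_scale[OF independent_w, of v c]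
  by (simp_all add: eigen_coord_def span_w)

lemma eigen_coord_sum:
  assumes \<alpha>_in_\<Psi>: "\<alpha> \<in> \<Psi>"
  shows "eigen_coord (\<Sum>\<gamma>\<in>\<Psi>. d \<gamma> *s w \<gamma>) \<alpha> = d \<alpha>"
proof -
  have "eigen_coord (\<Sum>\<gamma>\<in>S. d \<gamma> *s w \<gamma>) \<alpha> = (\<Sum>\<gamma>\<in>S. d \<gamma> * eigen_coord (w \<gamma>) \<alpha>)" for S
    using eigen_coord_scale[of 0 0 \<alpha>]
    by (induction S rule: infinite_finite_induct) (simp_all add: eigen_coord_add eigen_coord_scale)
  also have "(\<Sum>\<gamma>\<in>\<Psi>. d \<gamma> * eigen_coord (w \<gamma>) \<alpha>) = (\<Sum>\<gamma>\<in>\<Psi>. if \<gamma> = \<alpha> then d \<gamma> else 0)"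
    by (rule sum.cong)
      (use \<alpha>_in_\<Psi> inj_onD[OF inj_w] in
        \<open>auto simp: eigen_coord_def vec.representation_basis[OF independent_w]\<close>)
  finally show ?thesis using finite_type \<alpha>_in_\<Psi> by simp
qed

lemma eigen_coord_diagonal_action:
  "\<alpha> \<in> \<Psi> \<Longrightarrow> eigen_coord (diagonal_action x v) \<alpha> = \<alpha> x * eigen_coord v \<alpha>"
  unfolding diagonal_action_def by (rule eigen_coord_sum)

lemma diagonal_action_eigen_sum:
  "diagonal_action x (\<Sum>\<alpha>\<in>\<Psi>. \<alpha> y *s w \<alpha>) = (\<Sum>\<alpha>\<in>\<Psi>. \<alpha> (x * y) *s w \<alpha>)"
  unfolding diagonal_action_def
  by (rule sum.cong[OF HOL.refl])
    (simp add: eigen_coord_sum unital_hom.hom_mult[OF field_hom.axioms[OF field_hom_type]])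

lemma linear_diagonal_action: "Vector_Spaces.linear (*s) (*s) (diagonal_action x)"
  unfolding Vector_Spaces.linear_iff
  by (intro conjI allI vec.vector_space_axioms)
    (simp_all add: diagonal_action_def eigen_coord_add eigen_coord_scale distrib_left
      vec.scale_left_distrib
      sum.distrib vec.scale_sum_right mult.left_commute)

lemma diagonal_action_add: "diagonal_action (x + y) v = diagonal_action x v + diagonal_action y v"
  unfolding diagonal_action_def sum.distrib[symmetric]
  by (rule sum.cong[OF HOL.refl])
    (simp add: unital_hom.hom_add[OF field_hom.axioms[OF field_hom_type]] distrib_right
      vec.scale_left_distrib)

lemma diagonal_action_mult: "diagonal_action (x * y) = diagonal_action x \<circ> diagonal_action y"
proof
  fix v
  have "diagonal_action x (diagonal_action y v) = (\<Sum>\<alpha>\<in>\<Psi>. (\<alpha> x * (\<alpha> y * eigen_coord v \<alpha>)) *s w \<alpha>)"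
    unfolding diagonal_action_def[of x]
    by (rule sum.cong[OF HOL.refl]) (simp add: eigen_coord_diagonal_action)
  also have "\<dots> = diagonal_action (x * y) v"
    unfolding diagonal_action_def
    by (rule sum.cong[OF HOL.refl])
      (simp add: unital_hom.hom_mult[OF field_hom.axioms[OF field_hom_type]] mult.assoc)
  finally show "diagonal_action (x * y) v = (diagonal_action x \<circ> diagonal_action y) v" by simp
qed

lemma diagonal_action_eq_scale:
  assumes "\<And>\<alpha>. \<alpha> \<in> \<Psi> \<Longrightarrow> \<alpha> x = c"
  shows "diagonal_action x v = c *s v"
proof -
  have "diagonal_action x v = c *s (\<Sum>\<alpha>\<in>\<Psi>. eigen_coord v \<alpha> *s w \<alpha>)"
    by (simp add: diagonal_action_def assms vec.scale_sum_right)
  then show ?thesis by (simp add: sum_eigen_coord)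
qed

lemma inj_diagonal_action: "inj diagonal_action"
proof (rule injI)
  fix x y assume action_eq: "diagonal_action x = diagonal_action y"
  have "\<Psi> \<noteq> {}"
  proof
    assume "\<Psi> = {}"
    then have "(1 :: 'c ^ 'm) = 0" using sum_eigen_coord[of 1] by simp
    then show False by simp
  qed
  then obtain \<alpha> where \<alpha>_in_\<Psi>: "\<alpha> \<in> \<Psi>" by blast
  interpret \<alpha>: field_hom \<alpha> using \<alpha>_in_\<Psi> by (rule field_hom_type)
  have "eigen_coord (w \<alpha>) \<alpha> = 1"
    using \<alpha>_in_\<Psi> by (simp add: eigen_coord_def vec.representation_basis[OF independent_w])
  then have "eigen_coord (diagonal_action z (w \<alpha>)) \<alpha> = \<alpha> z" for z
    by (simp add: eigen_coord_diagonal_action[OF \<alpha>_in_\<Psi>])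
  then have "\<alpha> x = \<alpha> y" using action_eq by metis
  then show "x = y" by simp
qed

lemma has_CM_type_diagonal_action: "has_CM_type A diagonal_action \<Psi>"
  unfolding has_CM_type_def
proof (intro exI[of _ diagonal_action] exI[of _ eigen_coord] conjI ballI allI
    linear_diagonal_action diagonal_action_add diagonal_action_mult)
  have "diagonal_action 1 v = v" for v
    using diagonal_action_eq_scale[of 1 1 v] unital_hom.hom_one[OF field_hom.axioms[OF field_hom_type]]
    by simp
  then show "diagonal_action 1 = id" by (simp add: fun_eq_iff)
  show "bij_betw eigen_coord UNIV {f. \<forall>\<alpha>. \<alpha> \<notin> \<Psi> \<longrightarrow> f \<alpha> = 0}"
  proof (rule bij_betw_byWitness[where f' = "\<lambda>d. \<Sum>\<alpha>\<in>\<Psi>. d \<alpha> *s w \<alpha>"])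
    show "\<forall>v\<in>UNIV. (\<Sum>\<alpha>\<in>\<Psi>. eigen_coord v \<alpha> *s w \<alpha>) = v" by (simp add: sum_eigen_coord)
    show "\<forall>d\<in>{f. \<forall>\<alpha>. \<alpha> \<notin> \<Psi> \<longrightarrow> f \<alpha> = 0}. eigen_coord (\<Sum>\<alpha>\<in>\<Psi>. d \<alpha> *s w \<alpha>) = d"
    proof (intro ballI ext)
      fix d :: "('K \<Rightarrow> 'c) \<Rightarrow> 'c" and \<alpha> assume "d \<in> {f. \<forall>\<alpha>. \<alpha> \<notin> \<Psi> \<longrightarrow> f \<alpha> = 0}"
      then show "eigen_coord (\<Sum>\<alpha>\<in>\<Psi>. d \<alpha> *s w \<alpha>) \<alpha> = d \<alpha>"
        by (cases "\<alpha> \<in> \<Psi>") (simp_all add: eigen_coord_sum, simp add: eigen_coord_def)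
    qed
  qed (auto simp: eigen_coord_def)
qed (simp_all add: eigen_coord_add eigen_coord_scale eigen_coord_diagonal_action)

end

section \<open>The CM type of the dual\<close>

locale cm_type_dual_pair = cm_dual_pair \<iota> emb cabs \<alpha>\<^sub>0 L m M L' \<beta>
  for \<iota> :: "'k::{field,finite} poly fract \<Rightarrow> 'K::field"
    and emb :: "'k fls \<Rightarrow> 'c::field" and cabs \<alpha>\<^sub>0
    and L :: "('c ^ 'n) set" and m M :: "'K \<Rightarrow> 'c ^ 'n \<Rightarrow> 'c ^ 'n"
    and L' :: "('c ^ 'm) set" and \<beta> +
  fixes \<Phi> :: "('K \<Rightarrow> 'c) set" and g :: "'c ^ 'n \<Rightarrow> ('K \<Rightarrow> 'c) \<Rightarrow> 'c"
  assumes type_subset: "\<Phi> \<subseteq> embeddings emb \<iota>"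
    and bij_g: "bij_betw g UNIV {f. \<forall>\<alpha>. \<alpha> \<notin> \<Phi> \<longrightarrow> f \<alpha> = 0}"
    and g_add: "g (v + w) \<alpha> = g v \<alpha> + g w \<alpha>"
    and g_scale: "g (c *s v) \<alpha> = c * g v \<alpha>"
    and g_action: "\<alpha> \<in> \<Phi> \<Longrightarrow> g (M x v) \<alpha> = \<alpha> x * g v \<alpha>"
begin

lemma type_subset_extensions: "\<Phi> \<subseteq> extensions"
  using type_subset by (simp add: extensions_eq_embeddings)

lemma finite_type: "finite \<Phi>"
  using type_subset_extensions finite_extensions by (rule finite_subset)

lemma card_type_ge: "CARD('n) \<le> card \<Phi>"
proof -
  define \<delta> where "\<delta> \<alpha> = (\<lambda>\<gamma>::'K \<Rightarrow> 'c. if \<gamma> = \<alpha> then 1 else 0 :: 'c)" for \<alpha>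
  interpret vec_fun: finite_dimensional_vector_space_pair_1 "(*s)" cart_basis
    "scale_fun :: 'c \<Rightarrow> (('K \<Rightarrow> 'c) \<Rightarrow> 'c) \<Rightarrow> ('K \<Rightarrow> 'c) \<Rightarrow> 'c" ..
  have "Vector_Spaces.linear (*s) scale_fun g"
    unfolding Vector_Spaces.linear_iff
    by (intro conjI allI vec.vector_space_axioms fun_space.vector_space_axioms ext)
      (simp_all add: g_add g_scale)
  moreover have "inj g" using bij_g by (rule bij_betw_imp_inj_on)
  ultimately have "fun_space.dim (range g) = vec.dim (UNIV :: ('c ^ 'n) set)"
    by (intro vec_fun.dim_image_eq) (simp_all add: inj_on_subset)
  also have "\<dots> = CARD('n)" by (simp add: vec.dim_UNIV card_cart_basis)
  finally have dim_range: "fun_space.dim (range g) = CARD('n)" .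
  have "range g \<subseteq> fun_space.span (\<delta> ` \<Phi>)"
  proof
    fix f assume "f \<in> range g"
    then have zero: "f \<gamma> = 0" if "\<gamma> \<notin> \<Phi>" for \<gamma> using bij_betw_imp_surj_on[OF bij_g] that by blast
    have "f = (\<Sum>\<alpha>\<in>\<Phi>. scale_fun (f \<alpha>) (\<delta> \<alpha>))"
    proof
      show "f \<gamma> = (\<Sum>\<alpha>\<in>\<Phi>. scale_fun (f \<alpha>) (\<delta> \<alpha>)) \<gamma>" for \<gamma>
        using finite_type zero[of \<gamma>] by (simp add: \<delta>_def if_distrib[of "\<lambda>a. _ * a"] cong: if_cong)
    qed
    also have "\<dots> \<in> fun_space.span (\<delta> ` \<Phi>)"
      by (intro fun_space.span_sum fun_space.span_scale fun_space.span_base imageI)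
    finally show "f \<in> fun_space.span (\<delta> ` \<Phi>)" .
  qed
  then have "CARD('n) \<le> card (\<delta> ` \<Phi>)"
    unfolding dim_range[symmetric] by (rule fun_space.dim_le_card) (simp add: finite_type)
  also have "\<dots> \<le> card \<Phi>" by (rule card_image_le[OF finite_type])
  finally show ?thesis .
qed

lemma linear_component: "Vector_Spaces.linear (*s) (*) (\<lambda>v. g v \<alpha>)"
  unfolding Vector_Spaces.linear_iff
  by (intro conjI allI vec.vector_space_axioms g_add g_scale) (unfold_locales; simp add: algebra_simps)

lemma component_eq: "\<alpha> \<in> \<Phi> \<Longrightarrow> l \<in> L \<Longrightarrow> g l \<alpha> = g base_point \<alpha> * \<alpha> (to_K l)"
  using g_action[of \<alpha> "to_K l" base_point] orbit_to_K[of l] by (simp add: orbit_def mult.commute)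

lemma component_base_point_nonzero:
  assumes \<alpha>_in_\<Phi>: "\<alpha> \<in> \<Phi>"
  shows "g base_point \<alpha> \<noteq> 0"
proof
  assume "g base_point \<alpha> = 0"
  then have "L \<subseteq> {v. g v \<alpha> = 0}" using component_eq[OF \<alpha>_in_\<Phi>] by auto
  moreover have "vec.subspace {v. g v \<alpha> = 0}"
    using g_scale[of 0 0 \<alpha>] by (simp add: vec.subspace_def g_add g_scale)
  ultimately have "vec.span L \<subseteq> {v. g v \<alpha> = 0}" by (rule vec.span_minimal)
  then have "g v \<alpha> = 0" for v unfolding span_L_UNIV by blast
  moreover have "(\<lambda>\<gamma>. if \<gamma> = \<alpha> then 1 else 0) \<in> range g"
    unfolding bij_betw_imp_surj_on[OF bij_g] using \<alpha>_in_\<Phi> by auto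
  then obtain v where "(\<lambda>\<gamma>. if \<gamma> = \<alpha> then 1 else 0) = g v" by blast
  from fun_cong[OF this, of \<alpha>] have "g v \<alpha> = 1" by simp
  ultimately show False by simp
qed

lemma dual_vector_eq_0:
  assumes \<alpha>_in_\<Phi>: "\<alpha> \<in> \<Phi>"
  shows "dual_vector \<alpha> = 0"
proof -
  have "g base_point \<alpha> *s dual_vector \<alpha> = (\<Sum>b\<in>B. g b \<alpha> *s dual_basis b)"
    by (simp add: dual_vector_def vec.scale_sum_right component_eq[OF \<alpha>_in_\<Phi> B_in_L])
  also have "\<dots> = 0" by (rule sum_linear_form_dual_basis[OF linear_component])
  finally show ?thesis using component_base_point_nonzero[OF \<alpha>_in_\<Phi>] by simp
qed

definition dual_type :: "('K \<Rightarrow> 'c) set" where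
  "dual_type = extensions - \<Phi>"

lemma finite_dual_type: "finite dual_type"
  by (simp add: dual_type_def finite_extensions)

lemma dual_eq_sum_dual_type:
  assumes l'_in_L': "l' \<in> L'"
  shows "l' = (\<Sum>\<alpha>\<in>dual_type. \<alpha> (dual_to_K l') *s dual_vector \<alpha>)"
proof -
  have "(\<Sum>\<alpha>\<in>extensions. \<alpha> (dual_to_K l') *s dual_vector \<alpha>) =
      (\<Sum>\<alpha>\<in>dual_type. \<alpha> (dual_to_K l') *s dual_vector \<alpha>)"
    by (rule sum.mono_neutral_right) (auto simp: finite_extensions dual_type_def dual_vector_eq_0)
  then show ?thesis using dual_eq_sum_dual_vector[OF l'_in_L'] by simp
qed

lemma span_dual_vectors: "vec.span (dual_vector ` dual_type) = UNIV"
proof -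
  have "L' \<subseteq> vec.span (dual_vector ` dual_type)"
  proof
    fix l' assume "l' \<in> L'"
    then have "l' = (\<Sum>\<alpha>\<in>dual_type. \<alpha> (dual_to_K l') *s dual_vector \<alpha>)" by (rule dual_eq_sum_dual_type)
    also have "\<dots> \<in> vec.span (dual_vector ` dual_type)"
      by (intro vec.span_sum vec.span_scale vec.span_base imageI)
    finally show "l' \<in> vec.span (dual_vector ` dual_type)" .
  qed
  then have "vec.span L' \<subseteq> vec.span (dual_vector ` dual_type)"
    by (rule vec.span_minimal) (rule vec.subspace_span)
  then show ?thesis unfolding span_L'_UNIV by blast
qed

lemma card_dual_type_le: "card dual_type \<le> CARD('m)"
proof -
  have "card dual_type = card extensions - card \<Phi>"
    unfolding dual_type_def by (rule card_Diff_subset[OF finite_type type_subset_extensions])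
  then show ?thesis using card_extensions_le card_sum card_type_ge by linarith
qed

sublocale dual: eigenbasis dual_type dual_vector
proof (rule eigenbasis.intro)
  have dim_UNIV: "vec.dim (UNIV :: ('c ^ 'm) set) = CARD('m)" by (simp add: vec.dim_UNIV card_cart_basis)
  have "CARD('m) \<le> card (dual_vector ` dual_type)"
    using finite_dual_type span_dual_vectors unfolding dim_UNIV[symmetric] by (intro vec.dim_le_card) auto
  moreover have "card (dual_vector ` dual_type) \<le> card dual_type"
    by (rule card_image_le[OF finite_dual_type])
  ultimately have card_eq: "card (dual_vector ` dual_type) = card dual_type"
    "card (dual_vector ` dual_type) = CARD('m)"
    using card_dual_type_le by simp_all
  show "inj_on dual_vector dual_type" by (rule eq_card_imp_inj_on[OF finite_dual_type card_eq(1)])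
  show "vec.independent (dual_vector ` dual_type)"
    by (rule vec.card_le_dim_spanning[of _ UNIV])
      (use card_eq(2) dim_UNIV span_dual_vectors finite_dual_type in auto)
  show "field_hom \<alpha>" if "\<alpha> \<in> dual_type" for \<alpha> using that by (simp add: dual_type_def field_hom_extension)
qed (rule finite_dual_type span_dual_vectors)+

lemma diagonal_action_eq_dual_act:
  assumes "a \<in> A" "l' \<in> L'"
  shows "dual.diagonal_action a l' = dual_act a l'"
proof -
  have "dual.diagonal_action a l' = (\<Sum>\<alpha>\<in>dual_type. \<alpha> (a * dual_to_K l') *s dual_vector \<alpha>)"
    using dual.diagonal_action_eigen_sum[of a "dual_to_K l'"]
    by (simp only: dual_eq_sum_dual_type[OF assms(2), symmetric])
  also have "\<dots> = dual_act a l'"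
    using dual_eq_sum_dual_type[OF dual_act_closed[OF assms]] by (simp only: dual_to_K_dual_act[OF assms])
  finally show ?thesis .
qed

theorem complete_multiplication_dual:
  "complete_multiplication emb \<iota> L' dual.diagonal_action (embeddings emb \<iota> - \<Phi>)"
  unfolding complete_multiplication_def extensions_eq_embeddings[symmetric] dual_type_def[symmetric]
proof (intro conjI ballI allI dual.linear_diagonal_action dual.diagonal_action_add
  dual.diagonal_action_mult
    dual.has_CM_type_diagonal_action)
  show "dual_type \<subseteq> extensions" by (auto simp: dual_type_def)
  show "inj_on dual.diagonal_action A" using dual.inj_diagonal_action by (rule inj_on_subset) simp
  show "dual.diagonal_action a ` L' \<subseteq> L'" if "a \<in> A" for a
    using that by (auto simp: diagonal_action_eq_dual_act dual_act_closed)
  have "\<alpha> (P p) = eval_theta emb p" if "\<alpha> \<in> dual_type" for \<alpha> p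
    using that by (simp add: dual_type_def extensions_eq_embeddings embedding_poly_K)
  then show "dual.diagonal_action (P p) v = poly_scale emb p v" for p v
    unfolding poly_scale_def by (rule dual.diagonal_action_eq_scale)
qed

end

lemma CM_type_nonempty:
  fixes m :: "'K::field \<Rightarrow> 'c::field ^ 'n \<Rightarrow> 'c ^ 'n"
  assumes "has_CM_type A m \<Phi>"
  shows "\<Phi> \<noteq> {}"
proof
  assume "\<Phi> = {}"
  then obtain g :: "'c ^ 'n \<Rightarrow> ('K \<Rightarrow> 'c) \<Rightarrow> 'c" where g_bij: "bij_betw g UNIV {f. \<forall>\<alpha>. f \<alpha> = 0}"
    using assms unfolding has_CM_type_def by auto
  then have "g v = (\<lambda>_. 0)" for v using bij_betwE by fastforce
  then have "(1 :: 'c ^ 'n) = 0" using bij_betw_imp_inj_on[OF g_bij] by (intro injD[of g]) auto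
  then show False by simp
qed

lemma cm_type_dual_pair_exists:
  fixes m :: "'K::field \<Rightarrow> 'c::field ^ 'n \<Rightarrow> 'c ^ 'n"
  assumes C_infinity: "C_infinity emb cabs" and finite_separable: "finite_separable \<iota>"
    and lattice: "lattice_of_rank emb (degree_K \<iota>) L" "complete_multiplication emb \<iota> L m \<Phi>"
    and dual_pair: "dual_pair emb (degree_K \<iota>) L L' \<beta>"
  obtains \<alpha>\<^sub>0 M g where "cm_type_dual_pair \<iota> emb cabs \<alpha>\<^sub>0 L m M L' \<beta> \<Phi> g"
proof -
  have type_subset: "\<Phi> \<subseteq> embeddings emb \<iota>" and CM_type: "has_CM_type (ring_A \<iota>) m \<Phi>"
    and action_closed: "\<And>a l. a \<in> ring_A \<iota> \<Longrightarrow> l \<in> L \<Longrightarrow> m a l \<in> L"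
    and action_poly: "\<And>p v. m (poly_K \<iota> p) v = poly_scale emb p v"
    using lattice(2) unfolding complete_multiplication_def by (blast, blast, blast, blast)
  obtain \<alpha>\<^sub>0 where embedding: "\<alpha>\<^sub>0 \<in> embeddings emb \<iota>" using CM_type_nonempty[OF CM_type] type_subset
    by blast
  obtain M and g :: "'c ^ 'n \<Rightarrow> ('K \<Rightarrow> 'c) \<Rightarrow> 'c"
    where action_extension: "\<forall>a\<in>ring_A \<iota>. M a = m a" "\<forall>x. Vector_Spaces.linear (*s) (*s) (M x)" "M 1 = id"
      "\<forall>x y v. M (x + y) v = M x v + M y v" "\<forall>x y. M (x * y) = M x \<circ> M y"
    and eigen_iso: "bij_betw g UNIV {f. \<forall>\<alpha>. \<alpha> \<notin> \<Phi> \<longrightarrow> f \<alpha> = 0}" "\<forall>v w \<alpha>. g (v + w) \<alpha> = g v \<alpha> + g w \<alpha>"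
      "\<forall>c v \<alpha>. g (c *s v) \<alpha> = c * g v \<alpha>" "\<forall>x v. \<forall>\<alpha>\<in>\<Phi>. g (M x v) \<alpha> = \<alpha> x * g v \<alpha>"
    using CM_type unfolding has_CM_type_def by (elim exE conjE) (rule that; assumption)
  have "unital_ring_hom \<iota>" using finite_separable by (simp add: finite_separable_def)
  then have "embedded_extension \<iota> emb cabs \<alpha>\<^sub>0"
    using C_infinity finite_separable embedding
    by (intro embedded_extension.intro separable_extension.intro structure_map.intro
        separable_extension_axioms.intro embedded_extension_axioms.intro)
  then have "cm_type_dual_pair \<iota> emb cabs \<alpha>\<^sub>0 L m M L' \<beta> \<Phi> g"
    by (intro cm_type_dual_pair.intro cm_dual_pair.intro cm_lattice.intro cm_type_dual_pair_axioms.intro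
        cm_dual_pair_axioms.intro cm_lattice_axioms.intro)
      (use lattice(1) dual_pair action_closed action_poly type_subset action_extension eigen_iso in
        simp_all)
  then show ?thesis by (rule that)
qed

theorem theorem13p1:
  fixes emb :: "'k::{field,finite} fls \<Rightarrow> 'c::field"
    and cabs :: "'c \<Rightarrow> real"
    and \<iota> :: "'k poly fract \<Rightarrow> 'K::field"
    and r :: nat
    and L :: "('c ^ 'n) set"
    and L' :: "('c ^ 'm) set"
    and m :: "'K \<Rightarrow> 'c ^ 'n \<Rightarrow> 'c ^ 'n"
    and \<Phi> \<Phi>' :: "('K \<Rightarrow> 'c) set"
    and \<beta> :: "'c ^ 'n \<Rightarrow> 'c ^ 'm \<Rightarrow> 'k poly"
  assumes "C_infinity emb cabs"
    and "finite_separable \<iota>"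
    and "tensor_domain (const_K \<iota>) (const_C emb)"
    and "\<exists>!R. R \<in> places \<iota> \<and> over_infinity \<iota> R"
    and "r = degree_K \<iota>"
    and "lattice_of_rank emb r L"
    and "complete_multiplication emb \<iota> L m \<Phi>"
    and "dual_pair emb r L L' \<beta>"
    and "\<Phi>' = embeddings emb \<iota> - \<Phi>"
  shows "(\<exists>m'. complete_multiplication emb \<iota> L' m' \<Phi>' \<and>
               (\<forall>a\<in>ring_A \<iota>. \<forall>l'\<in>L'. m' a l' = dual_action \<beta> L L' m a l')) \<and>
         module_class (ring_A \<iota>) (dual_action \<beta> L L' m) L' =
           inv\<^bsub>class_group (ring_A \<iota>)\<^esub> (ideal_class (ring_A \<iota>) (different \<iota>)) \<otimes>\<^bsub>class_group (ring_A \<iota>)\<^esub>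
           inv\<^bsub>class_group (ring_A \<iota>)\<^esub> (module_class (ring_A \<iota>) m L)"
proof -
  obtain \<alpha>\<^sub>0 M g where "cm_type_dual_pair \<iota> emb cabs \<alpha>\<^sub>0 L m M L' \<beta> \<Phi> g"
    by (rule cm_type_dual_pair_exists[OF assms(1,2,6,7,8)[unfolded assms(5)]])
  then interpret cm_type_dual_pair \<iota> emb cabs \<alpha>\<^sub>0 L m M L' \<beta> \<Phi> g .
  show ?thesis
    unfolding assms(9)
    using complete_multiplication_dual diagonal_action_eq_dual_act module_class_dual by blast
qed

end
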